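(* Let $\mathcal{R}$ be a tolerance relation on $X=\{1,\dots,n\}$ with chordal graph $G(\mathcal{R})$, and let $\mathcal{C}$ be the set of maximal cliques of $G(\mathcal{R})$. Then $$C^*_{\mathrm{env}}(E(\mathcal{R})^d)\cong\bigoplus_{C\in\mathcal{C}}M_{|C|}(\mathbb{C}),$$ and the $C^*$-envelope is realized by the complete order embedding $\Phi:E(\mathcal{R})^d\to\bigoplus_{C\in\mathcal{C}}M_{|C|}(\mathbb{C})$, $(x_{ij})\mapsto((x_{ij})_{i,j\in C})_{C\in\mathcal{C}}$.
   Context: A tolerance relation on $X=\{1,\dots,n\}$ is a reflexive symmetric relation $\mathcal{R}\subseteq X\times X$; its graph $G(\mathcal{R})$ has vertex set $X$ and an edge between distinct $i,j$ iff $(i,j)\in\mathcal{R}$. A graph is chordal if every cycle of length at least 4 has a chord. $E(\mathcal{R})=\{(x_{ij})\in M_n(\mathbb{C})\mid x_{ij}=0\text{ if }(i,j)\notin\mathcal{R}\}$. The dual operator system $E(\mathcal{R})^d$ is identified with the $*$-vector space $E(\mathcal{R})$ with matrix order $M_m(E(\mathcal{R})^d)_+=\{M\in M_m(E(\mathcal{R}))\mid\exists N\in M_m(E(\mathcal{R})^\perp),\ M+N\in M_{mn}(\mathbb{C})_+\}$, where $E(\mathcal{R})^\perp=\{y\in M_n(\mathbb{C})\mid y_{ij}=0\ \forall(i,j)\in\mathcal{R}\}$, and with the identity matrix as order unit. A $C^*$-extension of an operator system $E$ is a unital complete order embedding $\iota:E\to A$ into a unital $C^*$-algebra with $C^*(\iota(E))=A$;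 the $C^*$-envelope $C^*_{\mathrm{env}}(E)$ is a $C^*$-extension $\iota:E\to A$ such that for every $C^*$-extension $\kappa:E\to B$ there is a unique $*$-homomorphism $\psi:B\to A$ with $\psi\circ\kappa=\iota$. *)

theory Defs
  imports Complex_Main
begin

record 'a cstar_alg =
  carrier :: "'a set"
  ca_zero :: 'a
  ca_one :: 'a
  ca_add :: "'a \<Rightarrow> 'a \<Rightarrow> 'a"
  ca_smult :: "complex \<Rightarrow> 'a \<Rightarrow> 'a"
  ca_mul :: "'a \<Rightarrow> 'a \<Rightarrow> 'a"
  ca_star :: "'a \<Rightarrow> 'a"
  ca_norm :: "'a \<Rightarrow> real"

definition ca_sub :: "('a, 'm) cstar_alg_scheme \<Rightarrow> 'a \<Rightarrow> 'a \<Rightarrow> 'a" where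
  "ca_sub A x y = ca_add A x (ca_smult A (-1) y)"

definition unital_cstar_algebra :: "('a, 'm) cstar_alg_scheme \<Rightarrow> bool" where
  "unital_cstar_algebra A \<longleftrightarrow>
     ca_zero A \<in> carrier A \<and> ca_one A \<in> carrier A \<and>
     (\<forall>x\<in>carrier A. \<forall>y\<in>carrier A. ca_add A x y \<in> carrier A \<and> ca_mul A x y \<in> carrier A) \<and>
     (\<forall>c. \<forall>x\<in>carrier A. ca_smult A c x \<in> carrier A) \<and>
     (\<forall>x\<in>carrier A. ca_star A x \<in> carrier A) \<and>
     \<comment> \<open>complex vector space\<close>
     (\<forall>x\<in>carrier A. \<forall>y\<in>carrier A. \<forall>z\<in>carrier A.
         ca_add A (ca_add A x y) z = ca_add A x (ca_add A y z)) \<and>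
     (\<forall>x\<in>carrier A. \<forall>y\<in>carrier A. ca_add A x y = ca_add A y x) \<and>
     (\<forall>x\<in>carrier A. ca_add A x (ca_zero A) = x) \<and>
     (\<forall>x\<in>carrier A. \<exists>y\<in>carrier A. ca_add A x y = ca_zero A) \<and>
     (\<forall>c. \<forall>x\<in>carrier A. \<forall>y\<in>carrier A.
         ca_smult A c (ca_add A x y) = ca_add A (ca_smult A c x) (ca_smult A c y)) \<and>
     (\<forall>c d. \<forall>x\<in>carrier A. ca_smult A (c + d) x = ca_add A (ca_smult A c x) (ca_smult A d x)) \<and>
     (\<forall>c d. \<forall>x\<in>carrier A. ca_smult A (c * d) x = ca_smult A c (ca_smult A d x)) \<and>
     (\<forall>x\<in>carrier A. ca_smult A 1 x = x) \<and>
     \<comment> \<open>associative unital algebra\<close>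
     (\<forall>x\<in>carrier A. \<forall>y\<in>carrier A. \<forall>z\<in>carrier A.
         ca_mul A (ca_mul A x y) z = ca_mul A x (ca_mul A y z) \<and>
         ca_mul A x (ca_add A y z) = ca_add A (ca_mul A x y) (ca_mul A x z) \<and>
         ca_mul A (ca_add A x y) z = ca_add A (ca_mul A x z) (ca_mul A y z)) \<and>
     (\<forall>c. \<forall>x\<in>carrier A. \<forall>y\<in>carrier A.
         ca_mul A (ca_smult A c x) y = ca_smult A c (ca_mul A x y) \<and>
         ca_mul A x (ca_smult A c y) = ca_smult A c (ca_mul A x y)) \<and>
     (\<forall>x\<in>carrier A. ca_mul A (ca_one A) x = x \<and> ca_mul A x (ca_one A) = x) \<and>
     \<comment> \<open>involution\<close>
     (\<forall>x\<in>carrier A. ca_star A (ca_star A x) = x) \<and>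
     (\<forall>x\<in>carrier A. \<forall>y\<in>carrier A.
         ca_star A (ca_add A x y) = ca_add A (ca_star A x) (ca_star A y) \<and>
         ca_star A (ca_mul A x y) = ca_mul A (ca_star A y) (ca_star A x)) \<and>
     (\<forall>c. \<forall>x\<in>carrier A. ca_star A (ca_smult A c x) = ca_smult A (cnj c) (ca_star A x)) \<and>
     \<comment> \<open>C*-norm\<close>
     (\<forall>x\<in>carrier A. ca_norm A x \<ge> 0 \<and> (ca_norm A x = 0 \<longleftrightarrow> x = ca_zero A)) \<and>
     (\<forall>x\<in>carrier A. \<forall>y\<in>carrier A.
         ca_norm A (ca_add A x y) \<le> ca_norm A x + ca_norm A y \<and>
         ca_norm A (ca_mul A x y) \<le> ca_norm A x * ca_norm A y) \<and>
     (\<forall>c. \<forall>x\<in>carrier A. ca_norm A (ca_smult A c x) = cmod c * ca_norm A x) \<and>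
     (\<forall>x\<in>carrier A. ca_norm A (ca_mul A (ca_star A x) x) = (ca_norm A x)\<^sup>2) \<and>
     \<comment> \<open>completeness\<close>
     (\<forall>f. (\<forall>k. f k \<in> carrier A) \<and>
          (\<forall>e>0. \<exists>N. \<forall>k\<ge>N. \<forall>l\<ge>N. ca_norm A (ca_sub A (f k) (f l)) < e) \<longrightarrow>
          (\<exists>L\<in>carrier A. (\<lambda>k. ca_norm A (ca_sub A (f k) L)) \<longlonglongrightarrow> 0))"

definition ca_sum :: "('a, 'm) cstar_alg_scheme \<Rightarrow> (nat \<Rightarrow> 'a) \<Rightarrow> nat \<Rightarrow> 'a" where
  "ca_sum A f m = foldr (\<lambda>k acc. ca_add A (f k) acc) [0..<m] (ca_zero A)"

definition mat_pos :: "('a, 'm) cstar_alg_scheme \<Rightarrow> nat \<Rightarrow> (nat \<Rightarrow> nat \<Rightarrow> 'a) \<Rightarrow> bool" where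
  "mat_pos A m P \<longleftrightarrow>
     (\<forall>a<m. \<forall>b<m. P a b \<in> carrier A) \<and>
     (\<exists>Y. (\<forall>a<m. \<forall>b<m. Y a b \<in> carrier A) \<and>
          (\<forall>a<m. \<forall>b<m. P a b = ca_sum A (\<lambda>k. ca_mul A (ca_star A (Y k a)) (Y k b)) m))"

definition cstar_gen :: "('a, 'm) cstar_alg_scheme \<Rightarrow> 'a set \<Rightarrow> 'a set" where
  "cstar_gen A S = \<Inter> {T. S \<subseteq> T \<and> T \<subseteq> carrier A \<and> ca_one A \<in> T \<and> ca_zero A \<in> T \<and>
        (\<forall>x\<in>T. \<forall>y\<in>T. ca_add A x y \<in> T \<and> ca_mul A x y \<in> T) \<and>
        (\<forall>c. \<forall>x\<in>T. ca_smult A c x \<in> T) \<and> (\<forall>x\<in>T. ca_star A x \<in> T) \<and>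
        (\<forall>f L. (\<forall>k. f k \<in> T) \<and> L \<in> carrier A \<and>
               (\<lambda>k. ca_norm A (ca_sub A (f k) L)) \<longlonglongrightarrow> 0 \<longrightarrow> L \<in> T)}"

definition star_hom :: "('b, 'm) cstar_alg_scheme \<Rightarrow> ('a, 'n) cstar_alg_scheme \<Rightarrow> ('b \<Rightarrow> 'a) \<Rightarrow> bool" where
  "star_hom B A \<psi> \<longleftrightarrow>
     (\<forall>x\<in>carrier B. \<psi> x \<in> carrier A) \<and>
     (\<forall>x\<in>carrier B. \<forall>y\<in>carrier B.
        \<psi> (ca_add B x y) = ca_add A (\<psi> x) (\<psi> y) \<and> \<psi> (ca_mul B x y) = ca_mul A (\<psi> x) (\<psi> y)) \<and>
     (\<forall>c. \<forall>x\<in>carrier B. \<psi> (ca_smult B c x) = ca_smult A c (\<psi> x)) \<and>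
     (\<forall>x\<in>carrier B. \<psi> (ca_star B x) = ca_star A (\<psi> x))"

text \<open>X = {1..n}; matrices are functions nat => nat => complex supported on X x X.\<close>

definition tol_rel :: "nat \<Rightarrow> (nat \<times> nat) set \<Rightarrow> bool" where
  "tol_rel n R \<longleftrightarrow> R \<subseteq> {1..n} \<times> {1..n} \<and> (\<forall>i\<in>{1..n}. (i, i) \<in> R) \<and> sym R"

definition adj :: "(nat \<times> nat) set \<Rightarrow> nat \<Rightarrow> nat \<Rightarrow> bool" where
  "adj R i j \<longleftrightarrow> i \<noteq> j \<and> (i, j) \<in> R"

definition chordal :: "nat \<Rightarrow> (nat \<times> nat) set \<Rightarrow> bool" where
  "chordal n R \<longleftrightarrow>
     (\<forall>vs. 4 \<le> length vs \<and> distinct vs \<and> set vs \<subseteq> {1..n} \<and>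
        (\<forall>i<length vs. adj R (vs ! i) (vs ! ((i + 1) mod length vs))) \<longrightarrow>
        (\<exists>i<length vs. \<exists>j<length vs. i \<noteq> j \<and> j \<noteq> (i + 1) mod length vs \<and>
             i \<noteq> (j + 1) mod length vs \<and> adj R (vs ! i) (vs ! j)))"

definition is_clique :: "nat \<Rightarrow> (nat \<times> nat) set \<Rightarrow> nat set \<Rightarrow> bool" where
  "is_clique n R C \<longleftrightarrow> C \<subseteq> {1..n} \<and> (\<forall>i\<in>C. \<forall>j\<in>C. i \<noteq> j \<longrightarrow> adj R i j)"

definition max_cliques :: "nat \<Rightarrow> (nat \<times> nat) set \<Rightarrow> nat set set" where
  "max_cliques n R = {C. is_clique n R C \<and> (\<forall>C'. is_clique n R C' \<and> C \<subseteq> C' \<longrightarrow> C' = C)}"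

definition ER :: "nat \<Rightarrow> (nat \<times> nat) set \<Rightarrow> (nat \<Rightarrow> nat \<Rightarrow> complex) set" where
  "ER n R = {x. \<forall>i j. (i, j) \<notin> R \<longrightarrow> x i j = 0}"

definition ER_perp :: "nat \<Rightarrow> (nat \<times> nat) set \<Rightarrow> (nat \<Rightarrow> nat \<Rightarrow> complex) set" where
  "ER_perp n R = {y. (\<forall>i j. (i, j) \<in> R \<longrightarrow> y i j = 0) \<and>
                     (\<forall>i j. (i, j) \<notin> {1..n} \<times> {1..n} \<longrightarrow> y i j = 0)}"

text \<open>An element of M_m(M_n(C)) = M_(mn)(C) (block (a,b), entry (i,j)) is positive
  semidefinite iff v* K v >= 0 for all v in C^(mn).\<close>
definition psd_block :: "nat \<Rightarrow> nat \<Rightarrow> (nat \<Rightarrow> nat \<Rightarrow> nat \<Rightarrow> nat \<Rightarrow> complex) \<Rightarrow> bool" where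
  "psd_block n m K \<longleftrightarrow>
     (\<forall>v :: nat \<Rightarrow> nat \<Rightarrow> complex.
        (\<Sum>a<m. \<Sum>b<m. \<Sum>i\<in>{1..n}. \<Sum>j\<in>{1..n}. cnj (v a i) * K a b i j * v b j) \<in> \<real> \<and>
        Re (\<Sum>a<m. \<Sum>b<m. \<Sum>i\<in>{1..n}. \<Sum>j\<in>{1..n}. cnj (v a i) * K a b i j * v b j) \<ge> 0)"

definition ERd_pos :: "nat \<Rightarrow> (nat \<times> nat) set \<Rightarrow> nat \<Rightarrow> (nat \<Rightarrow> nat \<Rightarrow> (nat \<Rightarrow> nat \<Rightarrow> complex)) \<Rightarrow> bool" where
  "ERd_pos n R m M \<longleftrightarrow>
     (\<forall>a<m. \<forall>b<m. M a b \<in> ER n R) \<and>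
     (\<exists>N. (\<forall>a<m. \<forall>b<m. N a b \<in> ER_perp n R) \<and>
          psd_block n m (\<lambda>a b i j. M a b i j + N a b i j))"

definition idX :: "nat \<Rightarrow> nat \<Rightarrow> nat \<Rightarrow> complex" where
  "idX n = (\<lambda>i j. if i = j \<and> i \<in> {1..n} then 1 else 0)"

definition complete_order_embedding ::
  "nat \<Rightarrow> (nat \<times> nat) set \<Rightarrow> ('a, 'm) cstar_alg_scheme \<Rightarrow> ((nat \<Rightarrow> nat \<Rightarrow> complex) \<Rightarrow> 'a) \<Rightarrow> bool" where
  "complete_order_embedding n R A \<iota> \<longleftrightarrow>
     (\<forall>x\<in>ER n R. \<iota> x \<in> carrier A) \<and>
     (\<forall>x\<in>ER n R. \<forall>y\<in>ER n R. \<iota> (\<lambda>i j. x i j + y i j) = ca_add A (\<iota> x) (\<iota> y)) \<and>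
     (\<forall>c. \<forall>x\<in>ER n R. \<iota> (\<lambda>i j. c * x i j) = ca_smult A c (\<iota> x)) \<and>
     inj_on \<iota> (ER n R) \<and>
     \<iota> (idX n) = ca_one A \<and>
     (\<forall>m M. (\<forall>a<m. \<forall>b<m. M a b \<in> ER n R) \<longrightarrow>
        (ERd_pos n R m M \<longleftrightarrow> mat_pos A m (\<lambda>a b. \<iota> (M a b))))"

definition cstar_extension ::
  "nat \<Rightarrow> (nat \<times> nat) set \<Rightarrow> ('a, 'm) cstar_alg_scheme \<Rightarrow> ((nat \<Rightarrow> nat \<Rightarrow> complex) \<Rightarrow> 'a) \<Rightarrow> bool" where
  "cstar_extension n R A \<iota> \<longleftrightarrow>
     unital_cstar_algebra A \<and> complete_order_embedding n R A \<iota> \<and>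
     cstar_gen A (\<iota> ` ER n R) = carrier A"

definition envelope_factors ::
  "nat \<Rightarrow> (nat \<times> nat) set \<Rightarrow> ('a, 'm) cstar_alg_scheme \<Rightarrow> ((nat \<Rightarrow> nat \<Rightarrow> complex) \<Rightarrow> 'a)
     \<Rightarrow> ('b, 'k) cstar_alg_scheme \<Rightarrow> ((nat \<Rightarrow> nat \<Rightarrow> complex) \<Rightarrow> 'b) \<Rightarrow> bool" where
  "envelope_factors n R A \<iota> B \<kappa> \<longleftrightarrow>
     (\<exists>\<psi>. star_hom B A \<psi> \<and> (\<forall>x\<in>ER n R. \<psi> (\<kappa> x) = \<iota> x) \<and>
          (\<forall>\<psi>'. star_hom B A \<psi>' \<and> (\<forall>x\<in>ER n R. \<psi>' (\<kappa> x) = \<iota> x) \<longrightarrow>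
                 (\<forall>b\<in>carrier B. \<psi>' b = \<psi> b)))"

text \<open>An element of the direct sum is F :: nat set => nat => nat => complex, where the
  block at the clique C is the |C| x |C| matrix (F C i j) for i, j in C.\<close>

definition blk_opnorm :: "nat set \<Rightarrow> (nat \<Rightarrow> nat \<Rightarrow> complex) \<Rightarrow> real" where
  "blk_opnorm C K = Sup {sqrt (\<Sum>i\<in>C. (cmod (\<Sum>j\<in>C. K i j * v j))\<^sup>2) | v.
                          (\<Sum>j\<in>C. (cmod (v j))\<^sup>2) \<le> 1}"

definition block_alg :: "nat \<Rightarrow> (nat \<times> nat) set \<Rightarrow> (nat set \<Rightarrow> nat \<Rightarrow> nat \<Rightarrow> complex) cstar_alg" where
  "block_alg n R =
    \<lparr> carrier = {F. \<forall>C i j. \<not> (C \<in> max_cliques n R \<and> i \<in> C \<and> j \<in> C) \<longrightarrow> F C i j = 0},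
      ca_zero = (\<lambda>C i j. 0),
      ca_one = (\<lambda>C i j. if C \<in> max_cliques n R \<and> i \<in> C \<and> i = j then 1 else 0),
      ca_add = (\<lambda>F G C i j. F C i j + G C i j),
      ca_smult = (\<lambda>c F C i j. c * F C i j),
      ca_mul = (\<lambda>F G C i j. \<Sum>k\<in>C. F C i k * G C k j),
      ca_star = (\<lambda>F C i j. cnj (F C j i)),
      ca_norm = (\<lambda>F. Sup (insert 0 ((\<lambda>C. blk_opnorm C (F C)) ` max_cliques n R))) \<rparr>"

definition Phi :: "nat \<Rightarrow> (nat \<times> nat) set \<Rightarrow> (nat \<Rightarrow> nat \<Rightarrow> complex) \<Rightarrow> (nat set \<Rightarrow> nat \<Rightarrow> nat \<Rightarrow> complex)" where
  "Phi n R x = (\<lambda>C i j. if C \<in> max_cliques n R \<and> i \<in> C \<and> j \<in> C then x i j else 0)"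

end

theory Submission
  imports Defs "HOL-Analysis.Analysis" "HOL-Library.Complex_Order"
begin

text \<open>
  Chordality enters only in showing that \<open>\<Phi>\<close> is a complete order embedding: a chordal graph that is
  not complete is glued from two smaller chordal graphs along a clique, and positive semidefinite
  matrices that agree on an overlap can be amalgamated. Hence a partial matrix all of whose clique
  blocks are positive has a positive completion.

  For the universal property, let \<open>\<kappa>\<close> be an arbitrary C*-extension into \<open>B\<close> and put
  \<open>x\<^sub>i\<^sub>j = \<kappa>(e\<^sub>i\<^sub>j)\<close> for \<open>(i, j) \<in> R\<close> and \<open>x\<^sub>i\<^sub>j = 0\<close> otherwise. The matrix \<open>(x\<^sub>i\<^sub>j)\<close> is positive over \<open>B\<close>, so
  \<open>x\<^sub>i\<^sub>j = Y\<^sub>i\<^sup>* Y\<^sub>j\<close> for columns \<open>Y\<^sub>i\<close>. For a maximal clique \<open>C\<close> the matrix \<open>t - (x\<^sub>i\<^sub>j)\<^sub>C / |C|\<close> is not positive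
  when \<open>t < 1\<close>, so that \<open>(x\<^sub>i\<^sub>j)\<^sub>C\<close> has approximate eigenvectors \<open>(c\<^sub>k)\<close> for the eigenvalue \<open>|C|\<close>. They
  satisfy \<open>Y\<^sub>j c\<^sub>j \<approx> Y\<^sub>k c\<^sub>k\<close> for \<open>j, k \<in> C\<close> and \<open>Y\<^sub>j c\<^sub>k \<approx> 0\<close> for \<open>j \<noteq> k\<close>. Since a vertex \<open>l \<notin> C\<close> is not
  adjacent to some \<open>k \<in> C\<close>, this gives \<open>x\<^sub>l\<^sub>j c\<^sub>j \<approx> x\<^sub>l\<^sub>k c\<^sub>k = 0\<close>, so asymptotically every \<open>\<kappa>(x)\<close> acts on the
  \<open>c\<^sub>k\<close> as the block of \<open>x\<close> at \<open>C\<close>. The elements of \<open>B\<close> acting asymptotically as a matrix form a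
  C*-subalgebra, which is therefore all of \<open>B\<close>, and the matrix is the image under the required
  homomorphism.
\<close>

section \<open>Unital C*-algebras as a type class\<close>

text \<open>\<open>B\<close> comes without a Hilbert space, and an eigenvalue need not have an
  eigenvector. The vectors are therefore elements of the algebra, acted on by left multiplication:
  columns of powers of \<open>a = (x_ij)_C / card C\<close>. Dividing by \<open>card C\<close>
  normalizes the extreme eigenvalue to 1, since the full matrix of matrix units over
  \<open>C\<close> is \<open>card C\<close> times a projection. Positivity of a matrix over
  \<open>B\<close> means that it has a factorization, so non-positivity of \<open>t - a\<close> is
  exploited by showing that decaying powers of \<open>a\<close> would yield one. The binomial series
  of the square root produces it from bounds on the entries alone, hence without a norm on matrices
  over \<open>B\<close>. That the columns are nearly fixed by \<open>a\<close> is read off from a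
  decomposition of \<open>1 - a\<close> into squares; it requires positivity of
  \<open>star d * d\<close> in every C*-algebra, which is derived from norm estimates instead of
  spectral theory. Finally, \<open>star_hom\<close> is a purely algebraic notion, so uniqueness of
  the factorization needs a separate argument that such maps into the blocks are continuous.\<close>

text \<open>The class does not contain \<open>0 \<noteq> 1\<close>, so that the zero algebra is allowed; \<open>cc c\<close> is the
  scalar \<open>c\<close> times the unit.\<close>

class cstar = real_normed_algebra + banach + monoid_mult +
  fixes star :: "'a \<Rightarrow> 'a" and cc :: "complex \<Rightarrow> 'a"
  assumes star_star [simp]: "star (star x) = x"
    and star_add: "star (x + y) = star x + star y"
    and star_mult: "star (x * y) = star y * star x"
    and cc_add: "cc (a + b) = cc a + cc b"
    and cc_mult: "cc (a * b) = cc a * cc b"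
    and cc_one [simp]: "cc 1 = 1"
    and cc_commute: "cc a * x = x * cc a"
    and star_cc: "star (cc a) = cc (cnj a)"
    and scaleR_cc: "scaleR r x = cc (complex_of_real r) * x"
    and norm_cc_mult: "norm (cc a * x) = cmod a * norm x"
    and norm_star_mult: "norm (star x * x) = (norm x)\<^sup>2"

section \<open>Taylor coefficients of the square root of 1 - z\<close>

definition sqc :: "nat \<Rightarrow> real" where
  "sqc k = (1/2 gchoose k) * (-1) ^ k"

lemma sqc_0 [simp]: "sqc 0 = 1"
  by (simp add: sqc_def)

lemma gchoose_neg_half: "(-1) ^ m * (-1/2 gchoose m) \<ge> (0::real)"
proof -
  have "pochhammer (1/2) m \<ge> (0::real)"
    by (intro pochhammer_nonneg) auto
  then show ?thesis
    by (simp add: gbinomial_pochhammer power_mult_distrib[symmetric] mult.assoc[symmetric])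
qed

text \<open>Absorption rewrites the binomial coefficient of 1/2 at \<open>k\<close> by that of -1/2
  at \<open>k - 1\<close>, whose sign is known. Knowing all signs is what turns a bound on partial
  sums into absolute summability.\<close>

lemma sqc_nonpos:
  assumes "k \<ge> 1"
  shows "sqc k \<le> 0"
proof -
  obtain m where k: "k = Suc m"
    using assms by (cases k) auto
  have "sqc k = - ((1/2) / real (Suc m) * ((-1) ^ m * (-1/2 gchoose m)))"
    unfolding sqc_def k gbinomial_absorption'[of "Suc m" "1/2"]
    using gbinomial_absorption'[of "Suc m" "1/2::real"] by simp
  moreover have "(1/2) / real (Suc m) * ((-1) ^ m * (-1/2 gchoose m)) \<ge> (0::real)"
    by (rule mult_nonneg_nonneg[OF _ gchoose_neg_half]) simp
  ultimately show ?thesis by simp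
qed

text \<open>The alternating partial sum of binomial coefficients of 1/2 collapses to a single
  binomial coefficient of -1/2 with its sign.\<close>

lemma sum_sqc_nonneg: "(\<Sum>k\<le>m. sqc k) \<ge> 0"
  using gbinomial_sum_lower_neg[of "1/2::real" m] gchoose_neg_half[of m]
  by (simp add: sqc_def)

text \<open>Only the constant term is positive and the partial sums stay nonnegative, so the
  remaining terms have total weight at most 1. Hence the series may be used up to and including
  radius 1.\<close>

lemma sum_abs_sqc_Suc: "(\<Sum>k<m. \<bar>sqc (Suc k)\<bar>) \<le> 1"
proof -
  have "(\<Sum>k\<le>m. sqc k) = 1 + (\<Sum>k<m. sqc (Suc k))"
    unfolding lessThan_Suc_atMost[symmetric] sum.lessThan_Suc_shift by simp
  moreover have "(\<Sum>k<m. \<bar>sqc (Suc k)\<bar>) = - (\<Sum>k<m. sqc (Suc k))"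
    using sqc_nonpos by (simp add: sum_negf[symmetric])
  ultimately show ?thesis
    using sum_sqc_nonneg[of m] by linarith
qed

lemma summable_abs_sqc_Suc: "summable (\<lambda>k. \<bar>sqc (Suc k)\<bar>)"
  by (rule summableI_nonneg_bounded[OF _ sum_abs_sqc_Suc]) auto

lemma summable_abs_sqc: "summable (\<lambda>k. \<bar>sqc k\<bar>)"
  using summable_abs_sqc_Suc summable_Suc_iff[of "\<lambda>k. \<bar>sqc k\<bar>"] by simp

lemma suminf_abs_sqc_Suc: "(\<Sum>k. \<bar>sqc (Suc k)\<bar>) \<le> 1"
  by (rule suminf_le_const[OF summable_abs_sqc_Suc sum_abs_sqc_Suc])

lemma abs_sqc_le: "\<bar>sqc k\<bar> \<le> 1"
proof (cases k)
  case (Suc m)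
  have "\<bar>sqc (Suc m)\<bar> \<le> (\<Sum>k<Suc m. \<bar>sqc (Suc k)\<bar>)"
    by (rule member_le_sum) auto
  then show ?thesis
    unfolding Suc using sum_abs_sqc_Suc[of "Suc m"] by linarith
qed simp

text \<open>The squared series is 1 - z: Vandermonde's identity at 1/2 + 1/2 leaves the binomial
  coefficients of 1.\<close>

lemma sqc_convolution:
  "(\<Sum>i\<le>k. sqc i * sqc (k - i)) = (if k = 0 then 1 else if k = 1 then -1 else 0)"
proof -
  have "(\<Sum>i\<le>k. sqc i * sqc (k - i)) = (\<Sum>i\<le>k. (-1) ^ k * ((1/2 gchoose i) * (1/2 gchoose (k - i))))"
    by (rule sum.cong) (auto simp: sqc_def power_add[symmetric])
  also have "\<dots> = (-1) ^ k * ((1::real) gchoose k)"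
    using gbinomial_Vandermonde[of "1/2::real" "1/2" k]
    by (simp add: sum_distrib_left[symmetric] atLeast0AtMost)
  also have "((1::real) gchoose k) = (1 choose k)"
    using binomial_gbinomial[of 1 k, where 'a = real] by simp
  also have "(-1) ^ k * real (1 choose k) = (if k = 0 then 1 else if k = 1 then -1 else 0)"
    by (auto simp: binomial_eq_0)
  finally show ?thesis .
qed

section \<open>Elementary consequences of the C*-axioms\<close>

lemma star_zero [simp]: "star 0 = (0::'a::cstar)"
  using star_add[of "0::'a" 0] by simp

lemma star_one [simp]: "star 1 = (1::'a::cstar)"
  using star_mult[of "star 1" "1::'a"] by simp

lemma star_minus: "star (- x) = - star x"
  using star_add[of x "- x"] by (simp add: eq_neg_iff_add_eq_0 add.commute)

lemma star_diff: "star (x - y) = star x - star y"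
  using star_add[of x "- y"] by (simp add: star_minus)

lemma star_sum: "star (sum f A) = (\<Sum>i\<in>A. star (f i))"
  by (induction A rule: infinite_finite_induct) (auto simp: star_add)

lemma star_scaleR: "star (scaleR r x) = scaleR r (star x)"
  by (simp add: scaleR_cc star_mult star_cc cc_commute)

lemma star_power: "star x = x \<Longrightarrow> star (x ^ k) = x ^ k"
  by (induction k) (auto simp: star_mult power_commutes)

lemma cc_zero [simp]: "cc 0 = (0::'a::cstar)"
  using cc_add[of 0 0, where 'a = 'a] by simp

lemma norm_star: "norm (star x) = norm x"
proof -
  have *: "norm y \<le> norm (star y)" for y
  proof (cases "norm y = 0")
    case False
    have "norm y * norm y \<le> norm (star y) * norm y"
      using norm_star_mult[of y] norm_mult_ineq[of "star y" y] by (simp add: power2_eq_square)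
    then show ?thesis using False by (simp add: mult_le_cancel_right)
  qed (simp only: norm_ge_zero)
  show ?thesis using *[of x] *[of "star x"] by simp
qed

text \<open>Only an inequality, because the unit of the zero algebra has norm 0.\<close>

lemma norm_one_le: "norm (1::'a::cstar) \<le> 1"
proof -
  have "norm (1::'a) * norm (1::'a) = norm (1::'a)"
    using norm_star_mult[of "1::'a"] by (simp add: power2_eq_square)
  then show ?thesis by (cases "norm (1::'a) = 0") auto
qed

lemma norm_scaleR_one_le: "t \<ge> 0 \<Longrightarrow> norm (scaleR t (1::'a::cstar)) \<le> t"
  using norm_one_le[where 'a = 'a] by (simp add: mult_left_le)

lemma norm_power_Suc_le: "norm ((x::'a::cstar) ^ Suc k) \<le> norm x ^ Suc k"
proof (induction k)
  case (Suc k)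
  have "norm (x ^ Suc (Suc k)) \<le> norm x * norm (x ^ Suc k)"
    by (simp add: norm_mult_ineq)
  also have "\<dots> \<le> norm x * norm x ^ Suc k"
    by (rule mult_left_mono[OF Suc]) simp
  finally show ?case by simp
qed simp

lemma bounded_linear_star: "bounded_linear (star :: 'a \<Rightarrow> 'a::cstar)"
  by (rule bounded_linear_intro[where K = 1]) (auto simp: star_add star_scaleR norm_star)

section \<open>The square root of \<open>1 - b\<close> (not of \<open>b\<close>) in the closed unit
  ball\<close>

definition sqr :: "'a::cstar \<Rightarrow> 'a" where
  "sqr b = (\<Sum>k. scaleR (sqc k) (b ^ k))"

lemma norm_power_le_one:
  fixes b :: "'a::cstar"
  assumes "norm b \<le> 1"
  shows "norm (b ^ k) \<le> 1"
proof (cases k)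
  case (Suc j)
  have "norm (b ^ Suc j) \<le> norm b ^ Suc j" by (rule norm_power_Suc_le)
  also have "\<dots> \<le> 1" using assms by (intro power_le_one) auto
  finally show ?thesis using Suc by simp
qed (simp add: norm_one_le)

lemma summable_norm_sqr:
  fixes b :: "'a::cstar"
  assumes "norm b \<le> 1"
  shows "summable (\<lambda>k. norm (scaleR (sqc k) (b ^ k)))"
  by (rule summable_comparison_test'[OF summable_abs_sqc, where N = 0])
    (use norm_power_le_one[OF assms] in \<open>simp add: mult_left_le\<close>)

lemma sqr_square:
  fixes b :: "'a::cstar"
  assumes "norm b \<le> 1"
  shows "sqr b * sqr b = 1 - b"
proof -
  let ?f = "\<lambda>k. scaleR (sqc k) (b ^ k)"
  have "(\<lambda>k. \<Sum>i\<le>k. ?f i * ?f (k - i)) sums (sqr b * sqr b)"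
    unfolding sqr_def by (rule Cauchy_product_sums) (use summable_norm_sqr[OF assms] in auto)
  moreover have "(\<Sum>i\<le>k. ?f i * ?f (k - i)) = (if k = 0 then 1 else if k = 1 then - b else 0)" for k
  proof -
    have "(\<Sum>i\<le>k. ?f i * ?f (k - i)) = (\<Sum>i\<le>k. scaleR (sqc i * sqc (k - i)) (b ^ k))"
      by (rule sum.cong) (auto simp: power_add[symmetric])
    also have "\<dots> = scaleR (\<Sum>i\<le>k. sqc i * sqc (k - i)) (b ^ k)"
      by (simp add: scaleR_left.sum)
    finally show ?thesis by (simp add: sqc_convolution)
  qed
  moreover have "(\<lambda>k. if k = 0 then 1 else if k = 1 then - b else 0) sums
      (\<Sum>k\<in>{0, 1::nat}. if k = 0 then 1 else if k = 1 then - b else 0)"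
    by (rule sums_finite) auto
  ultimately show ?thesis
    by (auto dest: sums_unique2)
qed

text \<open>All terms after the first have total weight at most 1. This bound is what later
  certifies that the root is itself positive.\<close>

lemma norm_one_minus_sqr_le:
  fixes b :: "'a::cstar"
  assumes "norm b \<le> 1"
  shows "norm (1 - sqr b) \<le> 1"
proof -
  let ?f = "\<lambda>k. scaleR (sqc k) (b ^ k)"
  have s: "summable (\<lambda>k. norm (?f (Suc k)))"
    using summable_norm_sqr[OF assms] summable_Suc_iff[of "\<lambda>k. norm (?f k)"] by simp
  have "sqr b - 1 = (\<Sum>k. ?f (Suc k))"
    using suminf_split_head[OF summable_norm_cancel[OF summable_norm_sqr[OF assms]]]
    by (simp add: sqr_def)
  also have "norm \<dots> \<le> (\<Sum>k. norm (?f (Suc k)))"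
    by (rule summable_norm[OF s])
  also have "\<dots> \<le> (\<Sum>k. \<bar>sqc (Suc k)\<bar>)"
    by (rule suminf_le[OF _ s summable_abs_sqc_Suc])
      (use norm_power_le_one[OF assms] in \<open>simp add: mult_left_le del: power_Suc\<close>)
  also have "\<dots> \<le> 1" by (rule suminf_abs_sqc_Suc)
  finally show ?thesis by (simp add: norm_minus_commute)
qed

lemma star_sqr:
  fixes b :: "'a::cstar"
  assumes "norm b \<le> 1" "star b = b"
  shows "star (sqr b) = sqr b"
proof -
  have "star (sqr b) = (\<Sum>k. star (scaleR (sqc k) (b ^ k)))"
    unfolding sqr_def
    by (rule bounded_linear.suminf[OF bounded_linear_star])
      (rule summable_norm_cancel[OF summable_norm_sqr[OF assms(1)]])
  then show ?thesis
    by (simp add: sqr_def star_scaleR star_power assms)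
qed

lemma sqr_commute:
  fixes b y :: "'a::cstar"
  assumes "norm b \<le> 1" "y * b = b * y"
  shows "y * sqr b = sqr b * y"
proof -
  have s: "summable (\<lambda>k. scaleR (sqc k) (b ^ k))"
    by (rule summable_norm_cancel[OF summable_norm_sqr[OF assms(1)]])
  have "y * b ^ k = b ^ k * y" for k
    using power_commuting_commutes[OF assms(2)[symmetric], of k] by simp
  then show ?thesis
    unfolding sqr_def
    by (simp add: suminf_mult[OF s, symmetric] suminf_mult2[OF s])
qed

section \<open>Positive elements\<close>

text \<open>Positivity by a self-adjoint root avoids the spectrum. That every
  \<open>star d * d\<close> is positive in this sense is the hard fact
  \<open>cpos_star_mult\<close>.\<close>

definition cpos :: "'a::cstar \<Rightarrow> bool" where
  "cpos x \<longleftrightarrow> (\<exists>h. star h = h \<and> x = h * h)"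

lemma cpos_square: "star h = h \<Longrightarrow> cpos (h * h)"
  by (auto simp: cpos_def)

lemma cpos_star: "cpos x \<Longrightarrow> star x = x"
  by (auto simp: cpos_def star_mult)

lemma cpos_0 [simp]: "cpos 0"
  using cpos_square[of 0] by simp

lemma cpos_1 [simp]: "cpos 1"
  using cpos_square[of 1] by simp

lemma cpos_scaleR: "cpos x \<Longrightarrow> t \<ge> 0 \<Longrightarrow> cpos (scaleR t x)"
  unfolding cpos_def
proof (elim exE conjE)
  fix h assume "star h = h" "x = h * h" "t \<ge> 0"
  then show "\<exists>h. star h = h \<and> scaleR t x = h * h"
    by (intro exI[of _ "scaleR (sqrt t) h"]) (simp add: star_scaleR)
qed

text \<open>If \<open>h\<^sup>2 + k\<^sup>2 = s\<^sup>2\<close> for commuting self-adjoint elements, then \<open>u = h + i k\<close> satisfies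
  \<open>u\<^sup>* u = s\<^sup>2\<close>, and \<open>h\<close> is the real part of \<open>u\<close>.\<close>

lemma norm_le_of_sum_squares:
  fixes h k :: "'a::cstar"
  assumes "star h = h" "star k = k" "h * k = k * h" "h * h + k * k = scaleR (s\<^sup>2) 1" "s \<ge> 0"
  shows "norm h \<le> s"
proof -
  define u where "u = h + cc \<i> * k"
  have ii: "cc \<i> * cc \<i> = (- 1 :: 'a)"
    using cc_mult[of \<i> \<i>, where 'a = 'a] scaleR_cc[of "-1" "1::'a"] by simp
  have mi: "cc (- \<i>) = (- cc \<i> :: 'a)"
    using cc_add[of \<i> "- \<i>", where 'a = 'a] by (simp add: eq_neg_iff_add_eq_0 add.commute)
  have su: "star u = h - cc \<i> * k"
    by (simp add: u_def star_add star_mult star_cc assms mi cc_commute)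
  have "star u * u = h * h + k * k"
  proof -
    have "cc \<i> * k * (cc \<i> * k) = - (k * k)"
      by (metis ii cc_commute mult.assoc mult_minus_left mult_1_left)
    moreover have "h * (cc \<i> * k) = cc \<i> * k * h"
      by (metis assms(3) cc_commute mult.assoc)
    ultimately show ?thesis
      unfolding su by (simp add: u_def algebra_simps)
  qed
  then have "(norm u)\<^sup>2 = norm (scaleR (s\<^sup>2) (1::'a))"
    using norm_star_mult[of u] assms(4) by simp
  also have "\<dots> \<le> s\<^sup>2"
    by (rule norm_scaleR_one_le) simp
  finally have u: "norm u \<le> s"
    using assms(5) power2_le_imp_le by blast
  have "h + h = u + star u"
    unfolding su by (simp add: u_def)
  then have "norm (h + h) \<le> norm u + norm u"
    by (metis norm_triangle_ineq norm_star)
  moreover have "norm (h + h) = norm h + norm h"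
    by (metis scaleR_2 norm_scaleR abs_numeral mult_2)
  ultimately show ?thesis using u by linarith
qed

text \<open>Let \<open>k\<close> be the root of \<open>1 - h * h\<close>. Then \<open>h\<close> and
  \<open>k\<close> commute and their squares add up to 1, which bounds \<open>k\<close>; the
  C*-identity passes the bound on to \<open>k * k\<close>.\<close>

lemma norm_one_minus_square_le:
  fixes h :: "'a::cstar"
  assumes "star h = h" "norm h \<le> 1"
  shows "norm (1 - h * h) \<le> 1"
proof -
  have n: "norm (h * h) \<le> 1"
    using norm_star_mult[of h] assms by (simp add: power_le_one)
  define k where "k = sqr (h * h)"
  have k: "star k = k" "k * k = 1 - h * h" "h * k = k * h"
    unfolding k_def using star_sqr[OF n] sqr_square[OF n] sqr_commute[OF n, of h] assms
    by (auto simp: star_mult mult.assoc)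
  have "norm k \<le> 1"
    by (rule norm_le_of_sum_squares[of k h 1]) (use k assms in auto)
  moreover have "norm (1 - h * h) = (norm k)\<^sup>2"
    using norm_star_mult[of k] k by simp
  ultimately show ?thesis by (simp add: power_le_one)
qed

text \<open>With the converse \<open>cposI\<close> this characterizes positivity by the norm alone.
  Rescaling by \<open>t\<close> reduces it to an element of norm at most 1.\<close>

lemma cpos_norm_diff_le:
  fixes x :: "'a::cstar"
  assumes "cpos x" "norm x \<le> t"
  shows "norm (scaleR t 1 - x) \<le> t"
proof (cases "t > 0")
  case True
  obtain h where h: "star h = h" "x = h * h"
    using assms(1) by (auto simp: cpos_def)
  define g where "g = scaleR (1 / sqrt t) h"
  have g: "star g = g" "scaleR t (g * g) = x"
    using True h by (auto simp: g_def star_scaleR)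
  have "(norm g)\<^sup>2 = norm x / t"
    using norm_star_mult[of g] True g by (metis norm_scaleR abs_of_pos nonzero_mult_div_cancel_left less_irrefl)
  then have "(norm g)\<^sup>2 \<le> 1\<^sup>2"
    using True assms(2) by simp
  then have "norm g \<le> 1"
    by (rule power2_le_imp_le) simp
  then have "norm (1 - g * g) \<le> 1"
    using norm_one_minus_square_le g(1) by blast
  moreover have "scaleR t 1 - x = scaleR t (1 - g * g)"
    using g(2) by (simp add: scaleR_diff_right)
  ultimately show ?thesis
    using True by (simp add: mult_left_le)
next
  case False
  have "0 \<le> norm x" by simp
  with False assms(2) have "t = 0" by linarith
  moreover have "x = 0"
    using assms(2) \<open>t = 0\<close> by simp
  ultimately show ?thesis by simp
qed

text \<open>The norm estimate for \<open>r\<close> is the hypothesis of the positivity criterion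
  again, so the root is positive as well. The last clause puts \<open>r\<close> in the bicommutant
  of \<open>x\<close>, which is needed to multiply roots of commuting elements.\<close>

lemma cposI_norm:
  fixes x :: "'a::cstar"
  assumes "star x = x" "norm (scaleR t 1 - x) \<le> t" "t > 0"
  shows "\<exists>r. star r = r \<and> r * r = x \<and> norm (scaleR (sqrt t) 1 - r) \<le> sqrt t \<and>
    (\<forall>y. y * x = x * y \<longrightarrow> y * r = r * y)"
proof -
  define b where "b = scaleR (1 / t) (scaleR t 1 - x)"
  have b: "star b = b"
    using assms by (simp add: b_def star_scaleR star_diff)
  have "norm b = norm (scaleR t 1 - x) / t"
    unfolding b_def norm_scaleR using assms(3) by simp
  with assms have bn: "norm b \<le> 1" by simp
  have x: "scaleR t (1 - b) = x"
    using assms(3) by (simp add: b_def scaleR_diff_right)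
  let ?r = "scaleR (sqrt t) (sqr b)"
  have "star ?r = ?r"
    using star_sqr[OF bn b] by (simp add: star_scaleR)
  moreover have "?r * ?r = x"
    using sqr_square[OF bn] assms(3) x by simp
  moreover have "norm (scaleR (sqrt t) 1 - ?r) \<le> sqrt t"
  proof -
    have "scaleR (sqrt t) 1 - ?r = scaleR (sqrt t) (1 - sqr b)"
      by (simp add: scaleR_diff_right)
    then show ?thesis
      using norm_one_minus_sqr_le[OF bn] assms(3) by (simp add: mult_left_le)
  qed
  moreover have "y * ?r = ?r * y" if "y * x = x * y" for y
  proof -
    have "y * b = b * y"
      using that by (simp add: b_def algebra_simps)
    then show ?thesis
      using sqr_commute[OF bn] by simp
  qed
  ultimately show ?thesis by blast
qed

lemma cposI:
  fixes x :: "'a::cstar"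
  assumes "star x = x" "norm (scaleR t 1 - x) \<le> t"
  shows "cpos x"
proof (cases "t > 0")
  case True
  then show ?thesis
    using cposI_norm[OF assms] by (metis cpos_square)
next
  case False
  have "0 \<le> norm (scaleR t 1 - x)" by simp
  with False assms(2) have t: "t = 0" by linarith
  then have "x = 0"
    using assms(2) by simp
  then show ?thesis by simp
qed

lemma cpos_root:
  fixes x :: "'a::cstar"
  assumes "cpos x"
  obtains r where "cpos r" "r * r = x" "\<And>y. y * x = x * y \<Longrightarrow> y * r = r * y"
proof -
  \<comment> \<open>The summand 1 keeps \<open>t\<close> positive when \<open>x\<close> is
    0.\<close>
  define t where "t = norm x + 1"
  have t: "t > 0" by (simp add: t_def add_nonneg_pos)
  have "norm (scaleR t 1 - x) \<le> t"
    by (rule cpos_norm_diff_le[OF assms]) (simp add: t_def)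
  from cposI_norm[OF cpos_star[OF assms] this t] show ?thesis
    using that cposI by blast
qed

text \<open>In terms of the norm criterion this is the triangle inequality.\<close>

lemma cpos_add:
  fixes x y :: "'a::cstar"
  assumes "cpos x" "cpos y"
  shows "cpos (x + y)"
proof (rule cposI)
  show "star (x + y) = x + y"
    using assms by (simp add: star_add cpos_star)
  have "scaleR (norm x + norm y) 1 - (x + y) = (scaleR (norm x) 1 - x) + (scaleR (norm y) 1 - y)"
    by (simp add: scaleR_add_left)
  then show "norm (scaleR (norm x + norm y) 1 - (x + y)) \<le> norm x + norm y"
    using cpos_norm_diff_le[OF assms(1) order_refl] cpos_norm_diff_le[OF assms(2) order_refl]
    by (metis norm_triangle_mono)
qed

lemma cpos_sum: "(\<And>i. i \<in> A \<Longrightarrow> cpos (f i)) \<Longrightarrow> cpos (sum f A)"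
  by (induction A rule: infinite_finite_induct) (auto intro: cpos_add)

text \<open>Since \<open>y\<close> commutes with \<open>x\<close> it commutes with the root
  \<open>r\<close>, and then \<open>r\<close> commutes with the root \<open>s\<close> of
  \<open>y\<close>. So \<open>r * s\<close> is self-adjoint with square
  \<open>x * y\<close>.\<close>

lemma cpos_mult_commuting:
  fixes x y :: "'a::cstar"
  assumes "cpos x" "cpos y" "x * y = y * x"
  shows "cpos (x * y)"
proof -
  obtain r where r: "cpos r" "r * r = x" "\<And>z. z * x = x * z \<Longrightarrow> z * r = r * z"
    using cpos_root[OF assms(1)] by metis
  obtain s where s: "cpos s" "s * s = y" "\<And>z. z * y = y * z \<Longrightarrow> z * s = s * z"
    using cpos_root[OF assms(2)] by metis
  have "y * r = r * y" using r(3) assms(3) by simp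
  then have rs: "r * s = s * r" using s(3) by simp
  have "x * y = (r * s) * (r * s)"
    using rs r(2) s(2) by (metis mult.assoc)
  moreover have "star (r * s) = r * s"
    using rs cpos_star[OF r(1)] cpos_star[OF s(1)] by (simp add: star_mult)
  ultimately show ?thesis using cpos_square by metis
qed

text \<open>With \<open>g = 2 x - T\<close> one has \<open>g^2 + 4 x (T - x) = T^2\<close>, and
  \<open>x (T - x)\<close> has a root commuting with \<open>x\<close>. The lemma on sums of two
  squares then gives \<open>norm g \<le> T\<close>.\<close>

lemma cpos_between_norm:
  fixes x :: "'a::cstar"
  assumes "cpos x" "cpos (scaleR T 1 - x)" "T \<ge> 0"
  shows "norm x \<le> T"
proof -
  have "cpos (x * (scaleR T 1 - x))"
    by (rule cpos_mult_commuting) (use assms in \<open>auto simp: algebra_simps\<close>)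
  then obtain r where r: "cpos r" "r * r = x * (scaleR T 1 - x)"
    "\<And>y. y * (x * (scaleR T 1 - x)) = x * (scaleR T 1 - x) * y \<Longrightarrow> y * r = r * y"
    using cpos_root by metis
  define g where "g = scaleR 2 x - scaleR T 1"
  have xr: "x * r = r * x"
    by (rule r(3)) (simp add: algebra_simps)
  have "norm g \<le> T"
  proof (rule norm_le_of_sum_squares)
    show "star g = g"
      using cpos_star[OF assms(1)] by (simp add: g_def star_diff star_scaleR)
    show "star (scaleR 2 r) = scaleR 2 r"
      using cpos_star[OF r(1)] by (simp add: star_scaleR)
    show "g * scaleR 2 r = scaleR 2 r * g"
      using xr by (simp add: g_def algebra_simps)
    have "g * g + scaleR 2 r * scaleR 2 r = g * g + scaleR 4 (x * (scaleR T 1 - x))"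
      using r(2) by simp
    also have "\<dots> = scaleR (T\<^sup>2) 1"
      by (simp add: g_def algebra_simps power2_eq_square flip: scaleR_add_left)
    finally show "g * g + scaleR 2 r * scaleR 2 r = scaleR (T\<^sup>2) 1" .
  qed (rule assms(3))
  moreover have "scaleR 2 x = g + scaleR T 1"
    by (simp add: g_def)
  ultimately have "norm (scaleR 2 x) \<le> T + T"
    using norm_triangle_mono[of g T "scaleR T 1" T] norm_scaleR_one_le[OF assms(3)] by simp
  then show ?thesis by simp
qed

text \<open>\<open>x\<close> lies below \<open>y\<close>, and \<open>y\<close> lies below the scalar
  \<open>norm y\<close>.\<close>

lemma cpos_norm_mono:
  fixes x y :: "'a::cstar"
  assumes "cpos x" "cpos (y - x)"
  shows "norm x \<le> norm y"
proof (rule cpos_between_norm[OF assms(1)])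
  have "cpos y"
    using cpos_add[OF assms] by simp
  then have "cpos (scaleR (norm y) 1 - y)"
    by (intro cposI[where t = "norm y"]) (auto simp: star_diff star_scaleR cpos_star)
  from cpos_add[OF this assms(2)] show "cpos (scaleR (norm y) 1 - x)" by simp
qed simp

section \<open>Positivity of \<open>star d * d\<close>\<close>

lemma mult_star_power_shift:
  fixes y :: "'a::cstar"
  shows "(1 + scaleR s (y * star y)) ^ N * y = y * (1 + scaleR s (star y * y)) ^ N"
proof (induction N)
  case (Suc N)
  have "(1 + scaleR s (y * star y)) ^ Suc N * y = (1 + scaleR s (y * star y)) * y * (1 + scaleR s (star y * y)) ^ N"
    using Suc by (simp add: mult.assoc)
  also have "(1 + scaleR s (y * star y)) * y = y * (1 + scaleR s (star y * y))"
    by (simp add: algebra_simps)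
  finally show ?case by (simp add: mult.assoc)
qed simp

text \<open>Bernoulli's inequality multiplied by \<open>a\<close>. In the induction step the excess
  is \<open>s (p - 1) a^2\<close>, where \<open>p - 1\<close> is positive and commutes with
  \<open>a\<close>.\<close>

lemma cpos_one_plus_power:
  fixes a :: "'a::cstar"
  assumes "cpos a" "s \<ge> 0"
  shows "cpos ((1 + scaleR s a) ^ N * a - scaleR (real N * s) (a * a))"
proof (induction N)
  case 0
  then show ?case using assms by simp
next
  case (Suc N)
  define p where "p = (1 + scaleR s a) ^ N"
  have comm: "a * p = p * a"
    unfolding p_def by (rule power_commuting_commutes[symmetric]) (simp add: algebra_simps)
  have "cpos (p - 1)"
    unfolding p_def
  proof (induction N)
    case (Suc N)
    have "cpos ((1 + scaleR s a) ^ N)"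
      using cpos_add[OF Suc cpos_1] by simp
    moreover have "a * (1 + scaleR s a) ^ N = (1 + scaleR s a) ^ N * a"
      by (rule power_commuting_commutes[symmetric]) (simp add: algebra_simps)
    ultimately have "cpos (a * (1 + scaleR s a) ^ N)"
      using cpos_mult_commuting[OF assms(1)] by simp
    from cpos_add[OF Suc cpos_scaleR[OF this assms(2)]] show ?case
      by (simp add: algebra_simps)
  qed simp
  then have "cpos ((p - 1) * (a * a))"
    using cpos_mult_commuting[OF _ cpos_square[OF cpos_star[OF assms(1)]], of "p - 1"] comm
    by (metis mult.assoc left_diff_distrib right_diff_distrib mult_1_left mult_1_right)
  from cpos_add[OF Suc cpos_scaleR[OF this assms(2)]]
  have "cpos (p * a - scaleR (real N * s) (a * a) + scaleR s ((p - 1) * (a * a)))"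
    by (simp add: p_def)
  also have "p * a - scaleR (real N * s) (a * a) + scaleR s ((p - 1) * (a * a)) =
      p * a + scaleR s (p * (a * a)) - scaleR (real (Suc N) * s) (a * a)"
    by (simp add: algebra_simps)
  also have "p * a + scaleR s (p * (a * a)) = (1 + scaleR s a) ^ Suc N * a"
    using comm by (simp add: p_def[symmetric] distrib_right) (metis mult.assoc)
  finally show ?case .
qed

text \<open>\<open>y y\<^sup>*\<close> is positive because \<open>y\<^sup>* y + y y\<^sup>*\<close> is a sum of two squares, so \<open>(1 + s y y\<^sup>*)\<^sup>N y y\<^sup>*\<close> grows
  at least linearly in \<open>N\<close>; but it equals \<open>y (1 + s y\<^sup>* y)\<^sup>N y\<^sup>*\<close>, which stays bounded.\<close>

lemma eq_zero_of_cpos_minus_star_mult: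
  fixes y :: "'a::cstar"
  assumes "cpos (- (star y * y))"
  shows "y = 0"
proof -
  \<comment> \<open>\<open>u\<close> and \<open>v\<close> are twice the real and imaginary parts of
    \<open>y\<close>; the cross terms cancel in \<open>u * u + v * v\<close>.\<close>
  define u where "u = y + star y"
  define v where "v = cc \<i> * (star y - y)"
  have ii: "cc \<i> * cc \<i> = (- 1 :: 'a)"
    using cc_mult[of \<i> \<i>, where 'a = 'a] scaleR_cc[of "-1" "1::'a"] by simp
  have mi: "cc (- \<i>) = (- cc \<i> :: 'a)"
    using cc_add[of \<i> "- \<i>", where 'a = 'a] by (simp add: eq_neg_iff_add_eq_0 add.commute)
  have su: "star u = u" by (simp add: u_def star_add add.commute)
  have sv: "star v = v"
    by (simp add: v_def star_mult star_diff star_cc mi)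
      (metis cc_commute minus_diff_eq mult_minus_right)
  have vv: "v * v = - ((star y - y) * (star y - y))"
    unfolding v_def by (metis ii cc_commute mult.assoc mult_minus_left mult_1_left)
  have sum: "scaleR (1/2) (u * u + v * v) = star y * y + y * star y"
  proof -
    have "u * u + v * v = scaleR 2 (star y * y + y * star y)"
      unfolding vv by (simp add: u_def algebra_simps scaleR_2)
    then show ?thesis by simp
  qed
  define a where "a = y * star y"
  have "cpos (scaleR (1/2) (u * u + v * v))"
    using su sv by (intro cpos_scaleR cpos_add cpos_square) auto
  from cpos_add[OF this assms] have a: "cpos a"
    unfolding sum by (simp add: a_def)
  \<comment> \<open>Small enough that the positive element \<open>- s (star y * y)\<close> has norm
    at most 1; the norm criterion then makes \<open>1 + s (star y * y)\<close> a contraction, whose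
    powers stay bounded.\<close>
  define s where "s = 1 / (norm (star y * y) + 1)"
  have s: "s > 0" by (simp add: s_def add_nonneg_pos)
  have "norm (1 + scaleR s (star y * y)) \<le> 1"
  proof -
    have "norm (scaleR 1 1 - scaleR s (- (star y * y))) \<le> 1"
      by (rule cpos_norm_diff_le) (use cpos_scaleR[OF assms, of s] s in \<open>auto simp: s_def\<close>)
    then show ?thesis by simp
  qed
  then have pw: "norm ((1 + scaleR s (star y * y)) ^ N) \<le> 1" for N
    by (rule norm_power_le_one)
  have bd: "real N * (s * norm (a * a)) \<le> norm y * norm y" for N
  proof -
    have "norm (scaleR (real N * s) (a * a)) \<le> norm ((1 + scaleR s a) ^ N * a)"
      using cpos_one_plus_power[OF a, of s N] s
      by (intro cpos_norm_mono cpos_scaleR cpos_square cpos_star[OF a]) auto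
    also have "(1 + scaleR s a) ^ N * a = y * (1 + scaleR s (star y * y)) ^ N * star y"
      unfolding a_def by (metis mult_star_power_shift mult.assoc)
    also have "norm \<dots> \<le> norm y * 1 * norm y"
      by (rule order_trans[OF norm_mult_ineq]) 
        (use pw[of N] in \<open>auto simp: norm_star intro!: mult_right_mono order_trans[OF norm_mult_ineq] mult_left_le\<close>)
    finally show ?thesis using s by (simp add: abs_mult mult.assoc)
  qed
  have "s * norm (a * a) = 0"
  proof (rule ccontr)
    assume "s * norm (a * a) \<noteq> 0"
    then have pos: "s * norm (a * a) > 0" using s by simp
    then obtain N where "real N * (s * norm (a * a)) > norm y * norm y"
      using reals_Archimedean3 by blast
    then show False using bd[of N] by linarith
  qed
  then have "a * a = 0" using s by simp
  then have "a = 0"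
    using norm_star_mult[of a] cpos_star[OF a] by simp
  then have "norm (star y) = 0"
    using norm_star_mult[of "star y"] by (simp add: a_def)
  then show ?thesis by (simp add: norm_star)
qed

text \<open>With \<open>b\<close> the absolute value of \<open>h\<close>, the element
  \<open>g = b - h\<close> is twice the negative part of \<open>h\<close>. Then
  \<open>star (d * g) * (d * g) = g * h * g\<close> is the negative of a positive element, so
  \<open>d * g = 0\<close>. Hence \<open>h * g\<close> and \<open>b * g\<close> vanish, so does
  \<open>g\<close>, and \<open>h = b\<close>.\<close>

lemma cpos_star_mult: "cpos (star d * (d::'a::cstar))"
proof -
  define h where "h = star d * d"
  have h: "star h = h" by (simp add: h_def star_mult)
  obtain b where b: "cpos b" "b * b = h * h" "\<And>y. y * (h * h) = h * h * y \<Longrightarrow> y * b = b * y"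
    using cpos_root[OF cpos_square[OF h]] by metis
  have hb: "h * b = b * h" by (rule b(3)) (simp add: mult.assoc)
  define g where "g = b - h"
  have g: "star g = g" using h cpos_star[OF b(1)] by (simp add: g_def star_diff)
  have gb: "g * b = b * g" using hb by (simp add: g_def algebra_simps)
  have gh: "h * g = - (b * g)" using hb b(2) by (simp add: g_def algebra_simps)
  have "star (d * g) * (d * g) = g * h * g"
    by (simp add: star_mult g h_def mult.assoc)
  also have "\<dots> = - (b * (g * g))"
    using gh gb by (simp add: mult.assoc) (metis mult.assoc)
  finally have e: "star (d * g) * (d * g) = - (b * (g * g))" .
  have "cpos (b * (g * g))"
    by (rule cpos_mult_commuting[OF b(1) cpos_square[OF g]]) (metis gb mult.assoc)
  then have dg: "d * g = 0"
    using eq_zero_of_cpos_minus_star_mult[of "d * g"] e by simp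
  have "h * g = 0" using dg by (simp add: h_def mult.assoc)
  moreover have "b * g = 0" using gh calculation by simp
  ultimately have "g * g = 0" by (simp add: g_def left_diff_distrib)
  then have "g = 0" using norm_star_mult[of g] g by simp
  then show ?thesis using b(1) by (simp add: g_def h_def)
qed

lemma norm_square_le_sum:
  fixes d :: "'i \<Rightarrow> 'a::cstar"
  assumes "finite A" "i \<in> A" "cpos r"
  shows "(norm (d i))\<^sup>2 \<le> norm ((\<Sum>j\<in>A. star (d j) * d j) + r)"
proof -
  have "norm (star (d i) * d i) \<le> norm ((\<Sum>j\<in>A. star (d j) * d j) + r)"
  proof (rule cpos_norm_mono[OF cpos_star_mult])
    have "cpos ((\<Sum>j\<in>A - {i}. star (d j) * d j) + r)"
      by (intro cpos_add cpos_sum cpos_star_mult assms)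
    then show "cpos ((\<Sum>j\<in>A. star (d j) * d j) + r - star (d i) * d i)"
      using assms by (simp add: sum_diff1 algebra_simps)
  qed
  then show ?thesis by (simp add: norm_star_mult)
qed

section \<open>Square roots of matrices over a C*-algebra\<close>

fun mpow :: "nat \<Rightarrow> (nat \<Rightarrow> nat \<Rightarrow> 'a::cstar) \<Rightarrow> nat \<Rightarrow> nat \<Rightarrow> nat \<Rightarrow> 'a" where
  "mpow m a 0 i j = (if i = j then 1 else 0)"
| "mpow m a (Suc k) i j = (\<Sum>l<m. a i l * mpow m a k l j)"

lemma mpow_add:
  assumes "i < m"
  shows "mpow m a (p + q) i j = (\<Sum>l<m. mpow m a p i l * mpow m a q l j)"
  using assms
proof (induction p arbitrary: i)
  case 0
  have "(\<Sum>l<m. mpow m a 0 i l * mpow m a q l j) = (\<Sum>l<m. if l = i then mpow m a q l j else 0)"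
    by (rule sum.cong) auto
  then show ?case using 0 by simp
next
  case (Suc p)
  have "mpow m a (Suc p + q) i j = (\<Sum>l<m. \<Sum>k<m. a i l * (mpow m a p l k * mpow m a q k j))"
    using Suc.IH by (simp add: sum_distrib_left)
  also have "\<dots> = (\<Sum>k<m. \<Sum>l<m. a i l * (mpow m a p l k * mpow m a q k j))"
    by (rule sum.swap)
  finally show ?case by (simp add: sum_distrib_right mult.assoc)
qed

lemma star_mpow:
  assumes "\<And>i j. i < m \<Longrightarrow> j < m \<Longrightarrow> star (a i j) = a j i" "i < m" "j < m"
  shows "star (mpow m a k i j) = mpow m a k j i"
  using assms(2,3)
proof (induction k arbitrary: i)
  case (Suc k)
  have "star (mpow m a (Suc k) i j) = (\<Sum>l<m. mpow m a k j l * a l i)"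
    using Suc assms(1) by (simp add: star_sum star_mult)
  also have "\<dots> = (\<Sum>l<m. mpow m a k j l * mpow m a 1 l i)"
  proof (rule sum.cong)
    fix l assume "l \<in> {..<m}"
    have "mpow m a 1 l i = (\<Sum>q<m. if q = i then a l i else 0)"
      unfolding One_nat_def mpow.simps by (rule sum.cong) auto
    then show "mpow m a k j l * a l i = mpow m a k j l * mpow m a 1 l i"
      using Suc.prems by simp
  qed simp
  also have "\<dots> = mpow m a (k + 1) j i"
    using mpow_add[of j m a k 1 i] Suc.prems by simp
  finally show ?case by simp
qed auto

text \<open>Multiplying by the \<open>K\<close>-th power sums \<open>m\<close> products with a
  factor at most \<open>1 / (2 * m)\<close>, so the largest entry is at least halved every
  \<open>K\<close> steps. The weight \<open>s\<close>, with \<open>s ^ K = 2\<close>, compensates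
  this exactly, and \<open>D\<close> dominates the first \<open>K\<close> powers.\<close>

lemma mpow_geometric_decay:
  fixes a :: "nat \<Rightarrow> nat \<Rightarrow> 'a::cstar"
  assumes "K \<ge> 1" "m \<ge> 1" "\<And>i j. i < m \<Longrightarrow> j < m \<Longrightarrow> norm (mpow m a K i j) \<le> 1 / (2 * real m)"
  obtains s D where "s > 1" "\<And>k i j. i < m \<Longrightarrow> j < m \<Longrightarrow> s ^ k * norm (mpow m a k i j) \<le> D"
proof -
  define s where "s = root K 2"
  have s: "s > 1" "s ^ K = 2"
    using assms(1) by (auto simp: s_def)
  define D where "D = (\<Sum>k<K. \<Sum>i<m. \<Sum>j<m. s ^ k * norm (mpow m a k i j))"
  have "s ^ k * norm (mpow m a k i j) \<le> D" if "i < m" "j < m" for k i j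
    using that
  proof (induction k arbitrary: i rule: less_induct)
    case (less k)
    show ?case
    proof (cases "k < K")
      case True
      have nn: "0 \<le> s ^ k' * norm (mpow m a k' i' j')" for k' i' j'
        using s by simp
      have "s ^ k * norm (mpow m a k i j) \<le> (\<Sum>j<m. s ^ k * norm (mpow m a k i j))"
        using less.prems nn by (intro member_le_sum) auto
      also have "\<dots> \<le> (\<Sum>i<m. \<Sum>j<m. s ^ k * norm (mpow m a k i j))"
        using less.prems nn by (intro member_le_sum) (auto intro!: sum_nonneg)
      also have "\<dots> \<le> D"
        unfolding D_def using True nn by (intro member_le_sum) (auto intro!: sum_nonneg)
      finally show ?thesis .
    next
      case False
      define q where "q = k - K"
      have k: "k = K + q" "q < k" using False assms(1) by (auto simp: q_def)
      have "norm (mpow m a k i j) \<le> (\<Sum>l<m. norm (mpow m a K i l) * norm (mpow m a q l j))"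
        unfolding k(1) mpow_add[OF less.prems(1)]
        by (rule order_trans[OF norm_sum]) (intro sum_mono norm_mult_ineq)
      also have "\<dots> \<le> (\<Sum>l<m. 1 / (2 * real m) * norm (mpow m a q l j))"
        using assms(3) less.prems by (intro sum_mono mult_right_mono) auto
      finally have "s ^ k * norm (mpow m a k i j) \<le>
          s ^ k * (\<Sum>l<m. 1 / (2 * real m) * norm (mpow m a q l j))"
        using s by (intro mult_left_mono) auto
      also have "\<dots> = (\<Sum>l<m. 1 / real m * (s ^ q * norm (mpow m a q l j)))"
        unfolding k(1) power_add s(2) by (simp add: sum_distrib_left mult_ac)
      also have "\<dots> \<le> (\<Sum>l<m. 1 / real m * D)"
        using less.IH[OF k(2)] less.prems by (intro sum_mono mult_left_mono) auto
      also have "\<dots> = D" using assms(2) by simp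
      finally show ?thesis .
    qed
  qed
  then show ?thesis using that s(1) by blast
qed

text \<open>Because the powers decay geometrically, the series of the root of 1 - z still converges
  at \<open>a / t\<close> for some \<open>t < 1\<close>. Its value times \<open>sqrt t\<close> is
  self-adjoint with square \<open>t - a\<close>, in the form that \<open>mat_pos\<close> asks
  for.\<close>

lemma matrix_square_root:
  fixes a :: "nat \<Rightarrow> nat \<Rightarrow> 'a::cstar"
  assumes "K \<ge> 1" "m \<ge> 1" "\<And>i j. i < m \<Longrightarrow> j < m \<Longrightarrow> norm (mpow m a K i j) \<le> 1 / (2 * real m)"
    and sa: "\<And>i j. i < m \<Longrightarrow> j < m \<Longrightarrow> star (a i j) = a j i"
  shows "\<exists>t S. 0 < t \<and> t < 1 \<and> (\<forall>i<m. \<forall>j<m.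
    (if i = j then scaleR t 1 else 0) - a i j = (\<Sum>r<m. star (S r i) * S r j))"
proof -
  obtain s D where s: "s > 1" and D: "\<And>k i j. i < m \<Longrightarrow> j < m \<Longrightarrow> s ^ k * norm (mpow m a k i j) \<le> D"
    using mpow_geometric_decay[OF assms(1-3)] by metis
  \<comment> \<open>Strictly between \<open>1 / s\<close>, which keeps the series convergent, and
    1.\<close>
  define t where "t = 2 / (1 + s)"
  have t: "0 < t" "t < 1" "1 < s * t"
    using s by (auto simp: t_def field_simps)
  let ?f = "\<lambda>i j k. scaleR (sqc k / t ^ k) (mpow m a k i j)"
  have summ: "summable (\<lambda>k. norm (?f i j k))" if "i < m" "j < m" for i j
  proof (rule summable_comparison_test'[where N = 0])
    show "summable (\<lambda>k. D * (1 / (s * t)) ^ k)"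
      using t by (intro summable_mult summable_geometric) auto
    fix k
    have "norm (?f i j k) = \<bar>sqc k\<bar> * (norm (mpow m a k i j) / t ^ k)"
      using t by simp
    also have "\<dots> \<le> 1 * (norm (mpow m a k i j) / t ^ k)"
      using t abs_sqc_le by (intro mult_right_mono) auto
    also have "\<dots> = (s ^ k * norm (mpow m a k i j)) * (1 / (s * t)) ^ k"
      using s t by (simp add: power_mult_distrib power_one_over field_simps)
    also have "\<dots> \<le> D * (1 / (s * t)) ^ k"
      using D[OF that] s t by (intro mult_right_mono) auto
    finally show "norm (norm (?f i j k)) \<le> D * (1 / (s * t)) ^ k" by simp
  qed
  define S where "S i j = scaleR (sqrt t) (\<Sum>k. ?f i j k)" for i j
  have starS: "star (S i j) = S j i" if "i < m" "j < m" for i j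
  proof -
    have "star (\<Sum>k. ?f i j k) = (\<Sum>k. star (?f i j k))"
      by (rule bounded_linear.suminf[OF bounded_linear_star])
        (rule summable_norm_cancel[OF summ[OF that]])
    also have "\<dots> = (\<Sum>k. ?f j i k)"
      using star_mpow[OF sa that] by (simp add: star_scaleR)
    finally show ?thesis by (simp add: S_def star_scaleR)
  qed
  have "(if i = j then scaleR t 1 else 0) - a i j = (\<Sum>r<m. star (S r i) * S r j)"
    if ij: "i < m" "j < m" for i j
  proof -
    \<comment> \<open>Cauchy products of entries, summed over the middle index \<open>r\<close>,
      give in degree \<open>k\<close> the \<open>k\<close>-th matrix power times the convolution of
      the coefficients. Only the degrees 0 and 1 survive.\<close>
    have "(\<lambda>k. \<Sum>r<m. \<Sum>p\<le>k. ?f i r p * ?f r j (k - p)) sums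
        (\<Sum>r<m. (\<Sum>k. ?f i r k) * (\<Sum>k. ?f r j k))"
      by (intro sums_sum Cauchy_product_sums summ) (use ij in auto)
    moreover have "(\<Sum>r<m. \<Sum>p\<le>k. ?f i r p * ?f r j (k - p)) =
        (if k = 0 then mpow m a 0 i j else if k = 1 then - scaleR (1 / t) (mpow m a 1 i j) else 0)" for k
    proof -
      have "(\<Sum>r<m. \<Sum>p\<le>k. ?f i r p * ?f r j (k - p)) = (\<Sum>p\<le>k. \<Sum>r<m. ?f i r p * ?f r j (k - p))"
        by (rule sum.swap)
      also have "\<dots> = (\<Sum>p\<le>k. scaleR (sqc p * sqc (k - p)) (scaleR (1 / t ^ k) (mpow m a k i j)))"
      proof (rule sum.cong)
        fix p assume p: "p \<in> {..k}"
        have "(\<Sum>r<m. ?f i r p * ?f r j (k - p)) =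
            scaleR (sqc p / t ^ p * (sqc (k - p) / t ^ (k - p))) (\<Sum>r<m. mpow m a p i r * mpow m a (k - p) r j)"
          by (simp add: scaleR_sum_right mult.commute)
        also have "(\<Sum>r<m. mpow m a p i r * mpow m a (k - p) r j) = mpow m a k i j"
          using mpow_add[OF ij(1), of a p "k - p" j] p by simp
        also have "sqc p / t ^ p * (sqc (k - p) / t ^ (k - p)) = sqc p * sqc (k - p) * (1 / t ^ k)"
          using p by (simp flip: power_add)
        finally show "(\<Sum>r<m. ?f i r p * ?f r j (k - p)) =
            scaleR (sqc p * sqc (k - p)) (scaleR (1 / t ^ k) (mpow m a k i j))" by simp
      qed simp
      also have "\<dots> = scaleR (\<Sum>p\<le>k. sqc p * sqc (k - p)) (scaleR (1 / t ^ k) (mpow m a k i j))"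
        unfolding scaleR_left.sum ..
      finally show ?thesis by (auto simp: sqc_convolution)
    qed
    moreover have "(\<lambda>k. if k = 0 then mpow m a 0 i j else if k = 1 then - scaleR (1 / t) (mpow m a 1 i j) else 0) sums
      (\<Sum>k\<in>{0, 1::nat}. if k = 0 then mpow m a 0 i j else if k = 1 then - scaleR (1 / t) (mpow m a 1 i j) else 0)"
      by (rule sums_finite) auto
    ultimately have eq: "(\<Sum>r<m. (\<Sum>k. ?f i r k) * (\<Sum>k. ?f r j k)) =
        mpow m a 0 i j - scaleR (1 / t) (mpow m a 1 i j)"
      by (auto dest: sums_unique2)
    have m1: "mpow m a 1 i j = a i j"
    proof -
      have "mpow m a 1 i j = (\<Sum>q<m. if q = j then a i j else 0)"
        unfolding One_nat_def mpow.simps by (rule sum.cong) auto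
      then show ?thesis using ij by simp
    qed
    have "(\<Sum>r<m. star (S r i) * S r j) = (\<Sum>r<m. S i r * S r j)"
      using starS ij by simp
    also have "\<dots> = scaleR t (\<Sum>r<m. (\<Sum>k. ?f i r k) * (\<Sum>k. ?f r j k))"
      using t by (simp add: S_def scaleR_sum_right)
    also have "\<dots> = (if i = j then scaleR t 1 else 0) - a i j"
      using t unfolding eq m1 by (simp add: scaleR_diff_right)
    finally show ?thesis by simp
  qed
  then show ?thesis using t by blast
qed

section \<open>Approximate eigenvectors\<close>

text \<open>The increments decrease, so \<open>Suc N\<close> copies of the last one are at most
  their sum, which telescopes to something below \<open>f 0\<close>.\<close>

lemma convex_sequence_increment:
  fixes f :: "nat \<Rightarrow> 'a::cstar"
  assumes "\<And>k. cpos (f k)" "\<And>k. cpos (f k - f (Suc k))"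
    "\<And>k. cpos (f k - f (Suc k) - (f (Suc k) - f (Suc (Suc k))))"
  shows "real (Suc N) * norm (f N - f (Suc N)) \<le> norm (f 0)"
proof -
  have mono: "cpos (f k - f (Suc k) - (f N - f (Suc N)))" if "k \<le> N" for k
    using that
  proof (induction N rule: dec_induct)
    case (step j)
    from cpos_add[OF step.IH assms(3)[of j]] show ?case by (simp add: algebra_simps)
  qed simp
  have tele: "(\<Sum>k<n. f k - f (Suc k)) = f 0 - f n" for n
    by (induction n) auto
  have "cpos (\<Sum>k<Suc N. f k - f (Suc k) - (f N - f (Suc N)))"
    using mono by (intro cpos_sum) auto
  also have "(\<Sum>k<Suc N. f k - f (Suc k) - (f N - f (Suc N))) =
      (f 0 - f (Suc N)) - (\<Sum>k<Suc N. f N - f (Suc N))"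
    unfolding sum_subtractf[of _ "\<lambda>_. f N - f (Suc N)"] tele ..
  also have "(\<Sum>k<Suc N. f N - f (Suc N)) = scaleR (real (Suc N)) (f N - f (Suc N))"
    by (simp add: sum_constant_scaleR del: sum.lessThan_Suc)
  finally have "cpos (f 0 - scaleR (real (Suc N)) (f N - f (Suc N)))"
    using cpos_add[OF _ assms(1)[of "Suc N"]] by fastforce
  then have "norm (scaleR (real (Suc N)) (f N - f (Suc N))) \<le> norm (f 0)"
    by (intro cpos_norm_mono cpos_scaleR assms(2)) auto
  then show ?thesis by simp
qed

text \<open>The hypotheses \<open>pos\<close> and \<open>le\<close> say that \<open>a\<close> lies
  between 0 and 1 as a quadratic form. A diagonal entry of a power is a product of two columns, so
  positivity, decrease and convexity of \<open>f\<close> become statements about the forms of 1,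
  \<open>a\<close> and \<open>1 - a\<close> at columns or differences of columns, according to the
  parity of the exponent.\<close>

lemma norm_mpow_diag_increment:
  fixes a :: "nat \<Rightarrow> nat \<Rightarrow> 'a::cstar"
  assumes sa: "\<And>i j. i < m \<Longrightarrow> j < m \<Longrightarrow> star (a i j) = a j i"
    and pos: "\<And>v. cpos (\<Sum>i<m. star (v i) * (\<Sum>l<m. a i l * v l))"
    and le: "\<And>v. cpos (\<Sum>i<m. star (v i) * (v i - (\<Sum>l<m. a i l * v l)))"
    and j: "j < m"
  shows "real (Suc N) * norm (mpow m a N j j - mpow m a (Suc N) j j) \<le> 1"
    and "cpos (mpow m a N j j)" "norm (mpow m a N j j) \<le> 1"
proof -
  define f where "f k = mpow m a k j j" for k
  define v where "v k i = mpow m a k i j" for k i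
  have fv: "f (p + q) = (\<Sum>i<m. star (v p i) * v q i)" for p q
    unfolding f_def v_def mpow_add[OF j] using star_mpow[OF sa] j by simp
  have av: "(\<Sum>l<m. a i l * v k l) = v (Suc k) i" for i k
    by (simp add: v_def)
  have aw: "(\<Sum>l<m. a i l * (v k l - v (Suc k) l)) = v (Suc k) i - v (Suc (Suc k)) i" for i k
    using av[of i k] av[of i "Suc k"] by (simp add: right_diff_distrib sum_subtractf)
  have f2: "cpos (f (2 * k))" for k
    unfolding mult_2 fv by (intro cpos_sum cpos_star_mult)
  have f2s: "cpos (f (Suc (2 * k)))" for k
    using pos[of "v k"] unfolding av fv[symmetric] by (simp add: mult_2)
  have d2: "cpos (f (2 * k) - f (Suc (2 * k)))" for k
    using le[of "v k"] unfolding av right_diff_distrib sum_subtractf fv[symmetric] by (simp add: mult_2)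
  have c2: "cpos (f (2 * k) - f (Suc (2 * k)) - (f (Suc (2 * k)) - f (Suc (Suc (2 * k)))))" for k
  proof -
    have "cpos (\<Sum>i<m. star (v k i - v (Suc k) i) * (v k i - v (Suc k) i))"
      by (intro cpos_sum cpos_star_mult)
    then show ?thesis
      unfolding star_diff right_diff_distrib left_diff_distrib sum_subtractf fv[symmetric]
      by (simp add: mult_2)
  qed
  have c2s: "cpos (f (Suc (2 * k)) - f (Suc (Suc (2 * k))) - (f (Suc (Suc (2 * k))) - f (Suc (Suc (Suc (2 * k))))))" for k
    using pos[of "\<lambda>i. v k i - v (Suc k) i"]
    unfolding aw
    unfolding star_diff right_diff_distrib left_diff_distrib sum_subtractf fv[symmetric]
    by (simp add: mult_2)
  \<comment> \<open>At odd exponents decrease is not a value of a form; it follows from convexity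
    there and decrease at the next even exponent.\<close>
  have d2s: "cpos (f (Suc (2 * k)) - f (Suc (Suc (2 * k))))" for k
    using cpos_add[OF c2s[of k] d2[of "Suc k"]] by simp
  have cases: "P k" if "\<And>k. P (2 * k)" "\<And>k. P (Suc (2 * k))" for P :: "nat \<Rightarrow> bool" and k
    using that by (metis even_Suc_div_two odd_Suc_div_two even_two_times_div_two parity_cases odd_two_times_div_two_succ Suc_eq_plus1)
  have 1: "cpos (f k)" for k by (rule cases[of "\<lambda>k. cpos (f k)"]) (use f2 f2s in auto)
  have 2: "cpos (f k - f (Suc k))" for k
    by (rule cases[of "\<lambda>k. cpos (f k - f (Suc k))"]) (use d2 d2s in auto)
  have 3: "cpos (f k - f (Suc k) - (f (Suc k) - f (Suc (Suc k))))" for k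
    by (rule cases[of "\<lambda>k. cpos (f k - f (Suc k) - (f (Suc k) - f (Suc (Suc k))))"]) (use c2 c2s in auto)
  have f0: "norm (f 0) \<le> 1" by (simp add: f_def norm_one_le)
  show "real (Suc N) * norm (mpow m a N j j - mpow m a (Suc N) j j) \<le> 1"
    using convex_sequence_increment[of f N, OF 1 2 3] f0 by (simp add: f_def)
  show "cpos (mpow m a N j j)" using 1 by (simp add: f_def)
  have "norm (f N) \<le> norm (f 0)"
  proof (induction N)
    case (Suc N)
    have "norm (f (Suc N)) \<le> norm (f N)"
      using 1 2 by (intro cpos_norm_mono) auto
    then show ?case using Suc by linarith
  qed simp
  then show "norm (mpow m a N j j) \<le> 1" using f0 by (simp add: f_def)
qed

lemma cpos_diff_trans: "cpos (y - x) \<Longrightarrow> cpos (z - y) \<Longrightarrow> cpos (z - x)"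
  using cpos_add[of "y - x" "z - y"] by simp

lemma cpos_sum_minus_member:
  assumes "finite A" "i \<in> A" "\<And>j. j \<in> A \<Longrightarrow> cpos (f j)"
  shows "cpos (sum f A - f i)"
  using cpos_sum[of "A - {i}" f] assms by (simp add: sum_diff1)

text \<open>Half of this is the defect in the Cauchy-Schwarz inequality for the sum of the
  \<open>w i\<close>, exhibited as a sum of squares.\<close>

lemma sum_square_differences:
  fixes w :: "'i \<Rightarrow> 'a::cstar"
  assumes "finite C"
  shows "(\<Sum>i\<in>C. \<Sum>j\<in>C. star (w i - w j) * (w i - w j)) =
    scaleR (2 * real (card C)) (\<Sum>i\<in>C. star (w i) * w i) - scaleR 2 (\<Sum>i\<in>C. \<Sum>j\<in>C. star (w i) * w j)"
proof -
  have "(\<Sum>i\<in>C. \<Sum>j\<in>C. star (w i - w j) * (w i - w j)) =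
    (\<Sum>i\<in>C. \<Sum>j\<in>C. star (w i) * w i) + (\<Sum>i\<in>C. \<Sum>j\<in>C. star (w j) * w j)
    - (\<Sum>i\<in>C. \<Sum>j\<in>C. star (w i) * w j) - (\<Sum>i\<in>C. \<Sum>j\<in>C. star (w j) * w i)"
    unfolding sum.distrib[symmetric] sum_subtractf[symmetric]
    by (simp add: star_diff algebra_simps)
  also have "(\<Sum>i\<in>C. \<Sum>j\<in>C. star (w j) * w i) = (\<Sum>i\<in>C. \<Sum>j\<in>C. star (w i) * w j)"
    by (rule sum.swap)
  also have "(\<Sum>i\<in>C. \<Sum>j\<in>C. star (w i) * w i) = scaleR (real (card C)) (\<Sum>i\<in>C. star (w i) * w i)"
    by (simp add: sum_constant_scaleR scaleR_sum_right)
  also have "(\<Sum>i\<in>C. \<Sum>j\<in>C. star (w j) * w j) = scaleR (real (card C)) (\<Sum>i\<in>C. star (w i) * w i)"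
    by (simp add: sum_constant_scaleR)
  finally show ?thesis
    by (simp only: scaleR_2 mult_2 scaleR_add_left) simp
qed

lemma tendsto_zero_of_norm_square_le:
  fixes z :: "nat \<Rightarrow> 'a::real_normed_vector"
  assumes "\<And>N. (norm (z N))\<^sup>2 \<le> B / real (Suc N)"
  shows "z \<longlonglongrightarrow> 0"
proof -
  have "(\<lambda>N. B * inverse (real (Suc N))) \<longlonglongrightarrow> B * 0"
    by (intro tendsto_intros LIMSEQ_inverse_real_of_nat)
  then have "(\<lambda>N. (norm (z N))\<^sup>2) \<longlonglongrightarrow> 0"
    by (intro Lim_null_comparison[where f = "\<lambda>N. (norm (z N))\<^sup>2"] always_eventually)
      (use assms in \<open>auto simp: divide_inverse\<close>)
  from tendsto_real_sqrt[OF this] have "(\<lambda>N. sqrt ((norm (z N))\<^sup>2)) \<longlonglongrightarrow> sqrt 0" .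
  then have "(\<lambda>N. norm (z N)) \<longlonglongrightarrow> 0" by simp
  then show ?thesis by (rule tendsto_norm_zero_cancel)
qed

section \<open>The matrix of a clique, scaled by \<open>1 / card C\<close>, as a quadratic form
  between 0 and 1\<close>

context
  fixes m :: nat and C :: "nat set" and x Y :: "nat \<Rightarrow> nat \<Rightarrow> 'a::cstar" and g :: 'a
    and a :: "nat \<Rightarrow> nat \<Rightarrow> 'a"
  assumes C: "C \<subseteq> {..<m}" "C \<noteq> {}"
    and xY: "\<And>i j. i < m \<Longrightarrow> j < m \<Longrightarrow> x i j = (\<Sum>r<m. star (Y r i) * Y r j)"
    and unit: "1 = (\<Sum>k<m. x k k) + star g * g"
    and a_def: "\<And>i j. a i j = (if i \<in> C \<and> j \<in> C then scaleR (1 / real (card C)) (x i j) else 0)"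
begin

private lemma finC: "finite C"
  using C finite_subset by blast

private lemma cardC: "real (card C) > 0"
  using C finC by (simp add: card_gt_0_iff)

lemma star_x: "i < m \<Longrightarrow> j < m \<Longrightarrow> star (x i j) = x j i"
  by (simp add: xY star_sum star_mult)

private lemma star_a: "i < m \<Longrightarrow> j < m \<Longrightarrow> star (a i j) = a j i"
  by (auto simp: a_def star_scaleR star_x)

private lemma form_a:
  "(\<Sum>i<m. star (v i) * (\<Sum>l<m. a i l * v l)) =
    scaleR (1 / real (card C)) (\<Sum>r<m. \<Sum>i\<in>C. \<Sum>l\<in>C. star (Y r i * v i) * (Y r l * v l))"
proof -
  have "(\<Sum>l<m. a i l * v l) = (if i \<in> C then \<Sum>l\<in>C. scaleR (1 / real (card C)) (x i l * v l) else 0)" for i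
  proof -
    have "(\<Sum>l<m. a i l * v l) = (\<Sum>l<m. if l \<in> C then (if i \<in> C then scaleR (1 / real (card C)) (x i l * v l) else 0) else 0)"
      by (rule sum.cong) (auto simp: a_def)
    also have "\<dots> = (\<Sum>l\<in>{..<m} \<inter> C. if i \<in> C then scaleR (1 / real (card C)) (x i l * v l) else 0)"
      by (simp add: sum.inter_restrict)
    also have "{..<m} \<inter> C = C" using C by blast
    finally show ?thesis by auto
  qed
  then have "(\<Sum>i<m. star (v i) * (\<Sum>l<m. a i l * v l)) =
      (\<Sum>i<m. if i \<in> C then \<Sum>l\<in>C. scaleR (1 / real (card C)) (star (v i) * (x i l * v l)) else 0)"
    by (intro sum.cong) (auto simp: sum_distrib_left)
  also have "\<dots> = (\<Sum>i\<in>{..<m} \<inter> C. \<Sum>l\<in>C. scaleR (1 / real (card C)) (star (v i) * (x i l * v l)))"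
    by (simp add: sum.inter_restrict)
  also have "{..<m} \<inter> C = C" using C by blast
  also have "(\<Sum>i\<in>C. \<Sum>l\<in>C. scaleR (1 / real (card C)) (star (v i) * (x i l * v l))) =
      (\<Sum>i\<in>C. \<Sum>l\<in>C. \<Sum>r<m. scaleR (1 / real (card C)) (star (Y r i * v i) * (Y r l * v l)))"
  proof (intro sum.cong refl)
    fix i l assume "i \<in> C" "l \<in> C"
    then have "i < m" "l < m" using C by auto
    then show "scaleR (1 / real (card C)) (star (v i) * (x i l * v l)) =
        (\<Sum>r<m. scaleR (1 / real (card C)) (star (Y r i * v i) * (Y r l * v l)))"
      by (simp add: xY sum_distrib_left sum_distrib_right scaleR_sum_right star_mult mult.assoc)
  qed
  also have "\<dots> = (\<Sum>r<m. \<Sum>i\<in>C. \<Sum>l\<in>C. scaleR (1 / real (card C)) (star (Y r i * v i) * (Y r l * v l)))"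
    by (subst sum.swap[of _ "{..<m}" C], subst sum.swap[of _ "{..<m}" C]) (rule refl)
  finally show ?thesis by (simp add: scaleR_sum_right)
qed

text \<open>The decomposition \<open>unit\<close> of 1 is inserted between the two factors, and each
  \<open>x k k\<close> is factored through \<open>Y\<close>. The term \<open>k = i\<close> is split
  off because it is the one that competes with the form of \<open>a\<close>.\<close>

private lemma form_one:
  assumes "i < m"
  shows "star (v i) * v i = star (g * v i) * (g * v i) + (\<Sum>r<m. star (Y r i * v i) * (Y r i * v i))
    + (\<Sum>k\<in>{..<m} - {i}. \<Sum>r<m. star (Y r k * v i) * (Y r k * v i))"
proof -
  have "star (v i) * v i = star (v i) * 1 * v i" by simp
  also have "\<dots> = star (g * v i) * (g * v i) + (\<Sum>k<m. star (v i) * x k k * v i)"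
    by (subst unit) (simp add: distrib_left distrib_right sum_distrib_left sum_distrib_right star_mult mult.assoc add.commute)
  also have "(\<Sum>k<m. star (v i) * x k k * v i) = (\<Sum>k<m. \<Sum>r<m. star (Y r k * v i) * (Y r k * v i))"
    by (intro sum.cong refl) (simp add: xY sum_distrib_left sum_distrib_right star_mult mult.assoc)
  also have "\<dots> = (\<Sum>r<m. star (Y r i * v i) * (Y r i * v i))
    + (\<Sum>k\<in>{..<m} - {i}. \<Sum>r<m. star (Y r k * v i) * (Y r k * v i))"
    using assms by (intro sum.remove) auto
  finally show ?thesis by (simp add: add.assoc)
qed

text \<open>All terms are squares, so where this form is small each of them is small. The last one
  is what remains of the terms \<open>Y r i * v i\<close> after the form of \<open>a\<close> is
  subtracted, by \<open>sum_square_differences\<close>.\<close>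

private lemma form_one_minus_a:
  "(\<Sum>i<m. star (v i) * (v i - (\<Sum>l<m. a i l * v l))) =
    (\<Sum>i\<in>{..<m} - C. star (v i) * v i) + (\<Sum>i\<in>C. star (g * v i) * (g * v i))
    + (\<Sum>i\<in>C. \<Sum>k\<in>{..<m} - {i}. \<Sum>r<m. star (Y r k * v i) * (Y r k * v i))
    + scaleR (1 / (2 * real (card C))) (\<Sum>r<m. \<Sum>i\<in>C. \<Sum>j\<in>C.
        star (Y r i * v i - Y r j * v j) * (Y r i * v i - Y r j * v j))"
proof -
  have "(\<Sum>i<m. star (v i) * (v i - (\<Sum>l<m. a i l * v l))) =
      (\<Sum>i<m. star (v i) * v i) - scaleR (1 / real (card C)) (\<Sum>r<m. \<Sum>i\<in>C. \<Sum>l\<in>C. star (Y r i * v i) * (Y r l * v l))"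
    unfolding right_diff_distrib sum_subtractf form_a ..
  also have "(\<Sum>i<m. star (v i) * v i) = (\<Sum>i\<in>{..<m} - C. star (v i) * v i) + (\<Sum>i\<in>C. star (v i) * v i)"
    using C by (intro sum.subset_diff) auto
  also have "(\<Sum>i\<in>C. star (v i) * v i) = (\<Sum>i\<in>C. star (g * v i) * (g * v i))
    + (\<Sum>i\<in>C. \<Sum>r<m. star (Y r i * v i) * (Y r i * v i))
    + (\<Sum>i\<in>C. \<Sum>k\<in>{..<m} - {i}. \<Sum>r<m. star (Y r k * v i) * (Y r k * v i))"
    unfolding sum.distrib[symmetric] using C by (intro sum.cong form_one) auto
  also have "(\<Sum>i\<in>C. \<Sum>r<m. star (Y r i * v i) * (Y r i * v i)) = (\<Sum>r<m. \<Sum>i\<in>C. star (Y r i * v i) * (Y r i * v i))"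
    by (rule sum.swap)
  also have "\<dots> = scaleR (1 / real (card C)) (\<Sum>r<m. \<Sum>i\<in>C. \<Sum>l\<in>C. star (Y r i * v i) * (Y r l * v l)) +
      scaleR (1 / (2 * real (card C))) (\<Sum>r<m. \<Sum>i\<in>C. \<Sum>j\<in>C.
        star (Y r i * v i - Y r j * v j) * (Y r i * v i - Y r j * v j))"
    unfolding sum_square_differences[OF finC] sum_subtractf scaleR_sum_right[symmetric] scaleR_diff_right
    using cardC by simp
  finally show ?thesis by (simp add: algebra_simps)
qed

private lemma cpos_form_a: "cpos (\<Sum>i<m. star (v i) * (\<Sum>l<m. a i l * v l))"
proof -
  have "(\<Sum>i\<in>C. \<Sum>l\<in>C. star (Y r i * v i) * (Y r l * v l)) =
      star (\<Sum>i\<in>C. Y r i * v i) * (\<Sum>l\<in>C. Y r l * v l)" for r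
    by (simp add: star_sum sum_product)
  moreover have "0 \<le> 1 / real (card C)" by simp
  ultimately show ?thesis
    unfolding form_a by (simp only:) (intro cpos_scaleR cpos_sum cpos_star_mult)
qed

private lemma cpos_form_one_minus_a: "cpos (\<Sum>i<m. star (v i) * (v i - (\<Sum>l<m. a i l * v l)))"
proof -
  have "0 \<le> 1 / (2 * real (card C))" by simp
  then show ?thesis
    unfolding form_one_minus_a by (intro cpos_add cpos_scaleR cpos_sum cpos_star_mult)
qed

text \<open>Each estimate climbs from a single square through the enclosing sums of positive
  elements up to \<open>H\<close>. The factor \<open>2 * real (card C)\<close> undoes the scaling of
  the last part.\<close>

private lemma norm_parts_le:
  fixes v :: "nat \<Rightarrow> 'a"
  defines "H \<equiv> (\<Sum>i<m. star (v i) * (v i - (\<Sum>l<m. a i l * v l)))"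
  assumes i: "i \<in> C"
  shows "(norm (g * v i))\<^sup>2 \<le> norm H"
    and "k < m \<Longrightarrow> k \<noteq> i \<Longrightarrow> r < m \<Longrightarrow> (norm (Y r k * v i))\<^sup>2 \<le> norm H"
    and "j \<in> C \<Longrightarrow> r < m \<Longrightarrow> (norm (Y r i * v i - Y r j * v j))\<^sup>2 \<le> 2 * real (card C) * norm H"
proof -
  let ?sq = "\<lambda>d::'a. star d * d"
  define P1 where "P1 = (\<Sum>i\<in>{..<m} - C. ?sq (v i))"
  define P2 where "P2 = (\<Sum>i\<in>C. ?sq (g * v i))"
  define P3 where "P3 = (\<Sum>i\<in>C. \<Sum>k\<in>{..<m} - {i}. \<Sum>r<m. ?sq (Y r k * v i))"
  define P4 where "P4 = scaleR (1 / (2 * real (card C))) (\<Sum>r<m. \<Sum>i\<in>C. \<Sum>j\<in>C. ?sq (Y r i * v i - Y r j * v j))"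
  have H: "H = P1 + P2 + P3 + P4"
    unfolding H_def P1_def P2_def P3_def P4_def by (rule form_one_minus_a)
  have P: "cpos P1" "cpos P2" "cpos P3" "cpos P4"
    unfolding P1_def P2_def P3_def P4_def
    by (intro cpos_scaleR cpos_sum cpos_star_mult; simp)+
  have le: "(norm d)\<^sup>2 \<le> norm S" if "cpos (S - ?sq d)" for d S
    using cpos_norm_mono[OF cpos_star_mult that] by (simp add: norm_star_mult)
  have "cpos (P2 - ?sq (g * v i))"
    unfolding P2_def using i finC by (intro cpos_sum_minus_member cpos_star_mult) auto
  moreover have "cpos (H - P2)"
    unfolding H using cpos_add[OF cpos_add[OF P(1) P(3)] P(4)] by (simp add: algebra_simps)
  ultimately show "(norm (g * v i))\<^sup>2 \<le> norm H"
    using cpos_diff_trans le by blast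
  show "(norm (Y r k * v i))\<^sup>2 \<le> norm H" if "k < m" "k \<noteq> i" "r < m"
  proof -
    have 1: "cpos ((\<Sum>r<m. ?sq (Y r k * v i)) - ?sq (Y r k * v i))"
      using that by (intro cpos_sum_minus_member cpos_star_mult) auto
    have 2: "cpos ((\<Sum>k\<in>{..<m} - {i}. \<Sum>r<m. ?sq (Y r k * v i)) - (\<Sum>r<m. ?sq (Y r k * v i)))"
      using that by (intro cpos_sum_minus_member cpos_sum cpos_star_mult) auto
    have 3: "cpos (P3 - (\<Sum>k\<in>{..<m} - {i}. \<Sum>r<m. ?sq (Y r k * v i)))"
      unfolding P3_def using i finC by (intro cpos_sum_minus_member cpos_sum cpos_star_mult) auto
    have 4: "cpos (H - P3)"
      unfolding H using cpos_add[OF cpos_add[OF P(1) P(2)] P(4)] by (simp add: algebra_simps)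
    show ?thesis
      by (rule le[OF cpos_diff_trans[OF cpos_diff_trans[OF cpos_diff_trans[OF 1 2] 3] 4]])
  qed
  show "(norm (Y r i * v i - Y r j * v j))\<^sup>2 \<le> 2 * real (card C) * norm H" if "j \<in> C" "r < m"
  proof -
    let ?d = "\<lambda>r i j. Y r i * v i - Y r j * v j"
    have 1: "cpos ((\<Sum>j\<in>C. ?sq (?d r i j)) - ?sq (?d r i j))"
      using that finC by (intro cpos_sum_minus_member cpos_star_mult) auto
    have 2: "cpos ((\<Sum>i\<in>C. \<Sum>j\<in>C. ?sq (?d r i j)) - (\<Sum>j\<in>C. ?sq (?d r i j)))"
      using i finC by (intro cpos_sum_minus_member cpos_sum cpos_star_mult) auto
    have 3: "cpos ((\<Sum>r<m. \<Sum>i\<in>C. \<Sum>j\<in>C. ?sq (?d r i j)) - (\<Sum>i\<in>C. \<Sum>j\<in>C. ?sq (?d r i j)))"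
      using that by (intro cpos_sum_minus_member cpos_sum cpos_star_mult) auto
    have 4: "cpos (scaleR (2 * real (card C)) H - (\<Sum>r<m. \<Sum>i\<in>C. \<Sum>j\<in>C. ?sq (?d r i j)))"
    proof -
      have "cpos (scaleR (2 * real (card C)) (H - P4))"
        unfolding H using cpos_add[OF cpos_add[OF P(1) P(2)] P(3)] cardC
        by (intro cpos_scaleR) (simp_all add: algebra_simps)
      then show ?thesis
        unfolding P4_def using cardC by (simp add: scaleR_diff_right)
    qed
    have "(norm (?d r i j))\<^sup>2 \<le> norm (scaleR (2 * real (card C)) H)"
      by (rule le[OF cpos_diff_trans[OF cpos_diff_trans[OF cpos_diff_trans[OF 1 2] 3] 4]])
    then show ?thesis using cardC by simp
  qed
qed

text \<open>The columns of \<open>a\<^sup>N\<close> are approximate eigenvectors of \<open>a\<close> for the eigenvalue 1, since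
  \<open>0 \<le> a \<le> 1\<close>. They do not vanish in the limit: otherwise the powers of \<open>a\<close> would decay geometrically,
  and the binomial series would give a square root of \<open>t - a\<close> for some \<open>t < 1\<close>.\<close>

lemma approximate_eigenvectors:
  assumes nosq: "\<And>t S. 0 < t \<Longrightarrow> t < 1 \<Longrightarrow> \<not> (\<forall>i<m. \<forall>j<m.
    (if i = j then scaleR t 1 else 0) - a i j = (\<Sum>r<m. star (S r i) * S r j))"
  obtains c :: "nat \<Rightarrow> nat \<Rightarrow> 'a" where
    "\<And>N i. i < m \<Longrightarrow> norm (c N i) \<le> 1"
    "\<And>N. \<exists>i\<in>C. norm (c N i) > 1 / (2 * real m)"
    "\<And>i. i \<in> C \<Longrightarrow> (\<lambda>N. g * c N i) \<longlonglongrightarrow> 0"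
    "\<And>i k r. i \<in> C \<Longrightarrow> k < m \<Longrightarrow> k \<noteq> i \<Longrightarrow> r < m \<Longrightarrow> (\<lambda>N. Y r k * c N i) \<longlonglongrightarrow> 0"
    "\<And>i j r. i \<in> C \<Longrightarrow> j \<in> C \<Longrightarrow> r < m \<Longrightarrow> (\<lambda>N. Y r i * c N i - Y r j * c N j) \<longlonglongrightarrow> 0"
proof -
  have m: "m \<ge> 1" using C by (cases m) auto
  have "\<exists>i<m. \<exists>j<m. norm (mpow m a (Suc N) i j) > 1 / (2 * real m)" for N
  proof (rule ccontr)
    assume "\<not> ?thesis"
    then have "norm (mpow m a (Suc N) i j) \<le> 1 / (2 * real m)" if "i < m" "j < m" for i j
      using that by (meson linorder_not_less)
    with matrix_square_root[of "Suc N" m a] m star_a obtain t S where "0 < t" "t < 1"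
      "\<forall>i<m. \<forall>j<m. (if i = j then scaleR t 1 else 0) - a i j = (\<Sum>r<m. star (S r i) * S r j)"
      by auto
    then show False using nosq[of t S] by blast
  qed
  then obtain I J where IJ: "\<And>N. I N < m" "\<And>N. J N < m"
    "\<And>N. norm (mpow m a (Suc N) (I N) (J N)) > 1 / (2 * real m)"
    by metis
  \<comment> \<open>Rows of \<open>a\<close> outside \<open>C\<close> are zero, hence so are those
    of every positive power. The zeroth power would not do, which is why \<open>Suc N\<close> is
    used.\<close>
  have IC: "I N \<in> C" for N
  proof (rule ccontr)
    assume "I N \<notin> C"
    then have "mpow m a (Suc N) (I N) (J N) = 0" by (simp add: a_def)
    then show False using IJ(3)[of N] m by (simp del: mpow.simps)
  qed
  define c where "c N i = mpow m a (Suc N) i (J N)" for N i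
  define H where "H N = (\<Sum>i<m. star (c N i) * (c N i - (\<Sum>l<m. a i l * c N l)))" for N
  have cc: "(\<Sum>i<m. star (mpow m a p i (J N)) * mpow m a q i (J N)) = mpow m a (p + q) (J N) (J N)" for p q N
    unfolding mpow_add[OF IJ(2)] using star_mpow[OF star_a] IJ(2) by simp
  \<comment> \<open>As \<open>a\<close> is self-adjoint, products of entries of the same column of
    two powers add up to a diagonal entry of the combined power. So the defect of the column is an
    increment of the diagonal sequence and tends to 0.\<close>
  have H: "H N = mpow m a (2 * Suc N) (J N) (J N) - mpow m a (Suc (2 * Suc N)) (J N) (J N)" for N
  proof -
    have "H N = (\<Sum>i<m. star (mpow m a (Suc N) i (J N)) * mpow m a (Suc N) i (J N)) -
        (\<Sum>i<m. star (mpow m a (Suc N) i (J N)) * mpow m a (Suc (Suc N)) i (J N))"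
      unfolding H_def c_def right_diff_distrib sum_subtractf mpow.simps(2)[of m a "Suc N"] ..
    then show ?thesis unfolding cc by (simp add: mult_2 del: mpow.simps)
  qed
  note * = norm_mpow_diag_increment[OF star_a cpos_form_a cpos_form_one_minus_a IJ(2)]
  have nH: "norm (H N) \<le> 1 / real (Suc N)" for N
  proof -
    have "real (Suc N) * norm (H N) \<le> real (Suc (2 * Suc N)) * norm (H N)"
      by (intro mult_right_mono) auto
    also have "\<dots> \<le> 1" unfolding H by (rule *(1))
    finally show ?thesis by (simp add: field_simps)
  qed
  have "norm (c N i) \<le> 1" if "i < m" for N i
  proof -
    have "(norm (c N i))\<^sup>2 \<le> norm ((\<Sum>i<m. star (c N i) * c N i) + 0)"
      by (rule norm_square_le_sum) (use that in auto)
    also have "\<dots> \<le> 1" unfolding c_def cc using *(3) by (simp del: mpow.simps)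
    finally show ?thesis by (simp add: power_le_one_iff)
  qed
  moreover have "\<exists>i\<in>C. norm (c N i) > 1 / (2 * real m)" for N
    using IC IJ(3) by (auto simp: c_def simp del: mpow.simps)
  moreover have "(\<lambda>N. g * c N i) \<longlonglongrightarrow> 0" if "i \<in> C" for i
    by (rule tendsto_zero_of_norm_square_le[where B = 1])
      (rule order_trans[OF norm_parts_le(1)[OF that, of "c N" for N, folded H_def] nH])
  moreover have "(\<lambda>N. Y r k * c N i) \<longlonglongrightarrow> 0" if "i \<in> C" "k < m" "k \<noteq> i" "r < m" for i k r
    by (rule tendsto_zero_of_norm_square_le[where B = 1])
      (rule order_trans[OF norm_parts_le(2)[OF that, of "c N" for N, folded H_def] nH])
  moreover have "(\<lambda>N. Y r i * c N i - Y r j * c N j) \<longlonglongrightarrow> 0" if "i \<in> C" "j \<in> C" "r < m" for i j r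
  proof (rule tendsto_zero_of_norm_square_le[where B = "2 * real (card C)"])
    fix N
    have "2 * real (card C) * norm (H N) \<le> 2 * real (card C) * (1 / real (Suc N))"
      using nH by (intro mult_left_mono) auto
    then show "(norm (Y r i * c N i - Y r j * c N j))\<^sup>2 \<le> 2 * real (card C) / real (Suc N)"
      using norm_parts_le(3)[OF that, of "c N", folded H_def] by simp
  qed
  ultimately show ?thesis using that by blast
qed

end

section \<open>The product of all C*-algebras on a type\<close>

locale unital_cstar =
  fixes A :: "('a, 'm) cstar_alg_scheme"
  assumes A: "unital_cstar_algebra A"
begin

lemma closed [simp]:
  "ca_zero A \<in> carrier A" "ca_one A \<in> carrier A"
  "x \<in> carrier A \<Longrightarrow> y \<in> carrier A \<Longrightarrow> ca_add A x y \<in> carrier A"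
  "x \<in> carrier A \<Longrightarrow> y \<in> carrier A \<Longrightarrow> ca_mul A x y \<in> carrier A"
  "x \<in> carrier A \<Longrightarrow> ca_smult A c x \<in> carrier A"
  "x \<in> carrier A \<Longrightarrow> ca_star A x \<in> carrier A"
  by (insert A, unfold unital_cstar_algebra_def, elim conjE, simp_all)

lemma vector_space_rules:
  "x \<in> carrier A \<Longrightarrow> y \<in> carrier A \<Longrightarrow> z \<in> carrier A \<Longrightarrow> ca_add A (ca_add A x y) z = ca_add A x (ca_add A y z)"
  "x \<in> carrier A \<Longrightarrow> y \<in> carrier A \<Longrightarrow> ca_add A x y = ca_add A y x"
  "x \<in> carrier A \<Longrightarrow> ca_add A x (ca_zero A) = x"
  "x \<in> carrier A \<Longrightarrow> y \<in> carrier A \<Longrightarrow> ca_smult A c (ca_add A x y) = ca_add A (ca_smult A c x) (ca_smult A c y)"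
  "x \<in> carrier A \<Longrightarrow> ca_smult A (c + d) x = ca_add A (ca_smult A c x) (ca_smult A d x)"
  "x \<in> carrier A \<Longrightarrow> ca_smult A (c * d) x = ca_smult A c (ca_smult A d x)"
  "x \<in> carrier A \<Longrightarrow> ca_smult A 1 x = x"
  by (insert A, unfold unital_cstar_algebra_def, elim conjE, simp_all)

lemma mul_rules:
  "x \<in> carrier A \<Longrightarrow> y \<in> carrier A \<Longrightarrow> z \<in> carrier A \<Longrightarrow> ca_mul A (ca_mul A x y) z = ca_mul A x (ca_mul A y z)"
  "x \<in> carrier A \<Longrightarrow> y \<in> carrier A \<Longrightarrow> z \<in> carrier A \<Longrightarrow>
    ca_mul A x (ca_add A y z) = ca_add A (ca_mul A x y) (ca_mul A x z)"
  "x \<in> carrier A \<Longrightarrow> y \<in> carrier A \<Longrightarrow> z \<in> carrier A \<Longrightarrow>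
    ca_mul A (ca_add A x y) z = ca_add A (ca_mul A x z) (ca_mul A y z)"
  "x \<in> carrier A \<Longrightarrow> y \<in> carrier A \<Longrightarrow> ca_mul A (ca_smult A c x) y = ca_smult A c (ca_mul A x y)"
  "x \<in> carrier A \<Longrightarrow> y \<in> carrier A \<Longrightarrow> ca_mul A x (ca_smult A c y) = ca_smult A c (ca_mul A x y)"
  "x \<in> carrier A \<Longrightarrow> ca_mul A (ca_one A) x = x" "x \<in> carrier A \<Longrightarrow> ca_mul A x (ca_one A) = x"
  by (insert A, unfold unital_cstar_algebra_def, elim conjE, simp_all)

lemma star_rules:
  "x \<in> carrier A \<Longrightarrow> ca_star A (ca_star A x) = x"
  "x \<in> carrier A \<Longrightarrow> y \<in> carrier A \<Longrightarrow> ca_star A (ca_add A x y) = ca_add A (ca_star A x) (ca_star A y)"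
  "x \<in> carrier A \<Longrightarrow> y \<in> carrier A \<Longrightarrow> ca_star A (ca_mul A x y) = ca_mul A (ca_star A y) (ca_star A x)"
  "x \<in> carrier A \<Longrightarrow> ca_star A (ca_smult A c x) = ca_smult A (cnj c) (ca_star A x)"
  by (insert A, unfold unital_cstar_algebra_def, elim conjE, simp_all)

lemma norm_rules:
  "x \<in> carrier A \<Longrightarrow> ca_norm A x \<ge> 0"
  "x \<in> carrier A \<Longrightarrow> ca_norm A x = 0 \<longleftrightarrow> x = ca_zero A"
  "x \<in> carrier A \<Longrightarrow> y \<in> carrier A \<Longrightarrow> ca_norm A (ca_add A x y) \<le> ca_norm A x + ca_norm A y"
  "x \<in> carrier A \<Longrightarrow> y \<in> carrier A \<Longrightarrow> ca_norm A (ca_mul A x y) \<le> ca_norm A x * ca_norm A y"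
  "x \<in> carrier A \<Longrightarrow> ca_norm A (ca_smult A c x) = cmod c * ca_norm A x"
  "x \<in> carrier A \<Longrightarrow> ca_norm A (ca_mul A (ca_star A x) x) = (ca_norm A x)\<^sup>2"
  by (insert A, unfold unital_cstar_algebra_def, elim conjE, simp_all)

lemma complete:
  assumes "\<And>k. f k \<in> carrier A"
    "\<And>e. e > 0 \<Longrightarrow> \<exists>N. \<forall>k\<ge>N. \<forall>l\<ge>N. ca_norm A (ca_sub A (f k) (f l)) < e"
  shows "\<exists>L\<in>carrier A. (\<lambda>k. ca_norm A (ca_sub A (f k) L)) \<longlonglongrightarrow> 0"
proof -
  have "\<forall>f. (\<forall>k. f k \<in> carrier A) \<and>
          (\<forall>e>0. \<exists>N. \<forall>k\<ge>N. \<forall>l\<ge>N. ca_norm A (ca_sub A (f k) (f l)) < e) \<longrightarrow>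
          (\<exists>L\<in>carrier A. (\<lambda>k. ca_norm A (ca_sub A (f k) L)) \<longlonglongrightarrow> 0)"
    using A unfolding unital_cstar_algebra_def by (elim conjE)
  then show ?thesis using assms by blast
qed

lemma add_left_cancel:
  assumes "x \<in> carrier A" "y \<in> carrier A" "ca_add A x y = x"
  shows "y = ca_zero A"
proof -
  have "\<forall>x\<in>carrier A. \<exists>y\<in>carrier A. ca_add A x y = ca_zero A"
    using A unfolding unital_cstar_algebra_def by (elim conjE)
  then obtain z where z: "z \<in> carrier A" "ca_add A x z = ca_zero A"
    using assms(1) by blast
  have "ca_add A z (ca_add A x y) = ca_add A (ca_add A z x) y"
    using vector_space_rules(1)[of z x y] z assms by simp
  also have "\<dots> = y"
    using z assms vector_space_rules(2)[of z x] vector_space_rules(2)[of "ca_zero A" y] vector_space_rules(3)[of y] by simp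
  finally show ?thesis
    using z assms vector_space_rules(2)[of z x] by simp
qed

lemma smult_0: "x \<in> carrier A \<Longrightarrow> ca_smult A 0 x = ca_zero A"
  using vector_space_rules(5)[of x 0 0] by (intro add_left_cancel[of "ca_smult A 0 x"]) auto

lemma add_neg: "x \<in> carrier A \<Longrightarrow> ca_add A x (ca_smult A (-1) x) = ca_zero A"
  using vector_space_rules(5)[of x 1 "-1"] vector_space_rules(7)[of x] smult_0[of x] by simp

lemma add_neg': "x \<in> carrier A \<Longrightarrow> ca_add A (ca_smult A (-1) x) x = ca_zero A"
  using add_neg vector_space_rules(2)[of "ca_smult A (-1) x" x] by simp

lemma zero_add: "x \<in> carrier A \<Longrightarrow> ca_add A (ca_zero A) x = x"
  using vector_space_rules(2)[of "ca_zero A" x] vector_space_rules(3)[of x] by simp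

lemma smult_zero: "ca_smult A c (ca_zero A) = ca_zero A"
  using vector_space_rules(6)[of "ca_zero A" c 0] smult_0[of "ca_zero A"] by simp

lemma norm_zero: "ca_norm A (ca_zero A) = 0"
  using norm_rules(2)[of "ca_zero A"] by simp

lemma norm_one_le: "ca_norm A (ca_one A) \<le> 1"
proof -
  have s: "ca_star A (ca_one A) = ca_one A"
    using star_rules(3)[of "ca_star A (ca_one A)" "ca_one A"] star_rules(1)[of "ca_one A"]
      mul_rules(6)[of "ca_star A (ca_one A)"] mul_rules(7)[of "ca_star A (ca_one A)"] mul_rules(7)[of "ca_one A"] by simp
  have "ca_norm A (ca_one A) * ca_norm A (ca_one A) = ca_norm A (ca_one A)"
    using norm_rules(6)[of "ca_one A"] mul_rules(6)[of "ca_one A"] s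
    by (simp add: power2_eq_square)
  then show ?thesis by (cases "ca_norm A (ca_one A) = 0") auto
qed

lemma norm_star: "x \<in> carrier A \<Longrightarrow> ca_norm A (ca_star A x) = ca_norm A x"
proof -
  have *: "ca_norm A y \<le> ca_norm A (ca_star A y)" if y: "y \<in> carrier A" for y
  proof (cases "ca_norm A y = 0")
    case True
    then show ?thesis using norm_rules(1)[of "ca_star A y"] y by simp
  next
    case False
    then have "ca_norm A y > 0" using norm_rules(1)[of y] y by simp
    moreover have "ca_norm A y * ca_norm A y \<le> ca_norm A (ca_star A y) * ca_norm A y"
      using norm_rules(4)[of "ca_star A y" y] norm_rules(6)[of y] y by (simp add: power2_eq_square)
    ultimately show ?thesis by simp
  qed
  assume "x \<in> carrier A"
  then show ?thesis using *[of x] *[of "ca_star A x"] star_rules(1)[of x] by simp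
qed

lemma sub_closed [simp]: "x \<in> carrier A \<Longrightarrow> y \<in> carrier A \<Longrightarrow> ca_sub A x y \<in> carrier A"
  by (simp add: ca_sub_def)

end

text \<open>Bounded families, indexed by all C*-algebras with elements in \<open>'b\<close>. An algebra given as a
  record becomes a direct summand of one type of class \<open>cstar\<close>, so that the theory developed in the
  class applies to it.\<close>

typedef (overloaded) 'b fam = "{f :: 'b cstar_alg \<Rightarrow> 'b.
    (\<forall>A. unital_cstar_algebra A \<longrightarrow> f A \<in> carrier A) \<and>
    (\<forall>A. \<not> unital_cstar_algebra A \<longrightarrow> f A = undefined) \<and>
    (\<exists>K. \<forall>A. unital_cstar_algebra A \<longrightarrow> ca_norm A (f A) \<le> K)}"
proof
  show "(\<lambda>A. if unital_cstar_algebra A then ca_zero A else undefined) \<in> {f :: 'b cstar_alg \<Rightarrow> 'b.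
    (\<forall>A. unital_cstar_algebra A \<longrightarrow> f A \<in> carrier A) \<and>
    (\<forall>A. \<not> unital_cstar_algebra A \<longrightarrow> f A = undefined) \<and>
    (\<exists>K. \<forall>A. unital_cstar_algebra A \<longrightarrow> ca_norm A (f A) \<le> K)}"
    by (auto simp: unital_cstar.closed unital_cstar.norm_zero unital_cstar_def intro!: exI[of _ 0])
qed

definition fam_of :: "('b cstar_alg \<Rightarrow> 'b) \<Rightarrow> 'b fam" where
  "fam_of f = Abs_fam (\<lambda>A. if unital_cstar_algebra A then f A else undefined)"

lemma Rep_fam_of:
  assumes "\<And>A. unital_cstar_algebra A \<Longrightarrow> f A \<in> carrier A"
    "\<And>A. unital_cstar_algebra A \<Longrightarrow> ca_norm A (f A) \<le> K" "unital_cstar_algebra A"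
  shows "Rep_fam (fam_of f) A = f A"
  unfolding fam_of_def using assms by (subst Abs_fam_inverse) auto

text \<open>Families have the fixed value \<open>undefined\<close> at records that are no unital
  C*-algebras, so equality there is automatic.\<close>

lemma fam_eqI: "(\<And>A. unital_cstar_algebra A \<Longrightarrow> Rep_fam F A = Rep_fam G A) \<Longrightarrow> F = G"
proof -
  assume *: "\<And>A. unital_cstar_algebra A \<Longrightarrow> Rep_fam F A = Rep_fam G A"
  have "Rep_fam F A = Rep_fam G A" for A
    using Rep_fam[of F] Rep_fam[of G] * by (cases "unital_cstar_algebra A") auto
  then show "F = G" by (simp add: Rep_fam_inject[symmetric] fun_eq_iff)
qed

lemma Rep_fam_carrier: "unital_cstar_algebra A \<Longrightarrow> Rep_fam F A \<in> carrier A"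
  using Rep_fam[of F] by auto

section \<open>Pointwise operations and the supremum norm on families\<close>

instantiation fam :: (type) "{zero, one, plus, minus, uminus, times, scaleR}"
begin

definition "zero_fam = fam_of ca_zero"
definition "one_fam = fam_of ca_one"
definition "plus_fam F G = fam_of (\<lambda>A. ca_add A (Rep_fam F A) (Rep_fam G A))"
definition "minus_fam F G = fam_of (\<lambda>A. ca_sub A (Rep_fam F A) (Rep_fam G A))"
definition "uminus_fam F = fam_of (\<lambda>A. ca_smult A (-1) (Rep_fam F A))"
definition "times_fam F G = fam_of (\<lambda>A. ca_mul A (Rep_fam F A) (Rep_fam G A))"
definition "scaleR_fam r F = fam_of (\<lambda>A. ca_smult A (complex_of_real r) (Rep_fam F A))"

instance ..
end

text \<open>The inserted 0 makes the set nonempty without exhibiting an algebra.\<close>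

definition fnorm :: "'b fam \<Rightarrow> real" where
  "fnorm F = Sup (insert 0 {ca_norm A (Rep_fam F A) | A. unital_cstar_algebra A})"

lemma fam_bounded: "\<exists>K. \<forall>A. unital_cstar_algebra A \<longrightarrow> ca_norm A (Rep_fam F A) \<le> K"
  using Rep_fam[of F] by auto

lemma fnorm_ge:
  assumes "unital_cstar_algebra A"
  shows "ca_norm A (Rep_fam F A) \<le> fnorm F"
  unfolding fnorm_def
proof (rule cSup_upper)
  obtain K where "\<And>A. unital_cstar_algebra A \<Longrightarrow> ca_norm A (Rep_fam F A) \<le> K"
    using fam_bounded by blast
  then show "bdd_above (insert 0 {ca_norm A (Rep_fam F A) | A. unital_cstar_algebra A})"
    by (intro bdd_aboveI[of _ "max K 0"]) (auto simp: le_max_iff_disj)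
qed (use assms in auto)

lemma fnorm_le:
  assumes "K \<ge> 0" "\<And>A. unital_cstar_algebra A \<Longrightarrow> ca_norm A (Rep_fam F A) \<le> K"
  shows "fnorm F \<le> K"
  unfolding fnorm_def by (rule cSup_least) (use assms in auto)

lemma fnorm_nonneg: "fnorm (F::'b fam) \<ge> 0"
  unfolding fnorm_def
proof (rule cSup_upper)
  obtain K where "\<And>A. unital_cstar_algebra A \<Longrightarrow> ca_norm A (Rep_fam F A) \<le> K"
    using fam_bounded by blast
  then show "bdd_above (insert 0 {ca_norm A (Rep_fam F A) | A. unital_cstar_algebra A})"
    by (intro bdd_aboveI[of _ "max K 0"]) (auto simp: le_max_iff_disj)
qed auto

context
  fixes A :: "'b cstar_alg"
  assumes A: "unital_cstar_algebra A"
begin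

interpretation unital_cstar A by unfold_locales (rule A)

lemma Rep_zero: "Rep_fam 0 A = ca_zero A"
  unfolding zero_fam_def
  by (rule Rep_fam_of[where K = 0])
    (auto simp: unital_cstar.closed unital_cstar.norm_zero unital_cstar_def A)

lemma Rep_one: "Rep_fam 1 A = ca_one A"
  unfolding one_fam_def
  by (rule Rep_fam_of[where K = 1])
    (auto simp: unital_cstar.closed unital_cstar.norm_one_le unital_cstar_def A)

lemma Rep_add: "Rep_fam (F + G) A = ca_add A (Rep_fam F A) (Rep_fam G A)"
  unfolding plus_fam_def
proof (rule Rep_fam_of[OF _ _ A])
  fix A' :: "'b cstar_alg" assume A': "unital_cstar_algebra A'"
  then interpret A': unital_cstar A' by unfold_locales
  show "ca_add A' (Rep_fam F A') (Rep_fam G A') \<in> carrier A'" by (simp add: Rep_fam_carrier A')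
  show "ca_norm A' (ca_add A' (Rep_fam F A') (Rep_fam G A')) \<le> fnorm F + fnorm G"
    using A'.norm_rules(3)[of "Rep_fam F A'" "Rep_fam G A'"] fnorm_ge[OF A', of F] fnorm_ge[OF A', of G]
    by (simp add: Rep_fam_carrier A')
qed

lemma Rep_smult_aux:
  fixes A' :: "'b cstar_alg" assumes A': "unital_cstar_algebra A'"
  shows "ca_smult A' c (Rep_fam F A') \<in> carrier A'" "ca_norm A' (ca_smult A' c (Rep_fam F A')) \<le> cmod c * fnorm F"
proof -
  interpret A': unital_cstar A' by unfold_locales (rule A')
  show "ca_smult A' c (Rep_fam F A') \<in> carrier A'" by (simp add: Rep_fam_carrier A')
  show "ca_norm A' (ca_smult A' c (Rep_fam F A')) \<le> cmod c * fnorm F"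
    using A'.norm_rules(5)[of "Rep_fam F A'" c] fnorm_ge[OF A', of F]
    by (simp add: Rep_fam_carrier A' mult_left_mono)
qed

lemma Rep_scaleR: "Rep_fam (scaleR r F) A = ca_smult A (complex_of_real r) (Rep_fam F A)"
  unfolding scaleR_fam_def by (rule Rep_fam_of[OF Rep_smult_aux A])

lemma Rep_uminus: "Rep_fam (- F) A = ca_smult A (-1) (Rep_fam F A)"
  unfolding uminus_fam_def by (rule Rep_fam_of[OF Rep_smult_aux A])

lemma Rep_minus: "Rep_fam (F - G) A = ca_sub A (Rep_fam F A) (Rep_fam G A)"
  unfolding minus_fam_def
proof (rule Rep_fam_of[OF _ _ A])
  fix A' :: "'b cstar_alg" assume A': "unital_cstar_algebra A'"
  then interpret A': unital_cstar A' by unfold_locales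
  show "ca_sub A' (Rep_fam F A') (Rep_fam G A') \<in> carrier A'" by (simp add: Rep_fam_carrier A')
  show "ca_norm A' (ca_sub A' (Rep_fam F A') (Rep_fam G A')) \<le> fnorm F + fnorm G"
    using A'.norm_rules(3)[of "Rep_fam F A'" "ca_smult A' (-1) (Rep_fam G A')"]
      A'.norm_rules(5)[of "Rep_fam G A'" "-1"] fnorm_ge[OF A', of F] fnorm_ge[OF A', of G]
    by (simp add: Rep_fam_carrier A' ca_sub_def)
qed

lemma Rep_mult: "Rep_fam (F * G) A = ca_mul A (Rep_fam F A) (Rep_fam G A)"
  unfolding times_fam_def
proof (rule Rep_fam_of[OF _ _ A])
  fix A' :: "'b cstar_alg" assume A': "unital_cstar_algebra A'"
  then interpret A': unital_cstar A' by unfold_locales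
  show "ca_mul A' (Rep_fam F A') (Rep_fam G A') \<in> carrier A'" by (simp add: Rep_fam_carrier A')
  have "ca_norm A' (ca_mul A' (Rep_fam F A') (Rep_fam G A')) \<le> ca_norm A' (Rep_fam F A') * ca_norm A' (Rep_fam G A')"
    using A'.norm_rules(4) by (simp add: Rep_fam_carrier A')
  also have "\<dots> \<le> fnorm F * fnorm G"
    using A'.norm_rules(1) fnorm_nonneg
    by (intro mult_mono fnorm_ge A') (auto simp: Rep_fam_carrier A')
  finally show "ca_norm A' (ca_mul A' (Rep_fam F A') (Rep_fam G A')) \<le> fnorm F * fnorm G" .
qed

end

lemmas Rep_fam_simps = Rep_zero Rep_one Rep_add Rep_scaleR Rep_uminus Rep_minus Rep_mult Rep_fam_carrier

instantiation fam :: (type) real_normed_vector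
begin

definition "norm_fam = (fnorm :: 'a fam \<Rightarrow> real)"
definition "dist_fam F G = norm (F - G :: 'a fam)"
definition "sgn_fam F = scaleR (inverse (norm F)) (F :: 'a fam)"
definition [code del]: "(uniformity :: ('a fam \<times> 'a fam) filter) = (INF e\<in>{0<..}. principal {(x, y). dist x y < e})"
definition [code del]: "open (U :: 'a fam set) \<longleftrightarrow> (\<forall>x\<in>U. \<forall>\<^sub>F (x', y) in uniformity. x' = x \<longrightarrow> y \<in> U)"

instance
proof
  fix F G H :: "'a fam" and r s :: real
  show "F + G + H = F + (G + H)"
    by (rule fam_eqI) (simp add: Rep_fam_simps unital_cstar.vector_space_rules(1) unital_cstar_def)
  show "F + G = G + F"
    by (rule fam_eqI) (simp add: Rep_fam_simps unital_cstar.vector_space_rules(2) unital_cstar_def)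
  show "0 + F = F"
    by (rule fam_eqI) (simp add: Rep_fam_simps unital_cstar.zero_add unital_cstar_def)
  show "- F + F = 0"
    by (rule fam_eqI) (simp add: Rep_fam_simps unital_cstar.add_neg' unital_cstar_def)
  show "F - G = F + - G"
    by (rule fam_eqI) (simp add: Rep_fam_simps ca_sub_def)
  show "scaleR r (F + G) = scaleR r F + scaleR r G"
    by (rule fam_eqI) (simp add: Rep_fam_simps unital_cstar.vector_space_rules(4) unital_cstar_def)
  show "scaleR (r + s) F = scaleR r F + scaleR s F"
    by (rule fam_eqI) (simp add: Rep_fam_simps unital_cstar.vector_space_rules(5) unital_cstar_def)
  have scaleR_scaleR: "scaleR r (scaleR s F) = scaleR (r * s) F" for r s and F :: "'a fam"
    by (rule fam_eqI) (simp add: Rep_fam_simps unital_cstar.vector_space_rules(6) unital_cstar_def)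
  show "scaleR r (scaleR s F) = scaleR (r * s) F"
    by (rule fam_eqI) (simp add: Rep_fam_simps unital_cstar.vector_space_rules(6) unital_cstar_def)
  have scaleR_one: "scaleR 1 F = F" for F :: "'a fam"
    by (rule fam_eqI) (simp add: Rep_fam_simps unital_cstar.vector_space_rules(7) unital_cstar_def)
  show "scaleR 1 F = F"
    by (rule fam_eqI) (simp add: Rep_fam_simps unital_cstar.vector_space_rules(7) unital_cstar_def)
  show "dist F G = norm (F - G)" by (rule dist_fam_def)
  show "sgn F = scaleR (inverse (norm F)) F" by (rule sgn_fam_def)
  show "(uniformity :: ('a fam \<times> 'a fam) filter) = (INF e\<in>{0<..}. principal {(x, y). dist x y < e})"
    by (rule uniformity_fam_def)
  show "open U \<longleftrightarrow> (\<forall>x\<in>U. \<forall>\<^sub>F (x', y) in uniformity. x' = x \<longrightarrow> y \<in> U)" for U :: "'a fam set"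
    by (rule open_fam_def)
  show "norm F = 0 \<longleftrightarrow> F = 0"
    unfolding norm_fam_def
  proof
    assume "fnorm F = 0"
    show "F = 0"
    proof (rule fam_eqI)
      fix A :: "'a cstar_alg" assume A: "unital_cstar_algebra A"
      then interpret unital_cstar A by unfold_locales
      have "ca_norm A (Rep_fam F A) = 0"
        using fnorm_ge[OF A, of F] \<open>fnorm F = 0\<close> norm_rules(1)[of "Rep_fam F A"] by (simp add: Rep_fam_carrier A)
      then show "Rep_fam F A = Rep_fam 0 A"
        using norm_rules(2)[of "Rep_fam F A"] by (simp add: Rep_fam_simps A)
    qed
  next
    assume "F = 0"
    then have "fnorm F \<le> 0"
      by (intro fnorm_le) (auto simp: Rep_fam_simps unital_cstar.norm_zero unital_cstar_def)
    then show "fnorm F = 0" using fnorm_nonneg[of F] by simp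
  qed
  show "norm (F + G) \<le> norm F + norm G"
    unfolding norm_fam_def
  proof (rule fnorm_le)
    fix A :: "'a cstar_alg" assume A: "unital_cstar_algebra A"
    then interpret unital_cstar A by unfold_locales
    show "ca_norm A (Rep_fam (F + G) A) \<le> fnorm F + fnorm G"
      using norm_rules(3)[of "Rep_fam F A" "Rep_fam G A"] fnorm_ge[OF A, of F] fnorm_ge[OF A, of G]
      by (simp add: Rep_fam_simps A)
  qed (simp add: fnorm_nonneg)
  have le: "fnorm (scaleR r F) \<le> \<bar>r\<bar> * fnorm F" for r and F :: "'a fam"
  proof (rule fnorm_le)
    fix A :: "'a cstar_alg" assume A: "unital_cstar_algebra A"
    show "ca_norm A (Rep_fam (scaleR r F) A) \<le> \<bar>r\<bar> * fnorm F"
      using Rep_smult_aux(2)[OF A A, of "complex_of_real r" F] by (simp add: Rep_scaleR A)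
  qed (simp add: fnorm_nonneg)
  show "norm (scaleR r F) = \<bar>r\<bar> * norm F"
    unfolding norm_fam_def
  proof (rule antisym[OF le])
    show "\<bar>r\<bar> * fnorm F \<le> fnorm (scaleR r F)"
    proof (cases "r = 0")
      case False
      have "fnorm F = fnorm (scaleR (inverse r) (scaleR r F))"
        using False scaleR_scaleR scaleR_one by simp
      also have "\<dots> \<le> \<bar>inverse r\<bar> * fnorm (scaleR r F)" by (rule le)
      finally show ?thesis using False by (simp add: field_simps)
    qed (simp add: fnorm_nonneg)
  qed
qed

end

lemma norm_fam_ge: "unital_cstar_algebra A \<Longrightarrow> ca_norm A (Rep_fam F A) \<le> norm F"
  by (simp add: norm_fam_def fnorm_ge)

lemma norm_fam_le:
  "K \<ge> 0 \<Longrightarrow> (\<And>A. unital_cstar_algebra A \<Longrightarrow> ca_norm A (Rep_fam F A) \<le> K) \<Longrightarrow> norm F \<le> K"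
  by (simp add: norm_fam_def fnorm_le)

instance fam :: (type) "{real_normed_algebra, monoid_mult}"
proof
  fix F G H :: "'a fam" and r :: real
  show "F * G * H = F * (G * H)"
    by (rule fam_eqI) (simp add: Rep_fam_simps unital_cstar.mul_rules(1) unital_cstar_def)
  show "(F + G) * H = F * H + G * H"
    by (rule fam_eqI) (simp add: Rep_fam_simps unital_cstar.mul_rules(3) unital_cstar_def)
  show "F * (G + H) = F * G + F * H"
    by (rule fam_eqI) (simp add: Rep_fam_simps unital_cstar.mul_rules(2) unital_cstar_def)
  show "scaleR r F * G = scaleR r (F * G)"
    by (rule fam_eqI) (simp add: Rep_fam_simps unital_cstar.mul_rules(4) unital_cstar_def)
  show "F * scaleR r G = scaleR r (F * G)"
    by (rule fam_eqI) (simp add: Rep_fam_simps unital_cstar.mul_rules(5) unital_cstar_def)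
  show "1 * F = F"
    by (rule fam_eqI) (simp add: Rep_fam_simps unital_cstar.mul_rules(6) unital_cstar_def)
  show "F * 1 = F"
    by (rule fam_eqI) (simp add: Rep_fam_simps unital_cstar.mul_rules(7) unital_cstar_def)
  show "norm (F * G) \<le> norm F * norm G"
  proof (rule norm_fam_le)
    fix A :: "'a cstar_alg" assume A: "unital_cstar_algebra A"
    then interpret unital_cstar A by unfold_locales
    have "ca_norm A (Rep_fam (F * G) A) \<le> ca_norm A (Rep_fam F A) * ca_norm A (Rep_fam G A)"
      by (simp add: Rep_fam_simps A norm_rules(4))
    also have "\<dots> \<le> norm F * norm G"
      using A by (intro mult_mono norm_fam_ge norm_rules(1)) (auto simp: Rep_fam_carrier)
    finally show "ca_norm A (Rep_fam (F * G) A) \<le> norm F * norm G" .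
  qed simp
qed

instance fam :: (type) banach
proof
  fix X :: "nat \<Rightarrow> 'a fam" assume X: "Cauchy X"
  have le: "ca_norm A (ca_sub A (Rep_fam (X k) A) (Rep_fam (X l) A)) \<le> norm (X k - X l)"
    if "unital_cstar_algebra A" for A k l
    using norm_fam_ge[OF that, of "X k - X l"] by (simp add: Rep_fam_simps that)
  have "\<exists>L\<in>carrier A. (\<lambda>k. ca_norm A (ca_sub A (Rep_fam (X k) A) L)) \<longlonglongrightarrow> 0"
    if A: "unital_cstar_algebra A" for A
  proof -
    interpret unital_cstar A by unfold_locales (rule A)
    show ?thesis
    proof (rule complete)
      fix e :: real assume "e > 0"
      then obtain N where "\<forall>k\<ge>N. \<forall>l\<ge>N. norm (X k - X l) < e"
        using X by (auto simp: Cauchy_iff)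
      then show "\<exists>N. \<forall>k\<ge>N. \<forall>l\<ge>N. ca_norm A (ca_sub A (Rep_fam (X k) A) (Rep_fam (X l) A)) < e"
        using le[OF A] by (meson order_le_less_trans)
    qed (simp add: Rep_fam_carrier A)
  qed
  then obtain L where L: "\<And>A. unital_cstar_algebra A \<Longrightarrow> L A \<in> carrier A"
    "\<And>A. unital_cstar_algebra A \<Longrightarrow> (\<lambda>k. ca_norm A (ca_sub A (Rep_fam (X k) A) (L A))) \<longlonglongrightarrow> 0"
    by metis
  \<comment> \<open>The Cauchy bound survives the pointwise limit with the same \<open>N\<close> for
    all algebras. This yields both the boundedness of \<open>L\<close>, by comparison with
    \<open>X N0\<close>, and convergence in the supremum norm.\<close>
  have uniform: "ca_norm A (ca_sub A (Rep_fam (X k) A) (L A)) \<le> e"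
    if A: "unital_cstar_algebra A" and N: "\<forall>l\<ge>N. norm (X k - X l) \<le> e" for A k e N
  proof -
    interpret unital_cstar A by unfold_locales (rule A)
    have "(\<lambda>l. e + ca_norm A (ca_sub A (Rep_fam (X l) A) (L A))) \<longlonglongrightarrow> e + 0"
      by (intro tendsto_intros L A)
    moreover have "ca_norm A (ca_sub A (Rep_fam (X k) A) (L A)) \<le> e + ca_norm A (ca_sub A (Rep_fam (X l) A) (L A))"
      if "l \<ge> N" for l
    proof -
      let ?x = "Rep_fam (X k) A" and ?y = "Rep_fam (X l) A"
      have c: "?x \<in> carrier A" "?y \<in> carrier A" "L A \<in> carrier A" by (auto simp: Rep_fam_carrier A L)
      have "ca_sub A ?x (L A) = ca_add A (ca_sub A ?x ?y) (ca_sub A ?y (L A))"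
      proof -
        have "ca_add A (ca_sub A ?x ?y) (ca_sub A ?y (L A)) =
            ca_add A ?x (ca_add A (ca_add A (ca_smult A (-1) ?y) ?y) (ca_smult A (-1) (L A)))"
          using c by (simp add: ca_sub_def vector_space_rules(1))
        then show ?thesis
          using c by (simp add: add_neg' zero_add) (simp add: ca_sub_def)
      qed
      then have "ca_norm A (ca_sub A ?x (L A)) \<le> ca_norm A (ca_sub A ?x ?y) + ca_norm A (ca_sub A ?y (L A))"
        using c by (simp add: norm_rules(3))
      then show ?thesis
        using le[OF A, of k l] N that by force
    qed
    ultimately have "ca_norm A (ca_sub A (Rep_fam (X k) A) (L A)) \<le> e + 0"
      by (intro LIMSEQ_le_const) auto
    then show ?thesis by simp
  qed
  obtain N0 where N0: "\<forall>l\<ge>N0. norm (X N0 - X l) \<le> 1"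
    using X unfolding Cauchy_iff by (metis le_refl less_imp_le zero_less_one)
  define Y where "Y = fam_of L"
  have Y: "Rep_fam Y A = L A" if A: "unital_cstar_algebra A" for A
    unfolding Y_def
  proof (rule Rep_fam_of[OF L(1) _ A])
    fix A :: "'a cstar_alg" assume A: "unital_cstar_algebra A"
    then interpret unital_cstar A by unfold_locales
    let ?x = "Rep_fam (X N0) A"
    have c: "?x \<in> carrier A" "L A \<in> carrier A" by (auto simp: Rep_fam_carrier A L)
    have "L A = ca_add A (ca_smult A (-1) (ca_sub A ?x (L A))) ?x"
    proof -
      have "ca_smult A (-1) (ca_sub A ?x (L A)) = ca_add A (ca_smult A (-1) ?x) (L A)"
        using c vector_space_rules(6)[of "L A" "-1" "-1"]
        by (simp add: ca_sub_def vector_space_rules(4,7))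
      moreover have "ca_add A (ca_add A (ca_smult A (-1) ?x) (L A)) ?x = ca_add A (ca_add A (ca_smult A (-1) ?x) ?x) (L A)"
        using c vector_space_rules(2)[of "L A" ?x] by (simp add: vector_space_rules(1))
      ultimately show ?thesis using c by (simp add: add_neg' zero_add)
    qed
    then have "ca_norm A (L A) \<le> ca_norm A (ca_smult A (-1) (ca_sub A ?x (L A))) + ca_norm A ?x"
      using c norm_rules(3)[of "ca_smult A (-1) (ca_sub A ?x (L A))" ?x] by simp
    also have "ca_norm A (ca_smult A (-1) (ca_sub A ?x (L A))) = ca_norm A (ca_sub A ?x (L A))"
      using c by (simp add: norm_rules(5))
    also have "\<dots> + ca_norm A ?x \<le> 1 + norm (X N0)"
      by (intro add_mono uniform[OF A N0] norm_fam_ge A)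
    finally show "ca_norm A (L A) \<le> 1 + norm (X N0)" .
  qed
  have "X \<longlonglongrightarrow> Y"
  proof (rule LIMSEQ_I)
    fix e :: real assume "e > 0"
    then obtain N where N: "\<forall>k\<ge>N. \<forall>l\<ge>N. norm (X k - X l) < e / 2"
      using X unfolding Cauchy_iff by (metis half_gt_zero)
    have "norm (X k - Y) < e" if "k \<ge> N" for k
    proof -
      have N': "\<forall>l\<ge>N. norm (X k - X l) \<le> e / 2"
        using N that less_imp_le by blast
      have "norm (X k - Y) \<le> e / 2"
      proof (rule norm_fam_le)
        show "ca_norm A (Rep_fam (X k - Y) A) \<le> e / 2" if "unital_cstar_algebra A" for A
          using uniform[OF that N'] that by (simp add: Rep_minus Y)
      qed (use \<open>e > 0\<close> in simp)
      then show ?thesis using \<open>e > 0\<close> by simp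
    qed
    then show "\<exists>N. \<forall>k\<ge>N. norm (X k - Y) < e" by blast
  qed
  then show "convergent X" by (auto simp: convergent_def)
qed

definition fam_star :: "'b fam \<Rightarrow> 'b fam" where
  "fam_star F = fam_of (\<lambda>A. ca_star A (Rep_fam F A))"

definition fam_cc :: "complex \<Rightarrow> 'b fam" where
  "fam_cc c = fam_of (\<lambda>A. ca_smult A c (ca_one A))"

lemma Rep_fam_star: "unital_cstar_algebra A \<Longrightarrow> Rep_fam (fam_star F) A = ca_star A (Rep_fam F A)"
  unfolding fam_star_def
  by (rule Rep_fam_of[where K = "norm F"])
    (auto simp: unital_cstar.closed unital_cstar.norm_star unital_cstar_def Rep_fam_carrier norm_fam_ge)

lemma Rep_fam_cc: "unital_cstar_algebra A \<Longrightarrow> Rep_fam (fam_cc c) A = ca_smult A c (ca_one A)"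
  unfolding fam_cc_def
  by (rule Rep_fam_of[where K = "cmod c"])
    (auto simp: unital_cstar.closed unital_cstar.norm_rules(5) unital_cstar.norm_one_le unital_cstar_def mult_left_le)

lemmas Rep_fam_simps' = Rep_fam_simps Rep_fam_star Rep_fam_cc

instantiation fam :: (type) cstar
begin

definition "star_fam = (fam_star :: 'a fam \<Rightarrow> 'a fam)"
definition "cc_fam = (fam_cc :: complex \<Rightarrow> 'a fam)"

instance
proof
  fix F G :: "'a fam" and a b :: complex and r :: real
  have cc: "Rep_fam (fam_cc c * F) A = ca_smult A c (Rep_fam F A)" if "unital_cstar_algebra A" for A c and F :: "'a fam"
    using that by (simp add: Rep_fam_simps' unital_cstar.mul_rules unital_cstar.closed unital_cstar_def)
  note defs = star_fam_def cc_fam_def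
  show "star (star F) = F"
    unfolding defs by (rule fam_eqI) (simp add: Rep_fam_simps' unital_cstar.star_rules unital_cstar_def)
  show "star (F + G) = star F + star G"
    unfolding defs by (rule fam_eqI) (simp add: Rep_fam_simps' unital_cstar.star_rules unital_cstar_def)
  show "star (F * G) = star G * star F"
    unfolding defs by (rule fam_eqI) (simp add: Rep_fam_simps' unital_cstar.star_rules unital_cstar_def)
  show "cc (a + b) = (cc a + cc b :: 'a fam)"
    unfolding defs
    by (rule fam_eqI) (simp add: Rep_fam_simps' unital_cstar.vector_space_rules unital_cstar.closed unital_cstar_def)
  show "cc (a * b) = (cc a * cc b :: 'a fam)"
    unfolding defs
    by (rule fam_eqI) (simp add: cc, simp add: Rep_fam_simps' unital_cstar.vector_space_rules unital_cstar.closed unital_cstar_def)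
  show "cc 1 = (1 :: 'a fam)"
    unfolding defs
    by (rule fam_eqI) (simp add: Rep_fam_simps' unital_cstar.vector_space_rules unital_cstar.closed unital_cstar_def)
  show "cc a * F = F * cc a"
    unfolding defs
    by (rule fam_eqI) (simp add: Rep_fam_simps' unital_cstar.mul_rules unital_cstar.closed unital_cstar_def)
  show "star (cc a) = (cc (cnj a) :: 'a fam)"
  proof -
    have "ca_star A (ca_one A) = ca_one A" if "unital_cstar_algebra A" for A :: "'a cstar_alg"
    proof -
      interpret unital_cstar A by unfold_locales (rule that)
      show ?thesis
        using star_rules(3)[of "ca_star A (ca_one A)" "ca_one A"]
        by (simp add: star_rules(1) mul_rules(6,7))
    qed
    then show ?thesis
      unfolding defs
      by (intro fam_eqI) (simp add: Rep_fam_simps' unital_cstar.star_rules unital_cstar.closed unital_cstar_def)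
  qed
  show "scaleR r F = cc (complex_of_real r) * F"
    unfolding defs by (rule fam_eqI) (simp add: cc Rep_scaleR)
  have le: "norm (fam_cc a * F) \<le> cmod a * norm F" for a and F :: "'a fam"
  proof (rule norm_fam_le)
    fix A :: "'a cstar_alg" assume A: "unital_cstar_algebra A"
    then interpret unital_cstar A by unfold_locales
    show "ca_norm A (Rep_fam (fam_cc a * F) A) \<le> cmod a * norm F"
      using A by (auto simp: cc norm_rules(5) Rep_fam_carrier intro!: mult_left_mono norm_fam_ge)
  qed simp
  show "norm (cc a * F) = cmod a * norm F"
    unfolding defs
  proof (rule antisym[OF le])
    show "cmod a * norm F \<le> norm (fam_cc a * F)"
    proof (cases "a = 0")
      case False
      have "fam_cc (inverse a) * (fam_cc a * F) = F"
      proof (rule fam_eqI)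
        fix A :: "'a cstar_alg" assume A: "unital_cstar_algebra A"
        then interpret unital_cstar A by unfold_locales
        show "Rep_fam (fam_cc (inverse a) * (fam_cc a * F)) A = Rep_fam F A"
          using vector_space_rules(6)[of "Rep_fam F A" "inverse a" a] False
          by (simp add: cc A Rep_fam_carrier vector_space_rules(7))
      qed
      then have "norm F \<le> cmod (inverse a) * norm (fam_cc a * F)"
        using le[of "inverse a" "fam_cc a * F"] by simp
      then have "norm F \<le> norm (fam_cc a * F) / cmod a"
        by (simp add: norm_inverse divide_inverse mult.commute)
      then show ?thesis using False by (simp add: pos_le_divide_eq mult.commute)
    qed simp
  qed
  show "norm (star F * F) = (norm F)\<^sup>2"
    unfolding defs
  proof (rule antisym)
    show "norm (fam_star F * F) \<le> (norm F)\<^sup>2"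
    proof (rule norm_fam_le)
      fix A :: "'a cstar_alg" assume A: "unital_cstar_algebra A"
      then interpret unital_cstar A by unfold_locales
      show "ca_norm A (Rep_fam (fam_star F * F) A) \<le> (norm F)\<^sup>2"
        using A by (auto simp: Rep_fam_simps' norm_rules(6) intro!: power_mono norm_fam_ge norm_rules(1))
    qed simp
    have "norm F \<le> sqrt (norm (fam_star F * F))"
    proof (rule norm_fam_le)
      fix A :: "'a cstar_alg" assume A: "unital_cstar_algebra A"
      then interpret unital_cstar A by unfold_locales
      have "(ca_norm A (Rep_fam F A))\<^sup>2 \<le> norm (fam_star F * F)"
        using norm_fam_ge[OF A, of "fam_star F * F"] A by (simp add: Rep_fam_simps' norm_rules(6))
      then show "ca_norm A (Rep_fam F A) \<le> sqrt (norm (fam_star F * F))"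
        by (rule real_le_rsqrt)
    qed simp
    then show "(norm F)\<^sup>2 \<le> norm (fam_star F * F)"
      by (metis norm_ge_zero power_mono real_sqrt_pow2)
  qed
qed

end

section \<open>An algebra as a direct summand\<close>

text \<open>\<open>truncate\<close> forgets possible extra record fields, so that \<open>B\<close>
  becomes an index of the families. \<open>ev B\<close> is unital and a left inverse of
  \<open>emb B\<close>.\<close>

definition ev :: "('b, 'k) cstar_alg_scheme \<Rightarrow> 'b fam \<Rightarrow> 'b" where
  "ev B F = Rep_fam F (cstar_alg.truncate B)"

text \<open>All other components are zero, so this embedding is isometric but not unital: the unit
  of \<open>B\<close> becomes a projection. A constant extension to the other algebras would leave
  their carriers.\<close>

definition emb :: "('b, 'k) cstar_alg_scheme \<Rightarrow> 'b \<Rightarrow> 'b fam" where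
  "emb B b = fam_of (\<lambda>A. if A = cstar_alg.truncate B then b else ca_zero A)"

lemma truncate_sel [simp]:
  "carrier (cstar_alg.truncate B) = carrier B" "ca_zero (cstar_alg.truncate B) = ca_zero B"
  "ca_one (cstar_alg.truncate B) = ca_one B" "ca_add (cstar_alg.truncate B) = ca_add B"
  "ca_smult (cstar_alg.truncate B) = ca_smult B" "ca_mul (cstar_alg.truncate B) = ca_mul B"
  "ca_star (cstar_alg.truncate B) = ca_star B" "ca_norm (cstar_alg.truncate B) = ca_norm B"
  "ca_sub (cstar_alg.truncate B) = ca_sub B"
  by (simp_all add: cstar_alg.truncate_def ca_sub_def fun_eq_iff)

lemma unital_cstar_truncate: "unital_cstar_algebra (cstar_alg.truncate B) \<longleftrightarrow> unital_cstar_algebra B"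
  unfolding unital_cstar_algebra_def by simp

context unital_cstar
begin

lemma unital_truncate: "unital_cstar_algebra (cstar_alg.truncate A)"
  using A by (simp add: unital_cstar_truncate)

lemma ev_simps:
  "ev A F \<in> carrier A" "ev A 0 = ca_zero A" "ev A 1 = ca_one A"
  "ev A (F + G) = ca_add A (ev A F) (ev A G)" "ev A (F - G) = ca_sub A (ev A F) (ev A G)"
  "ev A (F * G) = ca_mul A (ev A F) (ev A G)" "ev A (star F) = ca_star A (ev A F)"
  "ev A (scaleR r F) = ca_smult A (complex_of_real r) (ev A F)"
  using Rep_fam_simps'[OF unital_truncate] by (simp_all add: ev_def star_fam_def)

lemma Rep_emb:
  assumes "b \<in> carrier A" "unital_cstar_algebra A'"
  shows "Rep_fam (emb A b) A' = (if A' = cstar_alg.truncate A then b else ca_zero A')"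
  unfolding emb_def
  by (rule Rep_fam_of[where K = "ca_norm A b"])
    (use assms in \<open>auto simp: unital_cstar.closed unital_cstar.norm_zero unital_cstar_def norm_rules(1)\<close>)

lemma ev_emb [simp]: "b \<in> carrier A \<Longrightarrow> ev A (emb A b) = b"
  by (simp add: ev_def Rep_emb unital_truncate)

lemma emb_eqI:
  assumes "b \<in> carrier A" "ev A F = b"
    "\<And>A'. unital_cstar_algebra A' \<Longrightarrow> A' \<noteq> cstar_alg.truncate A \<Longrightarrow> Rep_fam F A' = ca_zero A'"
  shows "emb A b = F"
  by (rule fam_eqI) (use assms in \<open>auto simp: Rep_emb ev_def\<close>)

lemma emb_add: "x \<in> carrier A \<Longrightarrow> y \<in> carrier A \<Longrightarrow> emb A (ca_add A x y) = emb A x + emb A y"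
  by (rule emb_eqI) (auto simp: ev_simps Rep_fam_simps Rep_emb unital_cstar.zero_add unital_cstar.closed unital_cstar_def)

lemma emb_zero: "emb A (ca_zero A) = 0"
  by (rule emb_eqI) (auto simp: ev_simps Rep_fam_simps)

lemma emb_smult: "x \<in> carrier A \<Longrightarrow> emb A (ca_smult A c x) = cc c * emb A x"
proof (rule emb_eqI)
  assume x: "x \<in> carrier A"
  show "ca_smult A c x \<in> carrier A" using x by simp
  have *: "Rep_fam (cc c * F) A' = ca_smult A' c (Rep_fam F A')" if "unital_cstar_algebra A'"
    for A' :: "'a cstar_alg" and F
    using that
    by (simp add: cc_fam_def Rep_fam_simps' unital_cstar.mul_rules unital_cstar.closed unital_cstar_def)
  then show "ev A (cc c * emb A x) = ca_smult A c x"
    using unital_truncate x by (simp add: ev_def Rep_emb)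
  fix A' assume "unital_cstar_algebra A'" "A' \<noteq> cstar_alg.truncate A"
  then show "Rep_fam (cc c * emb A x) A' = ca_zero A'"
    using x by (simp add: * Rep_emb unital_cstar.smult_zero unital_cstar_def)
qed

lemma emb_star: "x \<in> carrier A \<Longrightarrow> emb A (ca_star A x) = star (emb A x)"
proof (rule emb_eqI)
  assume x: "x \<in> carrier A"
  show "ca_star A x \<in> carrier A" "ev A (star (emb A x)) = ca_star A x" using x by (auto simp: ev_simps)
  fix A' assume A': "unital_cstar_algebra A'" "A' \<noteq> cstar_alg.truncate A"
  then interpret A': unital_cstar A' by unfold_locales
  have "ca_star A' (ca_zero A') = ca_zero A'"
    using A'.star_rules(4)[of "ca_zero A'" 0] by (simp add: A'.smult_0)
  then show "Rep_fam (star (emb A x)) A' = ca_zero A'"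
    using x A' by (simp add: star_fam_def Rep_fam_star Rep_emb)
qed

lemma emb_mul: "x \<in> carrier A \<Longrightarrow> y \<in> carrier A \<Longrightarrow> emb A (ca_mul A x y) = emb A x * emb A y"
proof (rule emb_eqI)
  assume x: "x \<in> carrier A" "y \<in> carrier A"
  show "ca_mul A x y \<in> carrier A" "ev A (emb A x * emb A y) = ca_mul A x y" using x by (auto simp: ev_simps)
  fix A' assume A': "unital_cstar_algebra A'" "A' \<noteq> cstar_alg.truncate A"
  then interpret A': unital_cstar A' by unfold_locales
  have "ca_mul A' (ca_zero A') (ca_zero A') = ca_zero A'"
    using A'.mul_rules(4)[of "ca_zero A'" "ca_zero A'" 0] by (simp add: A'.smult_0)
  then show "Rep_fam (emb A x * emb A y) A' = ca_zero A'"
    using x A' by (simp add: Rep_mult Rep_emb)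
qed

lemma emb_sub: "x \<in> carrier A \<Longrightarrow> y \<in> carrier A \<Longrightarrow> emb A (ca_sub A x y) = emb A x - emb A y"
  using scaleR_cc[of "-1" "emb A y"] by (simp add: ca_sub_def emb_add emb_smult)

lemma norm_emb: "x \<in> carrier A \<Longrightarrow> norm (emb A x) = ca_norm A x"
proof (rule antisym)
  assume x: "x \<in> carrier A"
  show "norm (emb A x) \<le> ca_norm A x"
    using x by (intro norm_fam_le) (auto simp: Rep_emb norm_rules(1) unital_cstar.norm_zero unital_cstar_def)
  show "ca_norm A x \<le> norm (emb A x)"
    using norm_fam_ge[OF unital_truncate, of "emb A x"] x by (simp add: Rep_emb unital_truncate)
qed

lemma emb_ca_sum:
  assumes "\<And>k. k < m \<Longrightarrow> f k \<in> carrier A"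
  shows "emb A (ca_sum A f m) = (\<Sum>k<m. emb A (f k))"
proof -
  have "foldr (\<lambda>k acc. ca_add A (f k) acc) ks (ca_zero A) \<in> carrier A \<and>
      emb A (foldr (\<lambda>k acc. ca_add A (f k) acc) ks (ca_zero A)) = sum_list (map (\<lambda>k. emb A (f k)) ks)"
    if "\<And>k. k \<in> set ks \<Longrightarrow> f k \<in> carrier A" for ks
    using that by (induction ks) (auto simp: emb_zero emb_add)
  from this[of "[0..<m]"] assms show ?thesis
    by (simp add: ca_sum_def interv_sum_list_conv_sum_set_nat atLeast0LessThan)
qed

lemma ev_sum: "ev A (\<Sum>k<m. f k) = ca_sum A (\<lambda>k. ev A (f k)) m"
proof -
  have "ev A (sum_list (map f ks)) = foldr (\<lambda>k acc. ca_add A (ev A (f k)) acc) ks (ca_zero A)" for ks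
    by (induction ks) (auto simp: ev_simps)
  from this[of "[0..<m]"] show ?thesis
    by (simp add: ca_sum_def interv_sum_list_conv_sum_set_nat atLeast0LessThan)
qed

end

section \<open>Positive semidefinite matrices\<close>

definition psd :: "'i set \<Rightarrow> ('i \<Rightarrow> 'i \<Rightarrow> complex) \<Rightarrow> bool" where
  "psd I K \<longleftrightarrow> (\<forall>v. 0 \<le> (\<Sum>p\<in>I. \<Sum>q\<in>I. cnj (v p) * K p q * v q))"

lemma psdD: "psd I K \<Longrightarrow> 0 \<le> (\<Sum>p\<in>I. \<Sum>q\<in>I. cnj (v p) * K p q * v q)"
  by (simp add: psd_def)

lemma cnj_mult_self_nonneg: "0 \<le> cnj z * z"
  by (simp add: less_eq_complex_def)

lemma psd_cong:
  assumes "\<And>p q. p \<in> I \<Longrightarrow> q \<in> I \<Longrightarrow> K p q = K' p q"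
  shows "psd I K \<longleftrightarrow> psd I K'"
  unfolding psd_def using assms by simp

lemma psd_add: "psd I K \<Longrightarrow> psd I K' \<Longrightarrow> psd I (\<lambda>p q. K p q + K' p q)"
  unfolding psd_def by (simp add: algebra_simps sum.distrib add_nonneg_nonneg)

lemma psd_rank_one: "psd I (\<lambda>p q. cnj (c p) * c q)"
proof -
  have "(\<Sum>p\<in>I. \<Sum>q\<in>I. cnj (v p) * (cnj (c p) * c q) * v q) =
      cnj (\<Sum>p\<in>I. c p * v p) * (\<Sum>p\<in>I. c p * v p)" for v
    unfolding cnj_sum sum_product by (intro sum.cong refl) simp
  then show ?thesis unfolding psd_def by (simp only: cnj_mult_self_nonneg simp_thms)
qed

lemma psd_zero: "psd I (\<lambda>p q. 0)"
  by (simp add: psd_def)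

lemma psd_sum:
  assumes "\<And>s. s \<in> A \<Longrightarrow> psd I (K s)"
  shows "psd I (\<lambda>p q. \<Sum>s\<in>A. K s p q)"
  using assms
  by (induction A rule: infinite_finite_induct) (auto intro: psd_add simp: psd_zero)

lemma sum_if_subset:
  fixes f :: "'i \<Rightarrow> complex"
  assumes "J \<subseteq> I" "finite I"
  shows "(\<Sum>p\<in>I. if p \<in> J then f p else 0) = sum f J"
  using assms by (simp add: sum.inter_restrict[symmetric] Int_absorb1)

lemma psd_extend_zero:
  assumes "psd J K" "J \<subseteq> I" "finite I"
  shows "psd I (\<lambda>p q. if p \<in> J \<and> q \<in> J then K p q else 0)"
  unfolding psd_def
proof
  fix v
  have "(\<Sum>p\<in>I. \<Sum>q\<in>I. cnj (v p) * (if p \<in> J \<and> q \<in> J then K p q else 0) * v q) =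
      (\<Sum>p\<in>I. if p \<in> J then (\<Sum>q\<in>I. if q \<in> J then cnj (v p) * K p q * v q else 0) else 0)"
    by (intro sum.cong refl) (auto intro!: sum.cong)
  also have "\<dots> = (\<Sum>p\<in>J. \<Sum>q\<in>J. cnj (v p) * K p q * v q)"
    unfolding sum_if_subset[OF assms(2,3)] ..
  also have "\<dots> \<ge> 0" using assms(1) by (simp add: psd_def)
  finally show "0 \<le> (\<Sum>p\<in>I. \<Sum>q\<in>I. cnj (v p) * (if p \<in> J \<and> q \<in> J then K p q else 0) * v q)" .
qed

lemma psd_subset:
  assumes "psd I K" "J \<subseteq> I" "finite I"
  shows "psd J K"
  unfolding psd_def
proof
  fix v :: "'a \<Rightarrow> complex"
  let ?v = "\<lambda>p. if p \<in> J then v p else 0"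
  have "(\<Sum>p\<in>I. \<Sum>q\<in>I. cnj (?v p) * K p q * ?v q) =
      (\<Sum>p\<in>I. if p \<in> J then (\<Sum>q\<in>I. if q \<in> J then cnj (v p) * K p q * v q else 0) else 0)"
    by (intro sum.cong refl) (auto intro!: sum.cong)
  also have "\<dots> = (\<Sum>p\<in>J. \<Sum>q\<in>J. cnj (v p) * K p q * v q)"
    unfolding sum_if_subset[OF assms(2,3)] ..
  finally have "(\<Sum>p\<in>I. \<Sum>q\<in>I. cnj (?v p) * K p q * ?v q) = (\<Sum>p\<in>J. \<Sum>q\<in>J. cnj (v p) * K p q * v q)" .
  moreover have "0 \<le> (\<Sum>p\<in>I. \<Sum>q\<in>I. cnj (?v p) * K p q * ?v q)"
    by (rule psdD[OF assms(1)])
  ultimately show "0 \<le> (\<Sum>p\<in>J. \<Sum>q\<in>J. cnj (v p) * K p q * v q)" by simp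
qed

lemma psd_diag:
  assumes "psd I K" "finite I" "p \<in> I"
  shows "0 \<le> K p p"
proof -
  have "psd {p} K" using psd_subset[OF assms(1)] assms by simp
  then show ?thesis unfolding psd_def by (auto dest: spec[of _ "\<lambda>_. 1"])
qed

lemma psd_pair:
  assumes "psd I K" "finite I" "p \<in> I" "q \<in> I" "p \<noteq> q"
  shows "0 \<le> cnj a * K p p * a + cnj a * K p q * b + (cnj b * K q p * a + cnj b * K q q * b)"
proof -
  have "psd {p, q} K" using psd_subset[OF assms(1)] assms by simp
  then have "0 \<le> (\<Sum>r\<in>{p, q}. \<Sum>s\<in>{p, q}. cnj ((\<lambda>r. if r = p then a else b) r) * K r s * (\<lambda>r. if r = p then a else b) s)"
    by (rule psdD)
  then show ?thesis using assms(5) by (simp add: eq_commute[of q])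
qed

text \<open>The order of \<open>complex\<close> includes being real. Reality of the form at the
  vectors (1, 1) and (1, i) determines the imaginary and the real part of the off-diagonal
  entry.\<close>

lemma psd_hermitian:
  assumes "psd I K" "finite I" "p \<in> I" "q \<in> I"
  shows "K q p = cnj (K p q)"
proof (cases "p = q")
  case True
  then show ?thesis using psd_diag[OF assms(1-3)] by (simp add: less_eq_complex_def complex_eq_iff)
next
  case False
  have d: "Im (K p p) = 0" "Im (K q q) = 0"
    using psd_diag[OF assms(1,2)] assms(3,4) by (auto simp: less_eq_complex_def)
  show ?thesis
    using psd_pair[OF assms False, of 1 1] psd_pair[OF assms False, of 1 \<i>] d
    by (simp add: less_eq_complex_def complex_eq_iff)
qed

text \<open>With a zero at \<open>p\<close> the form is affine along multiples of the
  \<open>p\<close>-th unit vector. Choosing the multiple against the entry \<open>K p q\<close>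
  would make it negative unless that entry vanishes.\<close>

lemma psd_diag_zero:
  assumes "psd I K" "finite I" "p \<in> I" "q \<in> I" "K p p = 0"
  shows "K p q = 0" "K q p = 0"
proof -
  have "K p q = 0"
  proof (cases "p = q")
    case False
    define s where "s = (cmod (K p q))\<^sup>2"
    have h: "K q p = cnj (K p q)" by (rule psd_hermitian[OF assms(1-4)])
    have K: "Re (K q q) - 2 * t * s \<ge> 0" for t :: real
    proof -
      have "0 \<le> cnj (- (complex_of_real t * K p q)) * K p q + (K q p * (- (complex_of_real t * K p q)) + K q q)"
        using psd_pair[OF assms(1-4) False, of "- (complex_of_real t * K p q)" 1] assms(5) by simp
      then have "0 \<le> Re (cnj (- (complex_of_real t * K p q)) * K p q + (K q p * (- (complex_of_real t * K p q)) + K q q))"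
        by (simp add: less_eq_complex_def)
      also have "\<dots> = Re (K q q) - 2 * t * s"
        unfolding h s_def cmod_power2 by (simp add: algebra_simps power2_eq_square)
      finally show ?thesis .
    qed
    have "s = 0"
    proof (rule ccontr)
      assume "s \<noteq> 0"
      then have "s > 0" by (simp add: s_def)
      then show False using K[of "(Re (K q q) + 1) / (2 * s)"] by simp
    qed
    then show ?thesis by (simp add: s_def)
  qed (use assms in simp)
  then show "K p q = 0" "K q p = 0"
    using psd_hermitian[OF assms(1-4)] by auto
qed

text \<open>The vector \<open>v\<close> is extended to \<open>p\<close> by the value
  \<open>w\<close> that minimizes the form; the minimum is the form of the Schur complement.\<close>

lemma psd_schur:
  assumes "psd I K" "finite I" "p \<in> I" "K p p \<noteq> 0"
  shows "psd (I - {p}) (\<lambda>i j. K i j - K i p * K p j / K p p)"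
  unfolding psd_def
proof
  fix v :: "'a \<Rightarrow> complex"
  define J where "J = I - {p}"
  define s where "s = (\<Sum>j\<in>J. K p j * v j)"
  define w where "w = - s / K p p"
  have fin: "finite J" "p \<notin> J" "I = insert p J" using assms by (auto simp: J_def)
  have herm: "K i p = cnj (K p i)" if "i \<in> J" for i
    using psd_hermitian[OF assms(1,2), of p i] that assms(3) by (simp add: J_def)
  have cs: "(\<Sum>i\<in>J. cnj (v i) * K i p) = cnj s"
    unfolding s_def by (simp add: herm mult.commute)
  have real: "cnj (K p p) = K p p"
    using psd_hermitian[OF assms(1,2,3,3)] by simp
  let ?v = "\<lambda>i. if i = p then w else v i"
  have J: "(\<Sum>q\<in>J. f q (?v q)) = (\<Sum>q\<in>J. f q (v q))" for f :: "'a \<Rightarrow> complex \<Rightarrow> complex"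
    using fin by (intro sum.cong) auto
  have "0 \<le> (\<Sum>i\<in>I. \<Sum>j\<in>I. cnj (?v i) * K i j * ?v j)"
    by (rule psdD[OF assms(1)])
  also have "\<dots> = cnj w * K p p * w + (\<Sum>j\<in>J. cnj w * K p j * v j) +
      (\<Sum>i\<in>J. cnj (v i) * K i p * w + (\<Sum>j\<in>J. cnj (v i) * K i j * v j))"
    unfolding fin(3) using fin(1,2)
    by (simp add: J[of "\<lambda>q z. cnj w * K p q * z"] J[of "\<lambda>q z. cnj z * K q p * w + (\<Sum>j\<in>J. cnj z * K q j * v j)"]
        J[of "\<lambda>q z. c * K r q * z" for c r])
  also have "\<dots> = cnj w * K p p * w + cnj w * s + cnj s * w + (\<Sum>i\<in>J. \<Sum>j\<in>J. cnj (v i) * K i j * v j)"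
    unfolding sum.distrib cs[symmetric] by (simp add: s_def sum_distrib_left sum_distrib_right mult.assoc)
  also have "cnj w * K p p * w + cnj w * s + cnj s * w = - (cnj s * s / K p p)"
    using assms(4) real by (simp add: w_def)
  also have "cnj s * s / K p p = (\<Sum>i\<in>J. \<Sum>j\<in>J. cnj (v i) * (K i p * K p j / K p p) * v j)"
  proof -
    have "cnj s * s / K p p = (\<Sum>i\<in>J. cnj (v i) * K i p) * (\<Sum>j\<in>J. K p j * v j) / K p p"
      unfolding cs by (simp only: s_def)
    also have "\<dots> = (\<Sum>i\<in>J. \<Sum>j\<in>J. cnj (v i) * K i p * (K p j * v j) / K p p)"
      by (simp only: sum_product sum_divide_distrib)
    also have "\<dots> = (\<Sum>i\<in>J. \<Sum>j\<in>J. cnj (v i) * (K i p * K p j / K p p) * v j)"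
      by (simp add: mult.assoc)
    finally show ?thesis .
  qed
  finally show "0 \<le> (\<Sum>i\<in>I - {p}. \<Sum>j\<in>I - {p}. cnj (v i) * (K i j - K i p * K p j / K p p) * v j)"
    unfolding J_def[symmetric] by (simp add: algebra_simps sum_subtractf)
qed

text \<open>As in the Cholesky decomposition, one rank-one term is split off per index.\<close>

lemma psd_factorization:
  assumes "finite I" "psd I K"
  shows "\<exists>L. \<forall>p\<in>I. \<forall>q\<in>I. K p q = (\<Sum>s\<in>I. cnj (L s p) * L s q)"
  using assms
proof (induction I arbitrary: K rule: finite_induct)
  case (insert p J)
  have pI: "p \<in> insert p J" and fin: "finite (insert p J)" using insert by auto
  show ?case
  proof (cases "K p p = 0")
    case True
    have "psd J K" using psd_subset[OF insert.prems _ fin] by blast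
    then obtain L where L: "\<forall>i\<in>J. \<forall>j\<in>J. K i j = (\<Sum>s\<in>J. cnj (L s i) * L s j)"
      using insert.IH by blast
    have z: "K p q = 0" "K q p = 0" if "q \<in> insert p J" for q
      using psd_diag_zero[OF insert.prems fin pI that True] by auto
    define L' where "L' s q = (if s = p \<or> q = p then 0 else L s q)" for s q
    have "K i j = (\<Sum>s\<in>insert p J. cnj (L' s i) * L' s j)" if "i \<in> insert p J" "j \<in> insert p J" for i j
    proof (cases "i = p \<or> j = p")
      case True
      then show ?thesis using z that by (auto simp: L'_def)
    next
      case False
      then have "K i j = (\<Sum>s\<in>J. cnj (L s i) * L s j)" using L that by blast
      also have "\<dots> = (\<Sum>s\<in>insert p J. cnj (L' s i) * L' s j)"
        using insert.hyps False by (auto simp: L'_def intro!: sum.cong)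
      finally show ?thesis .
    qed
    then show ?thesis by blast
  next
    case False
    have "insert p J - {p} = J" using insert.hyps by auto
    then have "psd J (\<lambda>i j. K i j - K i p * K p j / K p p)"
      using psd_schur[OF insert.prems fin pI False] by simp
    from insert.IH[OF this] obtain L where
      L: "\<forall>i\<in>J. \<forall>j\<in>J. K i j - K i p * K p j / K p p = (\<Sum>s\<in>J. cnj (L s i) * L s j)"
      by blast
    define d where "d = Re (K p p)"
    have d: "K p p = complex_of_real d" "d > 0"
      using psd_diag[OF insert.prems fin pI] False
      by (auto simp: d_def less_eq_complex_def complex_eq_iff)
    have sd: "complex_of_real (sqrt d) * complex_of_real (sqrt d) = complex_of_real d"
      using d(2) by (simp flip: of_real_mult)
    define L' where "L' s q = (if s = p then K p q / complex_of_real (sqrt d) else if q = p then 0 else L s q)" for s q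
    have "K i j = (\<Sum>s\<in>insert p J. cnj (L' s i) * L' s j)" if ij: "i \<in> insert p J" "j \<in> insert p J" for i j
    proof -
      have h: "cnj (K p i) = K i p"
        using psd_hermitian[OF insert.prems fin pI ij(1)] by simp
      have "(\<Sum>s\<in>insert p J. cnj (L' s i) * L' s j) =
          K i p * K p j / K p p + (\<Sum>s\<in>J. if i = p \<or> j = p then 0 else cnj (L s i) * L s j)"
        using insert.hyps h sd d by (auto simp: L'_def intro!: sum.cong)
      also have "\<dots> = K i j"
      proof (cases "i = p \<or> j = p")
        case True
        then show ?thesis using False by auto
      next
        case False
        then have "K i j - K i p * K p j / K p p = (\<Sum>s\<in>J. cnj (L s i) * L s j)" using L ij by blast
        with False show ?thesis by (simp add: algebra_simps)
      qed
      finally show ?thesis by simp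
    qed
    then show ?thesis by blast
  qed
qed simp

text \<open>The overlap is removed index by index with Schur complements.\<close>

lemma psd_amalgamation:
  assumes "finite S" "finite T" "psd S A" "psd T B"
    "\<And>p q. p \<in> S \<inter> T \<Longrightarrow> q \<in> S \<inter> T \<Longrightarrow> A p q = B p q"
  shows "\<exists>K. psd (S \<union> T) K \<and> (\<forall>p\<in>S. \<forall>q\<in>S. K p q = A p q) \<and> (\<forall>p\<in>T. \<forall>q\<in>T. K p q = B p q)"
  using assms
proof (induction "card (S \<inter> T)" arbitrary: S T A B)
  case 0
  then have disj: "S \<inter> T = {}" by simp
  let ?K = "\<lambda>p q. (if p \<in> S \<and> q \<in> S then A p q else 0) + (if p \<in> T \<and> q \<in> T then B p q else 0)"
  have "psd (S \<union> T) ?K"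
    using 0 by (intro psd_add psd_extend_zero) auto
  then show ?case using disj by (intro exI[of _ ?K]) auto
next
  case (Suc k)
  then obtain p where p: "p \<in> S" "p \<in> T"
    by (metis Int_iff card.empty ex_in_conv nat.distinct(1))
  define S' where "S' = S - {p}"
  define T' where "T' = T - {p}"
  have k: "k = card (S' \<inter> T')"
  proof -
    have "S' \<inter> T' = (S \<inter> T) - {p}" by (auto simp: S'_def T'_def)
    then show ?thesis using Suc.hyps(2) Suc.prems(1) p by simp
  qed
  have fin: "finite S'" "finite T'" "S' \<union> T' \<subseteq> S \<union> T" "finite (S \<union> T)"
    using Suc.prems by (auto simp: S'_def T'_def)
  have AB: "A p p = B p p" using Suc.prems(5) p by blast
  show ?case
  proof (cases "A p p = 0")
    case True
    have zA: "A p q = 0" "A q p = 0" if "q \<in> S" for q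
      using psd_diag_zero[OF Suc.prems(3,1) p(1) that True] by auto
    have zB: "B p q = 0" "B q p = 0" if "q \<in> T" for q
      using psd_diag_zero[OF Suc.prems(4,2) p(2) that] True AB by auto
    have "psd S' A" "psd T' B"
      using psd_subset[OF Suc.prems(3) _ Suc.prems(1)] psd_subset[OF Suc.prems(4) _ Suc.prems(2)]
      by (auto simp: S'_def T'_def)
    moreover have "\<And>q r. q \<in> S' \<inter> T' \<Longrightarrow> r \<in> S' \<inter> T' \<Longrightarrow> A q r = B q r"
      using Suc.prems(5) by (auto simp: S'_def T'_def)
    ultimately obtain K where K: "psd (S' \<union> T') K" "\<forall>q\<in>S'. \<forall>r\<in>S'. K q r = A q r" "\<forall>q\<in>T'. \<forall>r\<in>T'. K q r = B q r"
      using Suc.hyps(1)[OF k fin(1,2)] by blast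
    let ?K = "\<lambda>q r. if q \<in> S' \<union> T' \<and> r \<in> S' \<union> T' then K q r else 0"
    have "psd (S \<union> T) ?K" by (rule psd_extend_zero[OF K(1) fin(3,4)])
    moreover have "?K q r = A q r" if "q \<in> S" "r \<in> S" for q r
      using K(2) zA that by (cases "q = p \<or> r = p") (auto simp: S'_def T'_def)
    moreover have "?K q r = B q r" if "q \<in> T" "r \<in> T" for q r
      using K(3) zB that by (cases "q = p \<or> r = p") (auto simp: S'_def T'_def)
    ultimately show ?thesis by blast
  next
    case False
    then have False': "B p p \<noteq> 0" using AB by simp
    \<comment> \<open>Both complements agree on the rest of the overlap since \<open>p\<close> and
      its row there are shared. The induction hypothesis amalgamates them.\<close>
    let ?A = "\<lambda>i j. A i j - A i p * A p j / A p p" and ?B = "\<lambda>i j. B i j - B i p * B p j / B p p"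
    have "psd S' ?A" "psd T' ?B"
      unfolding S'_def T'_def
      by (rule psd_schur[OF Suc.prems(3,1) p(1) False], rule psd_schur[OF Suc.prems(4,2) p(2) False'])
    moreover have "\<And>q r. q \<in> S' \<inter> T' \<Longrightarrow> r \<in> S' \<inter> T' \<Longrightarrow> ?A q r = ?B q r"
      using Suc.prems(5) p by (auto simp: S'_def T'_def)
    ultimately obtain K where K: "psd (S' \<union> T') K" "\<forall>q\<in>S'. \<forall>r\<in>S'. K q r = ?A q r" "\<forall>q\<in>T'. \<forall>r\<in>T'. K q r = ?B q r"
      using Suc.hyps(1)[OF k fin(1,2)] by blast
    define d where "d = Re (A p p)"
    have d: "A p p = complex_of_real d" "d > 0"
      using psd_diag[OF Suc.prems(3,1) p(1)] False
      by (auto simp: d_def less_eq_complex_def complex_eq_iff)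
    have sd: "complex_of_real (sqrt d) * complex_of_real (sqrt d) = complex_of_real d"
      using d(2) by (simp flip: of_real_mult)
    \<comment> \<open>The common extension of the two rows at \<open>p\<close>, normalized so that
      the rank-one term built from it restores on either side what the Schur complement took
      away.\<close>
    define c where "c j = (if j \<in> S then A p j else B p j) / complex_of_real (sqrt d)" for j
    have cA: "cnj (c q) * c r = A q p * A p r / A p p" if "q \<in> S" "r \<in> S" for q r
      using psd_hermitian[OF Suc.prems(3,1) p(1) that(1)] sd d that by (simp add: c_def)
    have cT: "c j = B p j / complex_of_real (sqrt d)" if "j \<in> T" for j
      using Suc.prems(5) p that by (auto simp: c_def)
    have cB: "cnj (c q) * c r = B q p * B p r / B p p" if "q \<in> T" "r \<in> T" for q r
      using psd_hermitian[OF Suc.prems(4,2) p(2) that(1)] sd d that AB by (simp add: cT)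
    let ?K = "\<lambda>q r. (if q \<in> S' \<union> T' \<and> r \<in> S' \<union> T' then K q r else 0) + cnj (c q) * c r"
    have "psd (S \<union> T) ?K"
      by (rule psd_add[OF psd_extend_zero[OF K(1) fin(3,4)] psd_rank_one])
    moreover have "?K q r = A q r" if "q \<in> S" "r \<in> S" for q r
      using K(2) that cA[OF that] False
      by (cases "q = p \<or> r = p") (auto simp: S'_def T'_def)
    moreover have "?K q r = B q r" if "q \<in> T" "r \<in> T" for q r
      using K(3) that cB[OF that] False'
      by (cases "q = p \<or> r = p") (auto simp: S'_def T'_def)
    ultimately show ?thesis by blast
  qed
qed

section \<open>Chordal graphs\<close>

lemma adj_sym: "tol_rel n R \<Longrightarrow> adj R i j \<Longrightarrow> adj R j i"
  by (auto simp: tol_rel_def adj_def sym_def)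

text \<open>\<open>W\<close> is a component of the graph with \<open>v\<close> and its neighbours deleted, and \<open>S\<close> the set of
  neighbours of \<open>W\<close>. Two non-adjacent vertices of \<open>S\<close> would be joined by a shortest path through
  \<open>W\<close>, which closes up through \<open>v\<close> to a chordless cycle.\<close>

lemma chordal_no_induced_path:
  assumes tol: "tol_rel n R" and ch: "chordal n R"
    and v: "v \<in> {1..n}" "\<And>b. b \<in> W \<Longrightarrow> \<not> adj R v b" "v \<notin> W" and W: "W \<subseteq> {1..n}"
    and xy: "adj R v x" "adj R v y" "x \<noteq> y" "\<not> adj R x y" "x \<in> {1..n}" "y \<in> {1..n}"
    and f: "f 0 = x" "f L = y" "\<And>i. i < L \<Longrightarrow> adj R (f i) (f (Suc i))" "\<And>i. 0 < i \<Longrightarrow> i < L \<Longrightarrow> f i \<in> W"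
  shows False
proof -
  define walk where "walk f l \<longleftrightarrow> f 0 = x \<and> f l = y \<and> (\<forall>i<l. adj R (f i) (f (Suc i))) \<and>
    (\<forall>i. 0 < i \<and> i < l \<longrightarrow> f i \<in> W)" for f l
  have "\<exists>l. \<exists>f. walk f l" using f by (auto simp: walk_def)
  then obtain l where l: "\<exists>f. walk f l" "\<And>k. k < l \<Longrightarrow> \<not> (\<exists>f. walk f k)"
    using exists_least_iff[of "\<lambda>l. \<exists>f. walk f l"] by blast
  then obtain h where h: "walk h l" by blast
  then have h0: "h 0 = x" "h l = y" and hs: "\<And>i. i < l \<Longrightarrow> adj R (h i) (h (Suc i))"
    and hW: "\<And>i. 0 < i \<Longrightarrow> i < l \<Longrightarrow> h i \<in> W"
    by (auto simp: walk_def)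
  have l2: "l \<ge> 2"
  proof (rule ccontr)
    assume "\<not> l \<ge> 2"
    then consider "l = 0" | "l = 1" by linarith
    then show False using h0 hs[of 0] xy by cases auto
  qed
  have short: False if ij: "i < j" "j \<le> l" and s: "adj R (h i) (h j)" "j > Suc i" for i j
  proof -
    \<comment> \<open>A chord from \<open>h i\<close> to \<open>h j\<close> lets the walk skip the
      vertices in between, which contradicts minimality.\<close>
    define g where "g k = (if k \<le> i then h k else h (k + (j - Suc i)))" for k
    have "walk g (l - (j - Suc i))"
      unfolding walk_def
    proof (intro conjI allI impI)
      show "g 0 = x" by (simp add: g_def h0)
      show "g (l - (j - Suc i)) = y" using ij s by (auto simp: g_def h0)
      fix k
      show "adj R (g k) (g (Suc k))" if "k < l - (j - Suc i)"
      proof -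
        consider "k < i" | "k = i" | "k > i" by linarith
        then show ?thesis
        proof cases
          case 1 then show ?thesis using hs[of k] ij by (simp add: g_def)
        next
          case 2 then show ?thesis using s ij by (simp add: g_def)
        next
          case 3 then show ?thesis using hs[of "k + (j - Suc i)"] that by (simp add: g_def)
        qed
      qed
      show "g k \<in> W" if "0 < k \<and> k < l - (j - Suc i)"
        using that ij s hW[of k] hW[of "k + (j - Suc i)"] by (auto simp: g_def)
    qed
    then show False using l(2)[of "l - (j - Suc i)"] ij s by auto
  qed
  have inj: "h i \<noteq> h j" if ij: "i < j" "j \<le> l" for i j
  proof
    assume e: "h i = h j"
    \<comment> \<open>A repeated vertex lets the loop between its two occurrences be cut
      out.\<close>
    define g where "g k = (if k \<le> i then h k else h (k + (j - i)))" for k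
    have "walk g (l - (j - i))"
      unfolding walk_def
    proof (intro conjI allI impI)
      show "g 0 = x" by (simp add: g_def h0)
      show "g (l - (j - i)) = y"
        using ij e h0 by (cases "j = l") (auto simp: g_def)
      fix k
      show "adj R (g k) (g (Suc k))" if "k < l - (j - i)"
      proof -
        consider "k < i" | "k = i" | "k > i" by linarith
        then show ?thesis
        proof cases
          case 1 then show ?thesis using hs[of k] ij by (simp add: g_def)
        next
          case 2 then show ?thesis using hs[of j] e ij that by (simp add: g_def)
        next
          case 3 then show ?thesis using hs[of "k + (j - i)"] that by (simp add: g_def)
        qed
      qed
      show "g k \<in> W" if "0 < k \<and> k < l - (j - i)"
        using that ij hW[of k] hW[of "k + (j - i)"] by (auto simp: g_def)
    qed
    then show False using l(2)[of "l - (j - i)"] ij by auto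
  qed
  have hn: "h i \<in> {1..n}" "h i \<noteq> v" if "i \<le> l" for i
  proof -
    have "i = 0 \<or> i = l \<or> (0 < i \<and> i < l)" using that by auto
    then show "h i \<in> {1..n}" "h i \<noteq> v"
      using h0 hW[of i] W v xy by (auto simp: adj_def)
  qed
  \<comment> \<open>The cycle closes through \<open>v\<close>, which shifts the positions of the
    path by one; \<open>l \<ge> 2\<close> gives it length at least 4.\<close>
  define vs where "vs = v # map h [0..<Suc l]"
  have len: "length vs = l + 2" by (simp add: vs_def)
  have nth0: "vs ! 0 = v" by (simp add: vs_def)
  have nthS: "vs ! Suc i = h i" if "i \<le> l" for i
    using that by (simp add: vs_def nth_append del: upt_Suc)
  have "distinct vs"
  proof -
    have "inj_on h {..l}"
      unfolding inj_on_def using inj by (metis atMost_iff linorder_neqE_nat)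
    moreover have "set [0..<Suc l] = {..l}" by auto
    ultimately have "distinct (map h [0..<Suc l])" by (simp add: distinct_map del: upt_Suc)
    moreover have "v \<notin> h ` {0..<Suc l}"
    proof
      assume "v \<in> h ` {0..<Suc l}"
      then obtain i where "v = h i" "i \<le> l" by auto
      then show False using hn(2)[of i] by blast
    qed
    ultimately show ?thesis by (simp add: vs_def del: upt_Suc)
  qed
  moreover have "set vs \<subseteq> {1..n}"
    using hn(1) v(1) by (auto simp: vs_def simp del: upt_Suc)
  moreover have "adj R (vs ! i) (vs ! ((i + 1) mod length vs))" if i: "i < length vs" for i
  proof -
    consider "i = 0" | j where "i = Suc j" "j < l" | "i = Suc l"
      using i len by (cases i) force+
    then show ?thesis
    proof cases
      case 1
      then show ?thesis using xy(1) nthS[of 0] h0 l2 len by (simp add: nth0)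
    next
      case (2 j)
      then have "(i + 1) mod length vs = Suc (Suc j)" using len by simp
      then show ?thesis using 2 hs[of j] nthS[of j] nthS[of "Suc j"] by simp
    next
      case 3
      then have "(i + 1) mod length vs = 0" using len by simp
      then show ?thesis using 3 nthS[of l] h0 xy(2) adj_sym[OF tol] by (simp add: nth0)
    qed
  qed
  moreover have "4 \<le> length vs" using len l2 by simp
  ultimately obtain i j where ij: "i < length vs" "j < length vs" "i \<noteq> j" "j \<noteq> (i + 1) mod length vs"
    "i \<noteq> (j + 1) mod length vs" "adj R (vs ! i) (vs ! j)"
    using ch unfolding chordal_def by meson
  \<comment> \<open>A chord at \<open>v\<close> would end in an inner vertex of the path, which lies
    in \<open>W\<close> and is not adjacent to \<open>v\<close>; any other chord is a shortcut of
    the path.\<close>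
  have nochord: False if ij: "i < j" "j < length vs" "j \<noteq> (i + 1) mod length vs"
    "i \<noteq> (j + 1) mod length vs" "adj R (vs ! i) (vs ! j)" for i j
  proof (cases i)
    case 0
    have "j \<noteq> Suc l" using ij(4) 0 len by auto
    moreover have "j \<noteq> 1" using ij(3) 0 len by auto
    ultimately obtain k where k: "j = Suc k" "0 < k" "k < l"
      using ij(1,2) 0 len by (cases j) auto
    then show False using ij(5) 0 nthS[of k] hW[of k] v(2) by (simp add: nth0)
  next
    case (Suc i')
    then obtain j' where j': "j = Suc j'" using ij(1) by (cases j) auto
    have "j \<noteq> Suc i" using ij len by auto
    then show False
      using short[of i' j'] ij Suc j' len nthS[of i'] nthS[of j'] by auto
  qed
  show False
  proof (cases "i < j")
    case True
    then show False using nochord[of i j] ij by blast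
  next
    case False
    then show False using nochord[of j i] ij adj_sym[OF tol] by (metis linorder_neqE_nat)
  qed
qed

text \<open>\<open>S\<close> lies among the neighbours of \<open>v\<close>, since a vertex of
  \<open>S\<close> not adjacent to \<open>v\<close> would belong to the component \<open>W\<close>
  itself. The two parts are \<open>W\<close> with \<open>S\<close>, which misses \<open>v\<close>,
  and the complement of \<open>W\<close>, which misses \<open>w\<close>.\<close>

lemma chordal_clique_separator:
  assumes tol: "tol_rel n R" and ch: "chordal n R" and U: "U \<subseteq> {1..n}" "\<not> is_clique n R U"
  obtains U1 U2 where "U1 \<union> U2 = U" "U1 \<noteq> U" "U2 \<noteq> U" "is_clique n R (U1 \<inter> U2)"
    "\<And>i j. i \<in> U1 - U2 \<Longrightarrow> j \<in> U2 - U1 \<Longrightarrow> (i, j) \<notin> R"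
proof -
  obtain v w where vw: "v \<in> U" "w \<in> U" "v \<noteq> w" "\<not> adj R v w"
    using U by (auto simp: is_clique_def)
  define W0 where "W0 = {x \<in> U. x \<noteq> v \<and> \<not> adj R v x}"
  define Q where "Q = {(a, b). a \<in> W0 \<and> b \<in> W0 \<and> adj R a b}"
  define W where "W = {x. (w, x) \<in> Q\<^sup>*}"
  define S where "S = {s \<in> U - W. \<exists>b\<in>W. adj R s b}"
  have symQ: "sym Q" using adj_sym[OF tol] by (auto simp: Q_def sym_def)
  have wW: "w \<in> W" by (simp add: W_def)
  have w0: "w \<in> W0" using vw by (simp add: W0_def)
  have WW0: "W \<subseteq> W0"
  proof
    fix x assume "x \<in> W"
    then have "(w, x) \<in> Q\<^sup>*" by (simp add: W_def)
    then show "x \<in> W0" by (induction rule: rtrancl_induct) (use w0 in \<open>auto simp: Q_def\<close>)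
  qed
  have WU: "W \<subseteq> U" using WW0 by (auto simp: W0_def)
  have vW: "v \<notin> W" "\<And>b. b \<in> W \<Longrightarrow> \<not> adj R v b" using WW0 by (auto simp: W0_def)
  have Sv: "adj R v s" if s: "s \<in> S" for s
  proof (rule ccontr)
    assume n: "\<not> adj R v s"
    obtain b where b: "b \<in> W" "adj R s b" "s \<in> U" "s \<notin> W" using s by (auto simp: S_def)
    have "s \<noteq> v" using b vW by auto
    then have "s \<in> W0" using n b by (simp add: W0_def)
    then have "(b, s) \<in> Q" using b WW0 adj_sym[OF tol] by (auto simp: Q_def)
    then have "s \<in> W" using b(1) by (auto simp: W_def intro: rtrancl_into_rtrancl)
    then show False using b by simp
  qed
  have "adj R x y" if x: "x \<in> S" "y \<in> S" "x \<noteq> y" for x y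
  proof (rule ccontr)
    assume n: "\<not> adj R x y"
    obtain b b' where b: "b \<in> W" "adj R x b" "b' \<in> W" "adj R y b'" using x by (auto simp: S_def)
    have "(b, w) \<in> Q\<^sup>*" using b(1) symQ by (auto simp: W_def intro: symD[OF sym_rtrancl])
    moreover have "(w, b') \<in> Q\<^sup>*" using b(3) by (simp add: W_def)
    ultimately have "(b, b') \<in> Q\<^sup>*" by (rule rtrancl_trans)
    then obtain k where "(b, b') \<in> Q ^^ k" using rtrancl_imp_relpow by blast
    then obtain f where f: "f 0 = b" "f k = b'" "\<And>i. i < k \<Longrightarrow> (f i, f (Suc i)) \<in> Q"
      by (auto simp: relpow_fun_conv)
    have fW: "f i \<in> W" if "i \<le> k" for i
      using that
    proof (induction i)
      case (Suc i)
      then have "(w, f i) \<in> Q\<^sup>*" "(f i, f (Suc i)) \<in> Q" using f(3) by (auto simp: W_def)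
      then show ?case by (auto simp: W_def intro: rtrancl_into_rtrancl)
    qed (use f b in simp)
    \<comment> \<open>The walk \<open>f\<close> inside \<open>W\<close>, with \<open>x\<close> put
      in front and \<open>y\<close> at the end.\<close>
    define h where "h i = (if i = 0 then x else if i \<le> Suc k then f (i - 1) else y)" for i
    show False
    proof (rule chordal_no_induced_path[OF tol ch])
      show "v \<in> {1..n}" "W \<subseteq> {1..n}" "x \<in> {1..n}" "y \<in> {1..n}"
        using vw U WU x by (auto simp: S_def)
      show "\<not> adj R v b" if "b \<in> W" for b using vW that by blast
      show "v \<notin> W" by (rule vW)
      show "adj R v x" "adj R v y" using Sv x by auto
      show "x \<noteq> y" "\<not> adj R x y" using x n by auto
      show "h 0 = x" "h (Suc (Suc k)) = y" by (auto simp: h_def)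
      show "adj R (h i) (h (Suc i))" if i: "i < Suc (Suc k)" for i
      proof -
        consider "i = 0" | j where "i = Suc j" "j < k" | "i = Suc k"
          using i by (cases i) force+
        then show ?thesis
        proof cases
          case 1 then show ?thesis using b f by (simp add: h_def)
        next
          case (2 j) then show ?thesis using f(3)[of j] by (simp add: h_def Q_def)
        next
          case 3 then show ?thesis using b f adj_sym[OF tol] by (simp add: h_def)
        qed
      qed
      show "h i \<in> W" if "0 < i" "i < Suc (Suc k)" for i
        using that fW[of "i - 1"] by (simp add: h_def)
    qed
  qed
  then have clique: "is_clique n R S"
    using U by (auto simp: is_clique_def S_def)
  have "v \<notin> S" using Sv by (auto simp: adj_def)
  show ?thesis
  proof (rule that[of "W \<union> S" "U - W"])
    show "W \<union> S \<union> (U - W) = U" using WU by (auto simp: S_def)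
    show "W \<union> S \<noteq> U" using vW \<open>v \<notin> S\<close> vw by blast
    show "U - W \<noteq> U" using wW WU by blast
    have "(W \<union> S) \<inter> (U - W) = S" by (auto simp: S_def)
    then show "is_clique n R ((W \<union> S) \<inter> (U - W))" using clique by simp
    fix i j assume ij: "i \<in> W \<union> S - (U - W)" "j \<in> U - W - (W \<union> S)"
    then have "i \<in> W" "j \<in> U" "j \<notin> W" "j \<notin> S" by (auto simp: S_def)
    moreover have "i \<noteq> j" using calculation by blast
    ultimately have "\<not> adj R j i" by (auto simp: S_def)
    then have "\<not> adj R i j" using adj_sym[OF tol] by blast
    then show "(i, j) \<notin> R" using \<open>i \<noteq> j\<close> by (simp add: adj_def)
  qed
qed

text \<open>The set \<open>I\<close> carries the block index of a matrix of matrices. The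
  completions of the two parts agree on the overlap because over a clique every entry is prescribed,
  and no pair of \<open>R\<close> is lost because each lies within one part.\<close>

lemma chordal_completion:
  fixes K :: "'a \<times> nat \<Rightarrow> 'a \<times> nat \<Rightarrow> complex"
  assumes tol: "tol_rel n R" and ch: "chordal n R" and I: "finite I" and U: "U \<subseteq> {1..n}"
    and K: "\<And>D. is_clique n R D \<Longrightarrow> D \<subseteq> U \<Longrightarrow> psd (I \<times> D) K"
  shows "\<exists>K'. psd (I \<times> U) K' \<and>
    (\<forall>a\<in>I. \<forall>b\<in>I. \<forall>i\<in>U. \<forall>j\<in>U. (i, j) \<in> R \<longrightarrow> K' (a, i) (b, j) = K (a, i) (b, j))"
  using U K
proof (induction "card U" arbitrary: U rule: less_induct)
  case less
  show ?case
  proof (cases "is_clique n R U")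
    case True
    then show ?thesis using less.prems(2)[of U] by blast
  next
    case False
    obtain U1 U2 where U: "U1 \<union> U2 = U" "U1 \<noteq> U" "U2 \<noteq> U" "is_clique n R (U1 \<inter> U2)"
      "\<And>i j. i \<in> U1 - U2 \<Longrightarrow> j \<in> U2 - U1 \<Longrightarrow> (i, j) \<notin> R"
      using chordal_clique_separator[OF tol ch less.prems(1) False] by metis
    have finU: "finite U" using less.prems(1) finite_subset by blast
    have c: "card U1 < card U" "card U2 < card U"
      using U finU by (metis Un_upper1 Un_upper2 psubsetI psubset_card_mono)+
    have IH: "\<exists>K'. psd (I \<times> V) K' \<and>
        (\<forall>a\<in>I. \<forall>b\<in>I. \<forall>i\<in>V. \<forall>j\<in>V. (i, j) \<in> R \<longrightarrow> K' (a, i) (b, j) = K (a, i) (b, j))"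
      if "V \<subseteq> U" "card V < card U" for V
    proof (rule less.hyps[OF that(2)])
      show "V \<subseteq> {1..n}" using that less.prems(1) by blast
      show "psd (I \<times> D) K" if "is_clique n R D" "D \<subseteq> V" for D
        using less.prems(2) that \<open>V \<subseteq> U\<close> by blast
    qed
    obtain K1 where K1: "psd (I \<times> U1) K1"
      "\<forall>a\<in>I. \<forall>b\<in>I. \<forall>i\<in>U1. \<forall>j\<in>U1. (i, j) \<in> R \<longrightarrow> K1 (a, i) (b, j) = K (a, i) (b, j)"
      using IH[OF _ c(1)] U(1) by blast
    obtain K2 where K2: "psd (I \<times> U2) K2"
      "\<forall>a\<in>I. \<forall>b\<in>I. \<forall>i\<in>U2. \<forall>j\<in>U2. (i, j) \<in> R \<longrightarrow> K2 (a, i) (b, j) = K (a, i) (b, j)"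
      using IH[OF _ c(2)] U(1) by blast
    have R12: "(i, j) \<in> R" if "i \<in> U1 \<inter> U2" "j \<in> U1 \<inter> U2" for i j
      using U(4) that tol unfolding is_clique_def tol_rel_def adj_def by (metis subsetD)
    have "\<exists>K'. psd (I \<times> U1 \<union> I \<times> U2) K' \<and> (\<forall>p\<in>I \<times> U1. \<forall>q\<in>I \<times> U1. K' p q = K1 p q) \<and>
        (\<forall>p\<in>I \<times> U2. \<forall>q\<in>I \<times> U2. K' p q = K2 p q)"
    proof (rule psd_amalgamation[OF _ _ K1(1) K2(1)])
      show "finite (I \<times> U1)" "finite (I \<times> U2)" using I finU U(1) by auto
      show "K1 p q = K2 p q" if "p \<in> I \<times> U1 \<inter> I \<times> U2" "q \<in> I \<times> U1 \<inter> I \<times> U2" for p q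
        using that K1(2) K2(2) R12 by auto
    qed
    then obtain K' where K': "psd (I \<times> U1 \<union> I \<times> U2) K'" "\<forall>p\<in>I \<times> U1. \<forall>q\<in>I \<times> U1. K' p q = K1 p q"
      "\<forall>p\<in>I \<times> U2. \<forall>q\<in>I \<times> U2. K' p q = K2 p q"
      by blast
    have "I \<times> U1 \<union> I \<times> U2 = I \<times> U" using U(1) by blast
    then have "psd (I \<times> U) K'" using K'(1) by simp
    moreover have "K' (a, i) (b, j) = K (a, i) (b, j)"
      if "a \<in> I" "b \<in> I" "i \<in> U" "j \<in> U" "(i, j) \<in> R" for a b i j
    proof -
      have "(j, i) \<in> R" using that(5) tol by (auto simp: tol_rel_def sym_def)
      then have "(i \<in> U1 \<and> j \<in> U1) \<or> (i \<in> U2 \<and> j \<in> U2)"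
        using that U(1) U(5)[of i j] U(5)[of j i] by blast
      then show ?thesis using that K' K1(2) K2(2) by auto
    qed
    ultimately show ?thesis by blast
  qed
qed

section \<open>The operator norm of a block\<close>

definition vn :: "nat set \<Rightarrow> (nat \<Rightarrow> complex) \<Rightarrow> real" where
  "vn C v = L2_set (\<lambda>i. cmod (v i)) C"

definition mv :: "nat set \<Rightarrow> (nat \<Rightarrow> nat \<Rightarrow> complex) \<Rightarrow> (nat \<Rightarrow> complex) \<Rightarrow> nat \<Rightarrow> complex" where
  "mv C K v i = (\<Sum>j\<in>C. K i j * v j)"

lemma vn_le_one_iff: "vn C v \<le> 1 \<longleftrightarrow> (\<Sum>j\<in>C. (cmod (v j))\<^sup>2) \<le> 1"
  by (simp add: vn_def L2_set_def)

lemma blk_opnorm_eq: "blk_opnorm C K = Sup {vn C (mv C K v) | v. vn C v \<le> 1}"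
  unfolding blk_opnorm_def vn_le_one_iff by (simp add: vn_def L2_set_def mv_def)

lemma vn_nonneg [simp]: "vn C v \<ge> 0"
  by (simp add: vn_def)

lemma vn_scale: "vn C (\<lambda>i. c * v i) = cmod c * vn C v"
proof -
  have "(\<Sum>i\<in>C. (cmod c * cmod (v i))\<^sup>2) = (cmod c)\<^sup>2 * (\<Sum>i\<in>C. (cmod (v i))\<^sup>2)"
    by (simp add: power_mult_distrib sum_distrib_left)
  then show ?thesis
    by (simp add: vn_def L2_set_def norm_mult real_sqrt_mult)
qed

lemma mv_scale: "mv C K (\<lambda>i. c * v i) = (\<lambda>i. c * mv C K v i)"
  by (auto simp: mv_def sum_distrib_left mult_ac)

context
  fixes C :: "nat set"
  assumes fin: "finite C"
begin

lemma vn_member: "i \<in> C \<Longrightarrow> cmod (v i) \<le> vn C v"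
  unfolding vn_def using member_le_L2_set[OF fin, of i "\<lambda>i. cmod (v i)"] by simp

lemma vn_eq_0: "vn C v = 0 \<Longrightarrow> i \<in> C \<Longrightarrow> v i = 0"
  using vn_member[of i v] by simp

lemma vn_mv_le_sum:
  assumes "vn C v \<le> 1"
  shows "vn C (mv C K v) \<le> (\<Sum>i\<in>C. \<Sum>j\<in>C. cmod (K i j))"
proof -
  have "vn C (mv C K v) \<le> (\<Sum>i\<in>C. cmod (mv C K v i))"
    unfolding vn_def by (rule L2_set_le_sum) simp
  also have "\<dots> \<le> (\<Sum>i\<in>C. \<Sum>j\<in>C. cmod (K i j))"
  proof (rule sum_mono)
    fix i assume "i \<in> C"
    have "cmod (mv C K v i) \<le> (\<Sum>j\<in>C. cmod (K i j * v j))"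
      unfolding mv_def by (rule norm_sum)
    also have "\<dots> \<le> (\<Sum>j\<in>C. cmod (K i j))"
    proof (rule sum_mono)
      fix j assume "j \<in> C"
      then have "cmod (v j) \<le> 1" using vn_member[of j v] assms by linarith
      then show "cmod (K i j * v j) \<le> cmod (K i j)" by (simp add: norm_mult mult_left_le)
    qed
    finally show "cmod (mv C K v i) \<le> (\<Sum>j\<in>C. cmod (K i j))" .
  qed
  finally show ?thesis .
qed

lemma opnorm_upper: "vn C v \<le> 1 \<Longrightarrow> vn C (mv C K v) \<le> blk_opnorm C K"
  unfolding blk_opnorm_eq
  by (rule cSup_upper) (use vn_mv_le_sum in \<open>auto intro!: bdd_aboveI\<close>)

lemma opnorm_le_sum: "blk_opnorm C K \<le> (\<Sum>i\<in>C. \<Sum>j\<in>C. cmod (K i j))"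
  unfolding blk_opnorm_eq
proof (rule cSup_least)
  have "vn C (\<lambda>_. 0) \<le> 1" by (simp add: vn_def L2_set_def)
  then show "{vn C (mv C K v) | v. vn C v \<le> 1} \<noteq> {}" by blast
qed (use vn_mv_le_sum in auto)

lemma opnorm_nonneg: "blk_opnorm C K \<ge> 0"
  using opnorm_upper[of "\<lambda>_. 0" K] vn_nonneg[of C "mv C K (\<lambda>_. 0)"]
  by (simp add: vn_def L2_set_def mv_def)

lemma opnorm_bound: "vn C (mv C K v) \<le> blk_opnorm C K * vn C v"
proof (cases "vn C v = 0")
  case True
  then have "mv C K v i = 0" for i
    by (simp add: mv_def vn_eq_0)
  then show ?thesis using True by (simp add: vn_def L2_set_def)
next
  case False
  then have pos: "vn C v > 0" using vn_nonneg[of C v] by linarith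
  let ?c = "complex_of_real (1 / vn C v)"
  have "vn C (\<lambda>i. ?c * v i) \<le> 1"
    unfolding vn_scale using pos by (simp add: norm_divide)
  from opnorm_upper[OF this, of K] show ?thesis
    unfolding mv_scale vn_scale using pos by (simp add: norm_divide field_simps)
qed

lemma opnorm_least:
  assumes "B \<ge> 0" "\<And>v. vn C (mv C K v) \<le> B * vn C v"
  shows "blk_opnorm C K \<le> B"
  unfolding blk_opnorm_eq
proof (rule cSup_least)
  have "vn C (\<lambda>_. 0) \<le> 1" by (simp add: vn_def L2_set_def)
  then show "{vn C (mv C K v) | v. vn C v \<le> 1} \<noteq> {}" by blast
  fix x assume "x \<in> {vn C (mv C K v) | v. vn C v \<le> 1}"
  then obtain v where "x = vn C (mv C K v)" "vn C v \<le> 1" by blast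
  then show "x \<le> B" using assms(1) assms(2)[of v] by (metis mult_left_le order_trans)
qed

lemma entry_le_opnorm:
  assumes "i \<in> C" "j \<in> C"
  shows "cmod (K i j) \<le> blk_opnorm C K"
proof -
  let ?e = "\<lambda>l. if l = j then 1 else 0 :: complex"
  have "vn C ?e \<le> 1"
    unfolding vn_le_one_iff using fin assms by (simp add: if_distrib[of cmod] if_distrib[of "\<lambda>x. x\<^sup>2"] cong: if_cong)
  from opnorm_upper[OF this, of K] have "vn C (mv C K ?e) \<le> blk_opnorm C K" .
  moreover have "mv C K ?e i = K i j"
    using fin assms by (simp add: mv_def if_distrib cong: if_cong)
  ultimately show ?thesis using vn_member[OF assms(1), of "mv C K ?e"] by simp
qed

lemma opnorm_add: "blk_opnorm C (\<lambda>i j. K i j + K' i j) \<le> blk_opnorm C K + blk_opnorm C K'"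
proof (rule opnorm_least)
  fix v
  have "mv C (\<lambda>i j. K i j + K' i j) v = (\<lambda>i. mv C K v i + mv C K' v i)"
    by (auto simp: mv_def algebra_simps sum.distrib)
  then have "vn C (mv C (\<lambda>i j. K i j + K' i j) v) \<le> L2_set (\<lambda>i. cmod (mv C K v i) + cmod (mv C K' v i)) C"
    unfolding vn_def by (intro L2_set_mono) (auto simp: norm_triangle_ineq)
  also have "\<dots> \<le> vn C (mv C K v) + vn C (mv C K' v)"
    unfolding vn_def by (rule L2_set_triangle_ineq)
  also have "\<dots> \<le> (blk_opnorm C K + blk_opnorm C K') * vn C v"
    using opnorm_bound[of K v] opnorm_bound[of K' v] by (simp add: distrib_right)
  finally show "vn C (mv C (\<lambda>i j. K i j + K' i j) v) \<le> (blk_opnorm C K + blk_opnorm C K') * vn C v" .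
qed (simp add: opnorm_nonneg)

lemma mv_mult: "mv C (\<lambda>i j. \<Sum>k\<in>C. K i k * K' k j) v = mv C K (mv C K' v)"
proof
  fix i
  have "mv C (\<lambda>i j. \<Sum>k\<in>C. K i k * K' k j) v i = (\<Sum>j\<in>C. \<Sum>k\<in>C. K i k * K' k j * v j)"
    by (simp add: mv_def sum_distrib_right)
  also have "\<dots> = (\<Sum>k\<in>C. \<Sum>j\<in>C. K i k * K' k j * v j)"
    by (rule sum.swap)
  finally show "mv C (\<lambda>i j. \<Sum>k\<in>C. K i k * K' k j) v i = mv C K (mv C K' v) i"
    by (simp add: mv_def sum_distrib_left mult.assoc)
qed

lemma opnorm_mult: "blk_opnorm C (\<lambda>i j. \<Sum>k\<in>C. K i k * K' k j) \<le> blk_opnorm C K * blk_opnorm C K'"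
proof (rule opnorm_least)
  fix v
  have "vn C (mv C K (mv C K' v)) \<le> blk_opnorm C K * vn C (mv C K' v)" by (rule opnorm_bound)
  also have "\<dots> \<le> blk_opnorm C K * (blk_opnorm C K' * vn C v)"
    by (intro mult_left_mono opnorm_bound opnorm_nonneg)
  finally show "vn C (mv C (\<lambda>i j. \<Sum>k\<in>C. K i k * K' k j) v) \<le> blk_opnorm C K * blk_opnorm C K' * vn C v"
    by (simp add: mv_mult mult.assoc)
qed (simp add: opnorm_nonneg)

lemma opnorm_scale: "blk_opnorm C (\<lambda>i j. c * K i j) = cmod c * blk_opnorm C K"
proof -
  have le: "blk_opnorm C (\<lambda>i j. c * K i j) \<le> cmod c * blk_opnorm C K" for c K
  proof (rule opnorm_least)
    fix v
    have "mv C (\<lambda>i j. c * K i j) v = (\<lambda>i. c * mv C K v i)"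
      by (auto simp: mv_def sum_distrib_left mult_ac)
    then show "vn C (mv C (\<lambda>i j. c * K i j) v) \<le> cmod c * blk_opnorm C K * vn C v"
      using mult_left_mono[OF opnorm_bound[of K v], of "cmod c"] by (simp add: vn_scale mult.assoc)
  qed (simp add: opnorm_nonneg)
  show ?thesis
  proof (rule antisym[OF le])
    show "cmod c * blk_opnorm C K \<le> blk_opnorm C (\<lambda>i j. c * K i j)"
    proof (cases "c = 0")
      case True
      then show ?thesis by (simp add: opnorm_nonneg)
    next
      case False
      then have "blk_opnorm C K \<le> cmod (inverse c) * blk_opnorm C (\<lambda>i j. c * K i j)"
        using le[of "inverse c" "\<lambda>i j. c * K i j"] by (simp add: mult.assoc[symmetric])
      then have "blk_opnorm C K \<le> blk_opnorm C (\<lambda>i j. c * K i j) / cmod c"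
        by (simp add: norm_inverse divide_inverse mult.commute)
      then show ?thesis using False by (simp add: pos_le_divide_eq mult.commute)
    qed
  qed
qed

text \<open>Cauchy-Schwarz for the inner product of \<open>v\<close> with the image of
  \<open>v\<close> under the adjoint of \<open>K\<close> times \<open>K\<close>.\<close>

lemma vn_mv_square:
  "(vn C (mv C K v))\<^sup>2 \<le> vn C (mv C (\<lambda>i j. \<Sum>k\<in>C. cnj (K k i) * K k j) v) * vn C v"
proof -
  let ?w = "mv C (\<lambda>i j. \<Sum>k\<in>C. cnj (K k i) * K k j) v"
  have "complex_of_real ((vn C (mv C K v))\<^sup>2) = (\<Sum>k\<in>C. cnj (mv C K v k) * mv C K v k)"
    by (simp add: vn_def L2_set_def sum_nonneg complex_norm_square[symmetric] mult.commute)
  also have "\<dots> = (\<Sum>k\<in>C. \<Sum>i\<in>C. cnj (v i) * (cnj (K k i) * mv C K v k))"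
    by (simp add: mv_def[of C K v] sum_distrib_right sum_distrib_left mult_ac)
  also have "\<dots> = (\<Sum>i\<in>C. \<Sum>k\<in>C. cnj (v i) * (cnj (K k i) * mv C K v k))"
    by (rule sum.swap)
  also have "\<dots> = (\<Sum>i\<in>C. cnj (v i) * ?w i)"
  proof (rule sum.cong)
    fix i
    have "?w i = mv C (\<lambda>i k. cnj (K k i)) (mv C K v) i"
      using mv_mult[of "\<lambda>i k. cnj (K k i)" K v] by simp
    then show "(\<Sum>k\<in>C. cnj (v i) * (cnj (K k i) * mv C K v k)) = cnj (v i) * ?w i"
      by (simp add: mv_def[of C "\<lambda>i k. cnj (K k i)"] sum_distrib_left)
  qed simp
  finally have "(vn C (mv C K v))\<^sup>2 = cmod (\<Sum>i\<in>C. cnj (v i) * ?w i)"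
    by (metis norm_of_real abs_power2)
  also have "\<dots> \<le> (\<Sum>i\<in>C. \<bar>cmod (?w i)\<bar> * \<bar>cmod (v i)\<bar>)"
    by (rule order_trans[OF norm_sum]) (simp add: norm_mult mult.commute)
  also have "\<dots> \<le> vn C ?w * vn C v"
    unfolding vn_def by (rule L2_set_mult_ineq)
  finally show ?thesis .
qed

lemma opnorm_square_le: "(blk_opnorm C K)\<^sup>2 \<le> blk_opnorm C (\<lambda>i j. \<Sum>k\<in>C. cnj (K k i) * K k j)"
proof -
  let ?s = "blk_opnorm C (\<lambda>i j. \<Sum>k\<in>C. cnj (K k i) * K k j)"
  have "blk_opnorm C K \<le> sqrt ?s"
  proof (rule opnorm_least)
    fix v
    have "(vn C (mv C K v))\<^sup>2 \<le> ?s * vn C v * vn C v"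
      using vn_mv_square[of K v] mult_right_mono[OF opnorm_bound[of "\<lambda>i j. \<Sum>k\<in>C. cnj (K k i) * K k j" v] vn_nonneg[of C v]]
      by linarith
    also have "\<dots> = (sqrt ?s * vn C v)\<^sup>2"
      by (simp add: power_mult_distrib opnorm_nonneg power2_eq_square)
    finally show "vn C (mv C K v) \<le> sqrt ?s * vn C v"
      by (rule power2_le_imp_le) (simp add: opnorm_nonneg)
  qed (simp add: opnorm_nonneg)
  then have "(blk_opnorm C K)\<^sup>2 \<le> (sqrt ?s)\<^sup>2"
    by (rule power_mono) (rule opnorm_nonneg)
  then show ?thesis by (simp add: opnorm_nonneg)
qed

text \<open>The other inequality together with submultiplicativity first shows that taking adjoints
  preserves the norm.\<close>

lemma opnorm_cstar: "blk_opnorm C (\<lambda>i j. \<Sum>k\<in>C. cnj (K k i) * K k j) = (blk_opnorm C K)\<^sup>2"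
proof (rule antisym[OF _ opnorm_square_le])
  have le: "blk_opnorm C K \<le> blk_opnorm C (\<lambda>i j. cnj (K j i))" for K
  proof (cases "blk_opnorm C K = 0")
    case True
    then show ?thesis using opnorm_nonneg[of "\<lambda>i j. cnj (K j i)"] by simp
  next
    case False
    then have "blk_opnorm C K > 0" using opnorm_nonneg[of K] by linarith
    moreover have "blk_opnorm C K * blk_opnorm C K \<le> blk_opnorm C (\<lambda>i j. cnj (K j i)) * blk_opnorm C K"
      using opnorm_square_le[of K] opnorm_mult[of "\<lambda>i j. cnj (K j i)" K] by (simp add: power2_eq_square)
    ultimately show ?thesis by simp
  qed
  have "blk_opnorm C (\<lambda>i j. cnj (K j i)) \<le> blk_opnorm C K"
    using le[of "\<lambda>i j. cnj (K j i)"] by simp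
  then have "blk_opnorm C (\<lambda>i j. cnj (K j i)) * blk_opnorm C K \<le> blk_opnorm C K * blk_opnorm C K"
    by (rule mult_right_mono) (rule opnorm_nonneg)
  then show "blk_opnorm C (\<lambda>i j. \<Sum>k\<in>C. cnj (K k i) * K k j) \<le> (blk_opnorm C K)\<^sup>2"
    using opnorm_mult[of "\<lambda>i j. cnj (K j i)" K] by (simp add: power2_eq_square)
qed

end

section \<open>The direct sum of matrix blocks\<close>

lemma max_cliques_subset: "C \<in> max_cliques n R \<Longrightarrow> C \<subseteq> {1..n}"
  by (simp add: max_cliques_def is_clique_def)

lemma finite_max_clique: "C \<in> max_cliques n R \<Longrightarrow> finite C"
  by (rule finite_subset[OF max_cliques_subset]) simp_all

lemma finite_max_cliques: "finite (max_cliques n R)"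
proof (rule finite_subset)
  show "max_cliques n R \<subseteq> Pow {1..n}" using max_cliques_subset by blast
qed simp

lemma max_cliques_maximal: "C \<in> max_cliques n R \<Longrightarrow> C' \<in> max_cliques n R \<Longrightarrow> C \<subseteq> C' \<Longrightarrow> C' = C"
  by (auto simp: max_cliques_def)

lemma max_clique_rel:
  "tol_rel n R \<Longrightarrow> C \<in> max_cliques n R \<Longrightarrow> i \<in> C \<Longrightarrow> j \<in> C \<Longrightarrow> (i, j) \<in> R"
  unfolding max_cliques_def is_clique_def tol_rel_def adj_def by (cases "i = j") auto

lemma clique_extends:
  assumes "is_clique n R D"
  obtains C where "C \<in> max_cliques n R" "D \<subseteq> C"
proof -
  let ?P = "{D'. is_clique n R D' \<and> D \<subseteq> D'}"
  have "finite ?P" by (rule finite_subset[of _ "Pow {1..n}"]) (auto simp: is_clique_def)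
  moreover have "?P \<noteq> {}" using assms by blast
  ultimately obtain C where C: "C \<in> ?P" "\<forall>C'\<in>?P. C \<subseteq> C' \<longrightarrow> C = C'"
    using finite_has_maximal[of ?P] by blast
  then have "C \<in> max_cliques n R" unfolding max_cliques_def by blast
  then show ?thesis using that C by blast
qed

lemma rel_in_max_clique:
  assumes "tol_rel n R" "(i, j) \<in> R"
  obtains C where "C \<in> max_cliques n R" "i \<in> C" "j \<in> C"
proof -
  have "is_clique n R {i, j}"
    using assms by (auto simp: is_clique_def adj_def tol_rel_def sym_def)
  then show ?thesis using clique_extends[of n R "{i, j}"] that by (metis insert_subset)
qed

lemma block_alg_sel [simp]:
  "carrier (block_alg n R) = {F. \<forall>C i j. \<not> (C \<in> max_cliques n R \<and> i \<in> C \<and> j \<in> C) \<longrightarrow> F C i j = 0}"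
  "ca_zero (block_alg n R) = (\<lambda>C i j. 0)"
  "ca_one (block_alg n R) = (\<lambda>C i j. if C \<in> max_cliques n R \<and> i \<in> C \<and> i = j then 1 else 0)"
  "ca_add (block_alg n R) = (\<lambda>F G C i j. F C i j + G C i j)"
  "ca_smult (block_alg n R) = (\<lambda>c F C i j. c * F C i j)"
  "ca_mul (block_alg n R) = (\<lambda>F G C i j. \<Sum>k\<in>C. F C i k * G C k j)"
  "ca_star (block_alg n R) = (\<lambda>F C i j. cnj (F C j i))"
  "ca_norm (block_alg n R) = (\<lambda>F. Sup (insert 0 ((\<lambda>C. blk_opnorm C (F C)) ` max_cliques n R)))"
  by (simp_all add: block_alg_def)

lemma block_sub [simp]: "ca_sub (block_alg n R) F G = (\<lambda>C i j. F C i j - G C i j)"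
  by (simp add: ca_sub_def)

definition bnorm :: "nat \<Rightarrow> (nat \<times> nat) set \<Rightarrow> (nat set \<Rightarrow> nat \<Rightarrow> nat \<Rightarrow> complex) \<Rightarrow> real" where
  "bnorm n R F = Sup (insert 0 ((\<lambda>C. blk_opnorm C (F C)) ` max_cliques n R))"

lemma bnorm_upper: "C \<in> max_cliques n R \<Longrightarrow> blk_opnorm C (F C) \<le> bnorm n R F"
  unfolding bnorm_def by (rule cSup_upper) (auto simp: finite_max_cliques)

lemma bnorm_nonneg: "bnorm n R F \<ge> 0"
  unfolding bnorm_def by (rule cSup_upper) (auto simp: finite_max_cliques)

lemma bnorm_least: "B \<ge> 0 \<Longrightarrow> (\<And>C. C \<in> max_cliques n R \<Longrightarrow> blk_opnorm C (F C) \<le> B) \<Longrightarrow> bnorm n R F \<le> B"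
  unfolding bnorm_def by (rule cSup_least) auto

lemma entry_le_bnorm: "C \<in> max_cliques n R \<Longrightarrow> i \<in> C \<Longrightarrow> j \<in> C \<Longrightarrow> cmod (F C i j) \<le> bnorm n R F"
  by (rule order_trans[OF entry_le_opnorm[OF finite_max_clique] bnorm_upper])

lemma bnorm_le_sum: "bnorm n R F \<le> (\<Sum>C\<in>max_cliques n R. \<Sum>i\<in>C. \<Sum>j\<in>C. cmod (F C i j))"
proof (rule bnorm_least)
  fix C assume C: "C \<in> max_cliques n R"
  have "blk_opnorm C (F C) \<le> (\<Sum>i\<in>C. \<Sum>j\<in>C. cmod (F C i j))"
    by (rule opnorm_le_sum[OF finite_max_clique[OF C]])
  also have "\<dots> \<le> (\<Sum>C\<in>max_cliques n R. \<Sum>i\<in>C. \<Sum>j\<in>C. cmod (F C i j))"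
    by (rule member_le_sum[of C "max_cliques n R" "\<lambda>C. \<Sum>i\<in>C. \<Sum>j\<in>C. cmod (F C i j)"])
      (use C finite_max_cliques in \<open>auto intro!: sum_nonneg\<close>)
  finally show "blk_opnorm C (F C) \<le> (\<Sum>C\<in>max_cliques n R. \<Sum>i\<in>C. \<Sum>j\<in>C. cmod (F C i j))" .
qed (auto intro!: sum_nonneg)

lemma bnorm_scale: "bnorm n R (\<lambda>C i j. c * F C i j) = cmod c * bnorm n R F"
proof -
  have le: "bnorm n R (\<lambda>C i j. c * F C i j) \<le> cmod c * bnorm n R F" for c F
    by (rule bnorm_least)
      (auto simp: opnorm_scale finite_max_clique bnorm_nonneg intro!: mult_left_mono bnorm_upper)
  show ?thesis
  proof (rule antisym[OF le])
    show "cmod c * bnorm n R F \<le> bnorm n R (\<lambda>C i j. c * F C i j)"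
    proof (cases "c = 0")
      case True
      then show ?thesis by (simp add: bnorm_nonneg)
    next
      case False
      then have "bnorm n R F \<le> cmod (inverse c) * bnorm n R (\<lambda>C i j. c * F C i j)"
        using le[of "inverse c" "\<lambda>C i j. c * F C i j"] by (simp add: mult.assoc[symmetric])
      then have "bnorm n R F \<le> bnorm n R (\<lambda>C i j. c * F C i j) / cmod c"
        by (simp add: norm_inverse divide_inverse mult.commute)
      then show ?thesis using False by (simp add: pos_le_divide_eq mult.commute)
    qed
  qed
qed

lemma bnorm_cstar: "bnorm n R (\<lambda>C i j. \<Sum>k\<in>C. cnj (F C k i) * F C k j) = (bnorm n R F)\<^sup>2"
proof (rule antisym)
  show "bnorm n R (\<lambda>C i j. \<Sum>k\<in>C. cnj (F C k i) * F C k j) \<le> (bnorm n R F)\<^sup>2"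
  proof (rule bnorm_least)
    fix C assume C: "C \<in> max_cliques n R"
    show "blk_opnorm C (\<lambda>i j. \<Sum>k\<in>C. cnj (F C k i) * F C k j) \<le> (bnorm n R F)\<^sup>2"
      unfolding opnorm_cstar[OF finite_max_clique[OF C]]
      by (rule power_mono[OF bnorm_upper[OF C] opnorm_nonneg[OF finite_max_clique[OF C]]])
  qed simp
  have "bnorm n R F \<le> sqrt (bnorm n R (\<lambda>C i j. \<Sum>k\<in>C. cnj (F C k i) * F C k j))"
  proof (rule bnorm_least)
    fix C assume C: "C \<in> max_cliques n R"
    have "(blk_opnorm C (F C))\<^sup>2 \<le> bnorm n R (\<lambda>C i j. \<Sum>k\<in>C. cnj (F C k i) * F C k j)"
      using bnorm_upper[OF C, of "\<lambda>C i j. \<Sum>k\<in>C. cnj (F C k i) * F C k j"]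
        opnorm_cstar[OF finite_max_clique[OF C], of "F C"] by simp
    then show "blk_opnorm C (F C) \<le> sqrt (bnorm n R (\<lambda>C i j. \<Sum>k\<in>C. cnj (F C k i) * F C k j))"
      by (rule real_le_rsqrt)
  qed (simp add: bnorm_nonneg)
  then have "(bnorm n R F)\<^sup>2 \<le> (sqrt (bnorm n R (\<lambda>C i j. \<Sum>k\<in>C. cnj (F C k i) * F C k j)))\<^sup>2"
    by (rule power_mono) (rule bnorm_nonneg)
  then show "(bnorm n R F)\<^sup>2 \<le> bnorm n R (\<lambda>C i j. \<Sum>k\<in>C. cnj (F C k i) * F C k j)"
    by (simp add: bnorm_nonneg)
qed

text \<open>The norm dominates each entry and is dominated by the finite sum of all entries, so
  convergence is entrywise.\<close>

lemma block_complete: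
  assumes f: "\<And>k. f k \<in> carrier (block_alg n R)"
    and cauchy: "\<And>e. e > 0 \<Longrightarrow> \<exists>N. \<forall>k\<ge>N. \<forall>l\<ge>N. bnorm n R (\<lambda>C i j. f k C i j - f l C i j) < e"
  shows "\<exists>L\<in>carrier (block_alg n R). (\<lambda>k. bnorm n R (\<lambda>C i j. f k C i j - L C i j)) \<longlonglongrightarrow> 0"
proof -
  have "Cauchy (\<lambda>k. f k C i j)" if "C \<in> max_cliques n R" "i \<in> C" "j \<in> C" for C i j
    unfolding Cauchy_iff
  proof (intro allI impI)
    fix e :: real assume "e > 0"
    then obtain N where "\<forall>k\<ge>N. \<forall>l\<ge>N. bnorm n R (\<lambda>C i j. f k C i j - f l C i j) < e"
      using cauchy by blast
    then show "\<exists>N. \<forall>k\<ge>N. \<forall>l\<ge>N. norm (f k C i j - f l C i j) < e"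
      using entry_le_bnorm[OF that, of "\<lambda>C i j. f k C i j - f l C i j" for k l]
      by (meson order_le_less_trans)
  qed
  then have conv: "(\<lambda>k. f k C i j) \<longlonglongrightarrow> lim (\<lambda>k. f k C i j)"
    if "C \<in> max_cliques n R" "i \<in> C" "j \<in> C" for C i j
    using that Cauchy_convergent convergent_LIMSEQ_iff by blast
  define L where "L C i j = (if C \<in> max_cliques n R \<and> i \<in> C \<and> j \<in> C then lim (\<lambda>k. f k C i j) else 0)" for C i j
  have "(\<lambda>k. \<Sum>C\<in>max_cliques n R. \<Sum>i\<in>C. \<Sum>j\<in>C. cmod (f k C i j - L C i j)) \<longlonglongrightarrow>
      (\<Sum>C\<in>max_cliques n R. \<Sum>i\<in>C. \<Sum>j\<in>C. 0)"
  proof (intro tendsto_sum)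
    fix C i j assume "C \<in> max_cliques n R" "i \<in> C" "j \<in> C"
    then have "(\<lambda>k. f k C i j) \<longlonglongrightarrow> L C i j" using conv by (simp add: L_def)
    then show "(\<lambda>k. cmod (f k C i j - L C i j)) \<longlonglongrightarrow> 0"
      by (simp add: LIM_zero_iff tendsto_norm_zero_iff)
  qed
  then have "(\<lambda>k. bnorm n R (\<lambda>C i j. f k C i j - L C i j)) \<longlonglongrightarrow> 0"
    by (intro Lim_null_comparison[of "\<lambda>k. bnorm n R (\<lambda>C i j. f k C i j - L C i j)"] always_eventually allI)
      (auto simp: bnorm_nonneg bnorm_le_sum)
  moreover have "L \<in> carrier (block_alg n R)" by (auto simp: L_def)
  ultimately show ?thesis by blast
qed

lemma block_mul_one:
  assumes "F \<in> carrier (block_alg n R)"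
  shows "ca_mul (block_alg n R) (ca_one (block_alg n R)) F = F"
    and "ca_mul (block_alg n R) F (ca_one (block_alg n R)) = F"
proof -
  have "(\<Sum>k\<in>C. (if C \<in> max_cliques n R \<and> i \<in> C \<and> i = k then 1 else 0) * F C k j) = F C i j \<and>
      (\<Sum>k\<in>C. F C i k * (if C \<in> max_cliques n R \<and> k \<in> C \<and> k = j then 1 else 0)) = F C i j" for C i j
  proof (cases "C \<in> max_cliques n R \<and> i \<in> C \<and> j \<in> C")
    case True
    then have "finite C" using finite_max_clique by blast
    have "(\<Sum>k\<in>C. (if C \<in> max_cliques n R \<and> i \<in> C \<and> i = k then 1 else 0) * F C k j) = (\<Sum>k\<in>C. if k = i then F C i j else 0)"
      using True by (intro sum.cong) auto
    moreover have "(\<Sum>k\<in>C. F C i k * (if C \<in> max_cliques n R \<and> k \<in> C \<and> k = j then 1 else 0)) = (\<Sum>k\<in>C. if k = j then F C i j else 0)"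
      using True by (intro sum.cong) auto
    ultimately show ?thesis using True \<open>finite C\<close> by simp
  next
    case False
    then have "F C i j = 0" using assms by auto
    moreover have "(if C \<in> max_cliques n R \<and> i \<in> C \<and> i = k then 1 else 0) * F C k j = 0"
      "F C i k * (if C \<in> max_cliques n R \<and> k \<in> C \<and> k = j then 1 else 0) = 0" if "k \<in> C" for k
      using False assms that by auto
    ultimately show ?thesis by (simp add: sum.neutral)
  qed
  then show "ca_mul (block_alg n R) (ca_one (block_alg n R)) F = F"
    "ca_mul (block_alg n R) F (ca_one (block_alg n R)) = F"
    unfolding block_alg_sel by presburger+
qed

lemma unital_cstar_algebra_block: "unital_cstar_algebra (block_alg n R)"
proof -
  let ?A = "block_alg n R"
  have norm: "ca_norm ?A = bnorm n R" by (simp add: bnorm_def fun_eq_iff)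
  have assoc: "(\<Sum>k\<in>C. (\<Sum>l\<in>C. F C i l * G C l k) * H C k j) = (\<Sum>l\<in>C. F C i l * (\<Sum>k\<in>C. G C l k * H C k j))"
    for F G H :: "nat set \<Rightarrow> nat \<Rightarrow> nat \<Rightarrow> complex" and C i j
  proof -
    have "(\<Sum>k\<in>C. (\<Sum>l\<in>C. F C i l * G C l k) * H C k j) = (\<Sum>k\<in>C. \<Sum>l\<in>C. F C i l * (G C l k * H C k j))"
      by (simp add: sum_distrib_right mult.assoc)
    also have "\<dots> = (\<Sum>l\<in>C. \<Sum>k\<in>C. F C i l * (G C l k * H C k j))" by (rule sum.swap)
    finally show ?thesis by (simp add: sum_distrib_left)
  qed
  have nz: "bnorm n R F = 0 \<longleftrightarrow> F = (\<lambda>C i j. 0)" if F: "F \<in> carrier ?A" for F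
  proof
    assume "bnorm n R F = 0"
    then have "F C i j = 0" if "C \<in> max_cliques n R" "i \<in> C" "j \<in> C" for C i j
      using entry_le_bnorm[OF that, of F] by simp
    moreover have "F C i j = 0" if "\<not> (C \<in> max_cliques n R \<and> i \<in> C \<and> j \<in> C)" for C i j
      using F that by simp
    ultimately show "F = (\<lambda>C i j. 0)" by (intro ext) blast
  next
    assume "F = (\<lambda>C i j. 0)"
    then have "bnorm n R F \<le> 0" using bnorm_le_sum[of n R F] by simp
    then show "bnorm n R F = 0" using bnorm_nonneg[of n R F] by simp
  qed
  have nadd: "bnorm n R (\<lambda>C i j. F C i j + G C i j) \<le> bnorm n R F + bnorm n R G" for F G
  proof (rule bnorm_least)
    fix C assume C: "C \<in> max_cliques n R"
    show "blk_opnorm C (\<lambda>i j. F C i j + G C i j) \<le> bnorm n R F + bnorm n R G"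
      using opnorm_add[OF finite_max_clique[OF C], of "F C" "G C"] bnorm_upper[OF C, of F] bnorm_upper[OF C, of G]
      by linarith
  qed (simp add: bnorm_nonneg)
  have nmul: "bnorm n R (\<lambda>C i j. \<Sum>k\<in>C. F C i k * G C k j) \<le> bnorm n R F * bnorm n R G" for F G
  proof (rule bnorm_least)
    fix C assume C: "C \<in> max_cliques n R"
    have "blk_opnorm C (F C) * blk_opnorm C (G C) \<le> bnorm n R F * bnorm n R G"
      using C by (intro mult_mono bnorm_upper bnorm_nonneg opnorm_nonneg finite_max_clique)
    then show "blk_opnorm C (\<lambda>i j. \<Sum>k\<in>C. F C i k * G C k j) \<le> bnorm n R F * bnorm n R G"
      using opnorm_mult[OF finite_max_clique[OF C], of "F C" "G C"] by linarith
  qed (simp add: bnorm_nonneg)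
  show ?thesis
    unfolding unital_cstar_algebra_def norm
  proof (intro conjI ballI allI impI)
    show "ca_zero ?A \<in> carrier ?A" by simp
    show "ca_one ?A \<in> carrier ?A" by simp
  next
    fix F G H assume F: "F \<in> carrier ?A" and G: "G \<in> carrier ?A" and H: "H \<in> carrier ?A"
    show "ca_add ?A (ca_add ?A F G) H = ca_add ?A F (ca_add ?A G H)" by (simp add: add.assoc)
    show "ca_mul ?A (ca_mul ?A F G) H = ca_mul ?A F (ca_mul ?A G H)" by (simp add: assoc)
    show "ca_mul ?A F (ca_add ?A G H) = ca_add ?A (ca_mul ?A F G) (ca_mul ?A F H)"
      by (simp add: distrib_left sum.distrib)
    show "ca_mul ?A (ca_add ?A F G) H = ca_add ?A (ca_mul ?A F H) (ca_mul ?A G H)"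
      by (simp add: distrib_right sum.distrib)
  next
    fix F G assume F: "F \<in> carrier ?A" and G: "G \<in> carrier ?A"
    show "ca_add ?A F G \<in> carrier ?A" using F G by auto
    show "ca_mul ?A F G \<in> carrier ?A" using F G by (auto intro!: sum.neutral)
    show "ca_add ?A F G = ca_add ?A G F" by (simp add: add.commute)
    show "ca_smult ?A c (ca_add ?A F G) = ca_add ?A (ca_smult ?A c F) (ca_smult ?A c G)" for c
      by (simp add: distrib_left)
    show "ca_mul ?A (ca_smult ?A c F) G = ca_smult ?A c (ca_mul ?A F G)" for c
      by (simp add: sum_distrib_left mult.assoc)
    show "ca_mul ?A F (ca_smult ?A c G) = ca_smult ?A c (ca_mul ?A F G)" for c
      by (simp add: sum_distrib_left mult.left_commute)
    show "ca_star ?A (ca_add ?A F G) = ca_add ?A (ca_star ?A F) (ca_star ?A G)" by simp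
    show "ca_star ?A (ca_mul ?A F G) = ca_mul ?A (ca_star ?A G) (ca_star ?A F)"
      by (simp add: mult.commute)
    show "bnorm n R (ca_add ?A F G) \<le> bnorm n R F + bnorm n R G" using nadd by simp
    show "bnorm n R (ca_mul ?A F G) \<le> bnorm n R F * bnorm n R G" using nmul by simp
  next
    fix F assume F: "F \<in> carrier ?A"
    show "ca_smult ?A c F \<in> carrier ?A" for c using F by auto
    show "ca_star ?A F \<in> carrier ?A" using F by auto
    show "ca_add ?A F (ca_zero ?A) = F" by simp
    show "\<exists>G\<in>carrier ?A. ca_add ?A F G = ca_zero ?A"
      using F by (intro bexI[of _ "\<lambda>C i j. - F C i j"]) auto
    show "ca_smult ?A (c + d) F = ca_add ?A (ca_smult ?A c F) (ca_smult ?A d F)" for c d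
      by (simp add: distrib_right)
    show "ca_smult ?A (c * d) F = ca_smult ?A c (ca_smult ?A d F)" for c d
      by (simp add: mult.assoc)
    show "ca_smult ?A 1 F = F" by simp
    show "ca_mul ?A (ca_one ?A) F = F" "ca_mul ?A F (ca_one ?A) = F" by (rule block_mul_one[OF F])+
    show "ca_star ?A (ca_star ?A F) = F" by simp
    show "ca_star ?A (ca_smult ?A c F) = ca_smult ?A (cnj c) (ca_star ?A F)" for c by simp
    show "bnorm n R F \<ge> 0" by (rule bnorm_nonneg)
    show "bnorm n R F = 0 \<longleftrightarrow> F = ca_zero ?A" using nz[OF F] by simp
    show "bnorm n R (ca_smult ?A c F) = cmod c * bnorm n R F" for c by (simp add: bnorm_scale)
    show "bnorm n R (ca_mul ?A (ca_star ?A F) F) = (bnorm n R F)\<^sup>2" by (simp add: bnorm_cstar)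
  next
    fix f :: "nat \<Rightarrow> nat set \<Rightarrow> nat \<Rightarrow> nat \<Rightarrow> complex"
    assume "(\<forall>k. f k \<in> carrier ?A) \<and>
      (\<forall>e>0. \<exists>N. \<forall>k\<ge>N. \<forall>l\<ge>N. bnorm n R (ca_sub ?A (f k) (f l)) < e)"
    then show "\<exists>L\<in>carrier ?A. (\<lambda>k. bnorm n R (ca_sub ?A (f k) L)) \<longlonglongrightarrow> 0"
      using block_complete[of f n R] unfolding block_sub by blast
  qed
qed

section \<open>Positive matrices over the direct sum and over the dual system\<close>

lemma ca_sum_block: "ca_sum (block_alg n R) f m = (\<lambda>C i j. \<Sum>k<m. f k C i j)"
proof -
  have "foldr (\<lambda>k acc. ca_add (block_alg n R) (f k) acc) ks (ca_zero (block_alg n R)) =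
      (\<lambda>C i j. sum_list (map (\<lambda>k. f k C i j) ks))" for ks
    by (induction ks) (auto simp: fun_eq_iff)
  from this[of "[0..<m]"] show ?thesis
    by (simp add: ca_sum_def interv_sum_list_conv_sum_set_nat atLeast0LessThan)
qed

text \<open>The factorization of a block has its rows indexed by \<open>{..<m} \<times> C\<close>,
  the same set as its columns. Thus it regroups into \<open>m\<close> rows of elements of the direct
  sum, exactly the number that \<open>mat_pos\<close> provides.\<close>

lemma mat_pos_block_iff:
  assumes P: "\<And>a b. a < m \<Longrightarrow> b < m \<Longrightarrow> P a b \<in> carrier (block_alg n R)"
  shows "mat_pos (block_alg n R) m P \<longleftrightarrow>
    (\<forall>C\<in>max_cliques n R. psd ({..<m} \<times> C) (\<lambda>p q. P (fst p) (fst q) C (snd p) (snd q)))"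
proof
  assume "mat_pos (block_alg n R) m P"
  then obtain Y where Y: "\<And>a b. a < m \<Longrightarrow> b < m \<Longrightarrow>
      P a b = (\<lambda>C i j. \<Sum>k<m. \<Sum>r\<in>C. cnj (Y k a C r i) * Y k b C r j)"
    unfolding mat_pos_def ca_sum_block by auto
  show "\<forall>C\<in>max_cliques n R. psd ({..<m} \<times> C) (\<lambda>p q. P (fst p) (fst q) C (snd p) (snd q))"
  proof
    fix C assume "C \<in> max_cliques n R"
    have "psd ({..<m} \<times> C) (\<lambda>p q. \<Sum>k<m. \<Sum>r\<in>C. cnj (Y k (fst p) C r (snd p)) * Y k (fst q) C r (snd q))"
      by (intro psd_sum psd_rank_one)
    then show "psd ({..<m} \<times> C) (\<lambda>p q. P (fst p) (fst q) C (snd p) (snd q))"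
      by (rule psd_cong[THEN iffD1, rotated]) (auto simp: Y)
  qed
next
  assume psd: "\<forall>C\<in>max_cliques n R. psd ({..<m} \<times> C) (\<lambda>p q. P (fst p) (fst q) C (snd p) (snd q))"
  have "\<forall>C\<in>max_cliques n R. \<exists>L. \<forall>p\<in>{..<m} \<times> C. \<forall>q\<in>{..<m} \<times> C. P (fst p) (fst q) C (snd p) (snd q) =
      (\<Sum>s\<in>{..<m} \<times> C. cnj (L s p) * L s q)"
    using psd finite_max_clique by (intro ballI psd_factorization) auto
  from bchoice[OF this] obtain L where L: "\<And>C p q. C \<in> max_cliques n R \<Longrightarrow> p \<in> {..<m} \<times> C \<Longrightarrow> q \<in> {..<m} \<times> C \<Longrightarrow>
      P (fst p) (fst q) C (snd p) (snd q) = (\<Sum>s\<in>{..<m} \<times> C. cnj (L C s p) * L C s q)"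
    by blast
  define Y where "Y k a C r i = (if C \<in> max_cliques n R \<and> r \<in> C \<and> i \<in> C then L C (k, r) (a, i) else 0)" for k a C r i
  have "P a b C i j = (\<Sum>k<m. \<Sum>r\<in>C. cnj (Y k a C r i) * Y k b C r j)" if ab: "a < m" "b < m" for a b C i j
  proof (cases "C \<in> max_cliques n R \<and> i \<in> C \<and> j \<in> C")
    case True
    then have "P a b C i j = (\<Sum>s\<in>{..<m} \<times> C. cnj (L C s (a, i)) * L C s (b, j))"
      using L[of C "(a, i)" "(b, j)"] ab by simp
    also have "\<dots> = (\<Sum>k<m. \<Sum>r\<in>C. cnj (L C (k, r) (a, i)) * L C (k, r) (b, j))"
      by (simp add: sum.cartesian_product split_def)
    finally show ?thesis using True by (simp add: Y_def)
  next
    case False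
    then have "P a b C i j = 0" using P[OF ab] by auto
    moreover have "cnj (Y k a C r i) * Y k b C r j = 0" for k r using False by (auto simp: Y_def)
    ultimately show ?thesis by (simp only: sum.neutral_const)
  qed
  moreover have "Y k a \<in> carrier (block_alg n R)" for k a by (auto simp: Y_def)
  ultimately show "mat_pos (block_alg n R) m P"
    unfolding mat_pos_def ca_sum_block using P
    by (intro conjI exI[of _ Y]) (auto simp: fun_eq_iff)
qed

lemma psd_block_iff:
  "psd_block n m K \<longleftrightarrow> psd ({..<m} \<times> {1..n}) (\<lambda>p q. K (fst p) (fst q) (snd p) (snd q))"
proof -
  have eq: "(\<Sum>a<m. \<Sum>b<m. \<Sum>i\<in>{1..n}. \<Sum>j\<in>{1..n}. cnj (w (a, i)) * K a b i j * w (b, j)) =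
    (\<Sum>p\<in>{..<m} \<times> {1..n}. \<Sum>q\<in>{..<m} \<times> {1..n}. cnj (w p) * K (fst p) (fst q) (snd p) (snd q) * w q)" for w
  proof -
    have "(\<Sum>p\<in>{..<m} \<times> {1..n}. \<Sum>q\<in>{..<m} \<times> {1..n}. cnj (w p) * K (fst p) (fst q) (snd p) (snd q) * w q) =
        (\<Sum>a<m. \<Sum>i\<in>{1..n}. \<Sum>b<m. \<Sum>j\<in>{1..n}. cnj (w (a, i)) * K a b i j * w (b, j))"
      by (simp add: sum.cartesian_product[symmetric] split_def sum.cartesian_product')
    also have "\<dots> = (\<Sum>a<m. \<Sum>b<m. \<Sum>i\<in>{1..n}. \<Sum>j\<in>{1..n}. cnj (w (a, i)) * K a b i j * w (b, j))"
      by (intro sum.cong refl sum.swap)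
    finally show ?thesis by simp
  qed
  have pos: "z \<in> \<real> \<and> Re z \<ge> 0 \<longleftrightarrow> 0 \<le> z" for z :: complex
    by (auto simp: less_eq_complex_def complex_is_Real_iff)
  show ?thesis
    unfolding psd_block_def psd_def pos
  proof (intro iffI allI)
    fix w assume "\<forall>v. 0 \<le> (\<Sum>a<m. \<Sum>b<m. \<Sum>i\<in>{1..n}. \<Sum>j\<in>{1..n}. cnj (v a i) * K a b i j * v b j)"
    from this[rule_format, of "\<lambda>a i. w (a, i)"]
    show "0 \<le> (\<Sum>p\<in>{..<m} \<times> {1..n}. \<Sum>q\<in>{..<m} \<times> {1..n}. cnj (w p) * K (fst p) (fst q) (snd p) (snd q) * w q)"
      unfolding eq .
  next
    fix v :: "nat \<Rightarrow> nat \<Rightarrow> complex"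
    assume "\<forall>w. 0 \<le> (\<Sum>p\<in>{..<m} \<times> {1..n}. \<Sum>q\<in>{..<m} \<times> {1..n}. cnj (w p) * K (fst p) (fst q) (snd p) (snd q) * w q)"
    from this[rule_format, of "\<lambda>p. v (fst p) (snd p)"]
    show "0 \<le> (\<Sum>a<m. \<Sum>b<m. \<Sum>i\<in>{1..n}. \<Sum>j\<in>{1..n}. cnj (v a i) * K a b i j * v b j)"
      unfolding eq[symmetric] by simp
  qed
qed

section \<open>The complete order embedding\<close>

lemma Phi_carrier: "Phi n R x \<in> carrier (block_alg n R)"
  by (auto simp: Phi_def)

text \<open>A correction from the annihilator of \<open>R\<close> is invisible on cliques.
  Conversely, the entries that a positive completion has outside \<open>R\<close> form such a
  correction.\<close>

lemma ERd_pos_iff: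
  assumes tol: "tol_rel n R" and ch: "chordal n R"
    and M: "\<And>a b. a < m \<Longrightarrow> b < m \<Longrightarrow> M a b \<in> ER n R"
  shows "ERd_pos n R m M \<longleftrightarrow>
    (\<forall>C\<in>max_cliques n R. psd ({..<m} \<times> C) (\<lambda>p q. M (fst p) (fst q) (snd p) (snd q)))"
proof
  assume "ERd_pos n R m M"
  then obtain N where N: "\<And>a b. a < m \<Longrightarrow> b < m \<Longrightarrow> N a b \<in> ER_perp n R"
    "psd ({..<m} \<times> {1..n}) (\<lambda>p q. M (fst p) (fst q) (snd p) (snd q) + N (fst p) (fst q) (snd p) (snd q))"
    unfolding ERd_pos_def psd_block_iff by blast
  show "\<forall>C\<in>max_cliques n R. psd ({..<m} \<times> C) (\<lambda>p q. M (fst p) (fst q) (snd p) (snd q))"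
  proof
    fix C assume C: "C \<in> max_cliques n R"
    have sub: "{..<m} \<times> C \<subseteq> {..<m} \<times> {1..n}" using max_cliques_subset[OF C] by auto
    have "psd ({..<m} \<times> C) (\<lambda>p q. M (fst p) (fst q) (snd p) (snd q) + N (fst p) (fst q) (snd p) (snd q))"
      by (rule psd_subset[OF N(2) sub]) simp
    then show "psd ({..<m} \<times> C) (\<lambda>p q. M (fst p) (fst q) (snd p) (snd q))"
      by (rule psd_cong[THEN iffD1, rotated])
        (use N(1) max_clique_rel[OF tol C] in \<open>auto simp: ER_perp_def\<close>)
  qed
next
  assume psd: "\<forall>C\<in>max_cliques n R. psd ({..<m} \<times> C) (\<lambda>p q. M (fst p) (fst q) (snd p) (snd q))"
  have "\<exists>K. psd ({..<m} \<times> {1..n}) K \<and> (\<forall>a\<in>{..<m}. \<forall>b\<in>{..<m}. \<forall>i\<in>{1..n}. \<forall>j\<in>{1..n}. (i, j) \<in> R \<longrightarrow>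
      K (a, i) (b, j) = (\<lambda>p q. M (fst p) (fst q) (snd p) (snd q)) (a, i) (b, j))"
  proof (rule chordal_completion[OF tol ch])
    fix D assume "is_clique n R D"
    then obtain C where C: "C \<in> max_cliques n R" "D \<subseteq> C" using clique_extends by blast
    show "psd ({..<m} \<times> D) (\<lambda>p q. M (fst p) (fst q) (snd p) (snd q))"
      by (rule psd_subset[of "{..<m} \<times> C"]) (use psd C finite_max_clique in auto)
  qed auto
  then obtain K where K: "psd ({..<m} \<times> {1..n}) K"
    "\<And>a b i j. a < m \<Longrightarrow> b < m \<Longrightarrow> i \<in> {1..n} \<Longrightarrow> j \<in> {1..n} \<Longrightarrow> (i, j) \<in> R \<Longrightarrow> K (a, i) (b, j) = M a b i j"
    by auto
  define N where "N a b i j = (if i \<in> {1..n} \<and> j \<in> {1..n} \<and> (i, j) \<notin> R then K (a, i) (b, j) else 0)" for a b i j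
  have "psd_block n m (\<lambda>a b i j. M a b i j + N a b i j)"
    unfolding psd_block_iff
    by (rule psd_cong[THEN iffD1, OF _ K(1)]) (use K(2) M in \<open>auto simp: N_def ER_def\<close>)
  moreover have "N a b \<in> ER_perp n R" for a b by (auto simp: ER_perp_def N_def)
  ultimately show "ERd_pos n R m M"
    unfolding ERd_pos_def using M by blast
qed

lemma complete_order_embedding_Phi:
  assumes tol: "tol_rel n R" and ch: "chordal n R"
  shows "complete_order_embedding n R (block_alg n R) (Phi n R)"
  unfolding complete_order_embedding_def
proof (intro conjI ballI allI impI)
  show "inj_on (Phi n R) (ER n R)"
  proof (rule inj_onI)
    fix x y assume xy: "x \<in> ER n R" "y \<in> ER n R" "Phi n R x = Phi n R y"
    have "x i j = y i j" for i j
    proof (cases "(i, j) \<in> R")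
      case True
      then obtain C where C: "C \<in> max_cliques n R" "i \<in> C" "j \<in> C"
        using rel_in_max_clique[OF tol] by metis
      from xy(3) have "Phi n R x C i j = Phi n R y C i j" by simp
      then show ?thesis using C by (simp add: Phi_def)
    next
      case False
      then show ?thesis using xy by (simp add: ER_def)
    qed
    then show "x = y" by blast
  qed
  fix m :: nat and M assume M: "\<forall>a<m. \<forall>b<m. M a b \<in> ER n R"
  have "(\<forall>C\<in>max_cliques n R. psd ({..<m} \<times> C) (\<lambda>p q. M (fst p) (fst q) (snd p) (snd q))) \<longleftrightarrow>
    (\<forall>C\<in>max_cliques n R. psd ({..<m} \<times> C) (\<lambda>p q. Phi n R (M (fst p) (fst q)) C (snd p) (snd q)))"
    by (intro ball_cong refl psd_cong) (auto simp: Phi_def)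
  then show "ERd_pos n R m M \<longleftrightarrow> mat_pos (block_alg n R) m (\<lambda>a b. Phi n R (M a b))"
    using M by (subst ERd_pos_iff[OF tol ch]) (auto simp: mat_pos_block_iff Phi_carrier simp del: block_alg_sel)
next
  show "Phi n R (idX n) = ca_one (block_alg n R)"
    using max_cliques_subset by (fastforce simp: Phi_def idX_def fun_eq_iff)
qed (auto simp: Phi_def fun_eq_iff)

section \<open>Generation of the direct sum by the image of \<open>Phi\<close>\<close>

definition munit :: "nat \<Rightarrow> nat \<Rightarrow> nat \<Rightarrow> nat \<Rightarrow> complex" where
  "munit i j = (\<lambda>k l. if k = i \<and> l = j then 1 else 0)"

lemma munit_ER: "(i, j) \<in> R \<Longrightarrow> munit i j \<in> ER n R"
  by (auto simp: ER_def munit_def)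

text \<open>The matrix unit at \<open>(i, j)\<close> placed simultaneously in the blocks of all
  maximal cliques containing \<open>S\<close>. Multiplication enlarges \<open>S\<close> and so
  removes blocks.\<close>

definition multi_unit :: "nat \<Rightarrow> (nat \<times> nat) set \<Rightarrow> nat set \<Rightarrow> nat \<Rightarrow> nat \<Rightarrow> nat set \<Rightarrow> nat \<Rightarrow> nat \<Rightarrow> complex" where
  "multi_unit n R S i j = (\<lambda>C k l. if C \<in> max_cliques n R \<and> S \<subseteq> C \<and> k = i \<and> l = j then 1 else 0)"

lemma Phi_munit: "Phi n R (munit i j) = multi_unit n R {i, j} i j"
  by (auto simp: Phi_def munit_def multi_unit_def fun_eq_iff)

lemma multi_unit_mult:
  assumes "k \<in> S"
  shows "ca_mul (block_alg n R) (multi_unit n R S i k) (multi_unit n R S' k j) = multi_unit n R (S \<union> S') i j"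
proof -
  have "(\<Sum>l\<in>C. multi_unit n R S i k C a l * multi_unit n R S' k j C l b) = multi_unit n R (S \<union> S') i j C a b" for C a b
  proof (cases "C \<in> max_cliques n R \<and> S \<subseteq> C \<and> S' \<subseteq> C \<and> a = i \<and> b = j")
    case True
    then have "finite C" "k \<in> C" using finite_max_clique assms by auto
    have "(\<Sum>l\<in>C. multi_unit n R S i k C a l * multi_unit n R S' k j C l b) = (\<Sum>l\<in>C. if l = k then 1 else 0)"
      using True by (intro sum.cong) (auto simp: multi_unit_def)
    then show ?thesis using True \<open>finite C\<close> \<open>k \<in> C\<close> by (simp add: multi_unit_def)
  next
    case False
    then have "multi_unit n R S i k C a l * multi_unit n R S' k j C l b = 0" for l
      by (auto simp: multi_unit_def)
    then have "(\<Sum>l\<in>C. multi_unit n R S i k C a l * multi_unit n R S' k j C l b) = 0"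
      by (intro sum.neutral) blast
    moreover have "multi_unit n R (S \<union> S') i j C a b = 0" using False by (auto simp: multi_unit_def)
    ultimately show ?thesis by simp
  qed
  then show ?thesis by (simp add: fun_eq_iff)
qed

text \<open>Multiplying the images of the matrix units along a walk through all vertices of \<open>C\<close> leaves
  only the blocks of cliques containing \<open>C\<close>, that is, the block of \<open>C\<close>.\<close>

lemma cstar_gen_Phi:
  assumes tol: "tol_rel n R"
  shows "cstar_gen (block_alg n R) (Phi n R ` ER n R) = carrier (block_alg n R)"
proof (rule antisym)
  let ?A = "block_alg n R"
  let ?P = "\<lambda>T. Phi n R ` ER n R \<subseteq> T \<and> T \<subseteq> carrier ?A \<and> ca_one ?A \<in> T \<and> ca_zero ?A \<in> T \<and>
        (\<forall>x\<in>T. \<forall>y\<in>T. ca_add ?A x y \<in> T \<and> ca_mul ?A x y \<in> T) \<and>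
        (\<forall>c. \<forall>x\<in>T. ca_smult ?A c x \<in> T) \<and> (\<forall>x\<in>T. ca_star ?A x \<in> T) \<and>
        (\<forall>f L. (\<forall>k. f k \<in> T) \<and> L \<in> carrier ?A \<and>
               (\<lambda>k. ca_norm ?A (ca_sub ?A (f k) L)) \<longlonglongrightarrow> 0 \<longrightarrow> L \<in> T)"
  have U: "unital_cstar_algebra ?A" by (rule unital_cstar_algebra_block)
  have "?P (carrier ?A)"
    using U Phi_carrier[of n R] unfolding unital_cstar_algebra_def
    by (elim conjE, intro conjI) (blast | simp only: image_subset_iff)+
  then show "cstar_gen ?A (Phi n R ` ER n R) \<subseteq> carrier ?A"
    unfolding cstar_gen_def by blast
  show "carrier ?A \<subseteq> cstar_gen ?A (Phi n R ` ER n R)"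
  proof
    fix F assume F: "F \<in> carrier ?A"
    have "F \<in> T" if T: "?P T" for T
    proof -
      have add: "ca_add ?A x y \<in> T" and mul: "ca_mul ?A x y \<in> T" if "x \<in> T" "y \<in> T" for x y
        using T that by blast+
      have smult: "ca_smult ?A c x \<in> T" if "x \<in> T" for c x using T that by blast
      have zero: "ca_zero ?A \<in> T" using T by blast
      have base: "multi_unit n R {i, j} i j \<in> T" if "(i, j) \<in> R" for i j
        using T munit_ER[OF that, of n] unfolding Phi_munit[symmetric] by blast
      have unit: "multi_unit n R C i j \<in> T" if C: "C \<in> max_cliques n R" "i \<in> C" "j \<in> C" for C i j
      proof -
        \<comment> \<open>The starting vertex \<open>i\<close> varies in the induction, since each
          step prepends an edge from a new vertex to the old start.\<close>
        have "multi_unit n R ({i, j} \<union> D) i j \<in> T" if "finite D" "D \<subseteq> C" "i \<in> C" for D i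
          using that
        proof (induction D arbitrary: i rule: finite_induct)
          case empty
          then show ?case using base max_clique_rel[OF tol C(1) _ C(3)] by simp
        next
          case (insert d D)
          have "multi_unit n R {i, d} i d \<in> T"
            using base max_clique_rel[OF tol C(1), of i d] insert.prems by simp
          moreover have "multi_unit n R ({d, j} \<union> D) d j \<in> T"
            using insert by simp
          ultimately have "multi_unit n R ({i, d} \<union> ({d, j} \<union> D)) i j \<in> T"
            using mul[of "multi_unit n R {i, d} i d" "multi_unit n R ({d, j} \<union> D) d j"]
              multi_unit_mult[of d "{i, d}" n R i "{d, j} \<union> D" j] by simp
          moreover have "{i, d} \<union> ({d, j} \<union> D) = {i, j} \<union> insert d D" by auto
          ultimately show ?case by simp
        qed
        from this[OF finite_max_clique[OF C(1)] subset_refl C(2)] show ?thesis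
          using C by (simp add: insert_absorb)
      qed
      define Tr where "Tr = {(C, i, j). C \<in> max_cliques n R \<and> i \<in> C \<and> j \<in> C}"
      have "finite Tr"
        by (rule finite_subset[of _ "max_cliques n R \<times> {1..n} \<times> {1..n}"])
          (use max_cliques_subset finite_max_cliques in \<open>auto simp: Tr_def\<close>)
      have "(\<lambda>C i j. if (C, i, j) \<in> S then F C i j else 0) \<in> T" if "finite S" "S \<subseteq> Tr" for S
        using that
      proof (induction S rule: finite_induct)
        case empty
        then show ?case using zero by simp
      next
        case (insert t S)
        obtain C i j where t: "t = (C, i, j)" by (cases t)
        then have C: "C \<in> max_cliques n R" "i \<in> C" "j \<in> C" using insert.prems by (auto simp: Tr_def)
        have "ca_add ?A (ca_smult ?A (F C i j) (multi_unit n R C i j)) (\<lambda>C i j. if (C, i, j) \<in> S then F C i j else 0) \<in> T"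
          using insert by (intro add smult unit C) auto
        moreover have "multi_unit n R C i j C' i' j' = (if (C', i', j') = t then 1 else 0)" for C' i' j'
          using C max_cliques_maximal[OF C(1), of C'] by (auto simp: multi_unit_def t)
        ultimately show ?case
          using insert.hyps by (auto simp: t fun_eq_iff elim!: back_subst[of "\<lambda>x. x \<in> T"])
      qed
      from this[OF \<open>finite Tr\<close> subset_refl]
      have "(\<lambda>C i j. if (C, i, j) \<in> Tr then F C i j else 0) \<in> T" .
      moreover have "(\<lambda>C i j. if (C, i, j) \<in> Tr then F C i j else 0) = F"
        using F by (auto simp: Tr_def fun_eq_iff)
      ultimately show ?thesis by simp
    qed
    then show "F \<in> cstar_gen ?A (Phi n R ` ER n R)"
      unfolding cstar_gen_def by blast
  qed
qed

lemma cstar_extension_Phi: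
  "tol_rel n R \<Longrightarrow> chordal n R \<Longrightarrow> cstar_extension n R (block_alg n R) (Phi n R)"
  by (simp add: cstar_extension_def unital_cstar_algebra_block complete_order_embedding_Phi cstar_gen_Phi
      del: block_alg_sel)

section \<open>Representations on approximate vectors\<close>

lemma tendsto_mult_left_null:
  fixes b :: "'a::real_normed_algebra"
  shows "f \<longlonglongrightarrow> 0 \<Longrightarrow> (\<lambda>N. b * f N) \<longlonglongrightarrow> 0"
  by (drule tendsto_mult_left[where c = b]) simp

text \<open>\<open>c N k\<close> stands for the \<open>k\<close>-th basis vector, and
  \<open>x_c\<close> says that \<open>x l j\<close> acts asymptotically as a matrix unit. The upper
  bound serves limits of represented elements; the lower bound \<open>\<delta>\<close> makes the
  representing matrix unique.\<close>

locale approx_vectors =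
  fixes C :: "nat set" and c :: "nat \<Rightarrow> nat \<Rightarrow> 'a::cstar" and x :: "nat \<Rightarrow> nat \<Rightarrow> 'a" and \<delta> :: "nat \<Rightarrow> real"
  assumes finC: "finite C"
    and c_le: "k \<in> C \<Longrightarrow> norm (c N k) \<le> 1"
    and c_ge: "k \<in> C \<Longrightarrow> \<delta> k > 0" "k \<in> C \<Longrightarrow> eventually (\<lambda>N. norm (c N k) \<ge> \<delta> k) sequentially"
    and x_c: "l \<in> C \<Longrightarrow> j \<in> C \<Longrightarrow> k \<in> C \<Longrightarrow> (\<lambda>N. x l j * c N k - (if j = k then c N l else 0)) \<longlonglongrightarrow> 0"
begin

text \<open>\<open>rep b X\<close>: in the limit, \<open>b\<close> acts on the span of the vectors \<open>c k\<close> as the matrix \<open>X\<close>.\<close>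

definition rep :: "'a \<Rightarrow> (nat \<Rightarrow> nat \<Rightarrow> complex) \<Rightarrow> bool" where
  "rep b X \<longleftrightarrow> (\<forall>k\<in>C. (\<lambda>N. b * c N k - (\<Sum>l\<in>C. cc (X l k) * c N l)) \<longlonglongrightarrow> 0)"

lemma rep_add: "rep b X \<Longrightarrow> rep d Z \<Longrightarrow> rep (b + d) (\<lambda>i j. X i j + Z i j)"
  unfolding rep_def
proof (intro ballI)
  fix k assume *: "\<forall>k\<in>C. (\<lambda>N. b * c N k - (\<Sum>l\<in>C. cc (X l k) * c N l)) \<longlonglongrightarrow> 0"
    "\<forall>k\<in>C. (\<lambda>N. d * c N k - (\<Sum>l\<in>C. cc (Z l k) * c N l)) \<longlonglongrightarrow> 0" "k \<in> C"
  from tendsto_add[OF *(1)[rule_format, OF *(3)] *(2)[rule_format, OF *(3)]]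
  show "(\<lambda>N. (b + d) * c N k - (\<Sum>l\<in>C. cc (X l k + Z l k) * c N l)) \<longlonglongrightarrow> 0"
    by (simp add: cc_add distrib_right sum.distrib algebra_simps)
qed

lemma rep_scale: "rep b X \<Longrightarrow> rep (cc z * b) (\<lambda>i j. z * X i j)"
  unfolding rep_def
proof (intro ballI)
  fix k assume *: "\<forall>k\<in>C. (\<lambda>N. b * c N k - (\<Sum>l\<in>C. cc (X l k) * c N l)) \<longlonglongrightarrow> 0" "k \<in> C"
  from tendsto_mult_left_null[OF *(1)[rule_format, OF *(2)], of "cc z"]
  show "(\<lambda>N. cc z * b * c N k - (\<Sum>l\<in>C. cc (z * X l k) * c N l)) \<longlonglongrightarrow> 0"
    by (simp add: cc_mult right_diff_distrib sum_distrib_left mult.assoc)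
qed

lemma rep_zero: "rep 0 (\<lambda>i j. 0)"
  by (simp add: rep_def)

lemma cc_sum: "cc (sum f A) = (\<Sum>i\<in>A. cc (f i) :: 'a)"
  by (induction A rule: infinite_finite_induct) (auto simp: cc_add)

lemma rep_mult:
  assumes "rep b X" "rep d Z"
  shows "rep (b * d) (\<lambda>i j. \<Sum>l\<in>C. X i l * Z l j)"
  unfolding rep_def
proof
  fix k assume k: "k \<in> C"
  have cc2: "cc z * (cc w * y) = cc (w * z) * y" for z w and y :: 'a
    using cc_mult[of z w, where 'a = 'a] by (simp add: mult.commute[of w z] mult.assoc)
  let ?d = "\<lambda>N. d * c N k - (\<Sum>l\<in>C. cc (Z l k) * c N l)"
  let ?b = "\<lambda>l N. b * c N l - (\<Sum>i\<in>C. cc (X i l) * c N i)"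
  have "(\<lambda>N. b * ?d N + (\<Sum>l\<in>C. cc (Z l k) * ?b l N)) \<longlonglongrightarrow> 0 + (\<Sum>l\<in>C. 0)"
    using assms k by (intro tendsto_add tendsto_sum tendsto_mult_left_null) (auto simp: rep_def)
  moreover have "b * ?d N + (\<Sum>l\<in>C. cc (Z l k) * ?b l N) =
      b * d * c N k - (\<Sum>i\<in>C. cc (\<Sum>l\<in>C. X i l * Z l k) * c N i)" for N
  proof -
    have "(\<Sum>l\<in>C. cc (Z l k) * (\<Sum>i\<in>C. cc (X i l) * c N i)) = (\<Sum>l\<in>C. \<Sum>i\<in>C. cc (X i l * Z l k) * c N i)"
      unfolding sum_distrib_left by (simp add: cc2)
    also have "\<dots> = (\<Sum>i\<in>C. \<Sum>l\<in>C. cc (X i l * Z l k) * c N i)"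
      by (rule sum.swap)
    also have "\<dots> = (\<Sum>i\<in>C. cc (\<Sum>l\<in>C. X i l * Z l k) * c N i)"
      by (simp add: cc_sum sum_distrib_right)
    finally have 1: "(\<Sum>l\<in>C. cc (Z l k) * (\<Sum>i\<in>C. cc (X i l) * c N i)) = (\<Sum>i\<in>C. cc (\<Sum>l\<in>C. X i l * Z l k) * c N i)" .
    have 2: "b * (\<Sum>l\<in>C. cc (Z l k) * c N l) = (\<Sum>l\<in>C. cc (Z l k) * (b * c N l))"
      unfolding sum_distrib_left by (intro sum.cong refl) (metis cc_commute mult.assoc)
    show ?thesis
      unfolding right_diff_distrib sum_subtractf 1 2 by (simp add: mult.assoc)
  qed
  ultimately show "(\<lambda>N. b * d * c N k - (\<Sum>i\<in>C. cc (\<Sum>l\<in>C. X i l * Z l k) * c N i)) \<longlonglongrightarrow> 0"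
    by simp
qed

lemma rep_x: "l \<in> C \<Longrightarrow> j \<in> C \<Longrightarrow> rep (x l j) (munit l j)"
  unfolding rep_def
proof
  fix k assume *: "l \<in> C" "j \<in> C" "k \<in> C"
  have "(\<Sum>i\<in>C. cc (munit l j i k) * c N i) = (if j = k then c N l else 0)" for N
  proof -
    have "(\<Sum>i\<in>C. cc (munit l j i k) * c N i) = (\<Sum>i\<in>C. if i = l then (if j = k then c N l else 0) else 0)"
      by (intro sum.cong) (auto simp: munit_def)
    then show ?thesis using finC * by simp
  qed
  then show "(\<lambda>N. x l j * c N k - (\<Sum>i\<in>C. cc (munit l j i k) * c N i)) \<longlonglongrightarrow> 0"
    using x_c[OF *] by simp
qed

text \<open>Multiplying by \<open>x k l\<close> isolates one entry: \<open>x k l * b\<close> maps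
  \<open>c k\<close> asymptotically to \<open>X l k\<close> times \<open>c k\<close>. The lower
  bound on \<open>c k\<close> allows the error to be divided out. Uniqueness and continuity of the
  matrix both follow from this.\<close>

lemma rep_bound:
  assumes "rep b X" and kl: "k \<in> C" "l \<in> C"
  shows "cmod (X l k) \<le> norm (x k l) * norm b"
proof -
  have r: "rep (x k l * b) (\<lambda>i j. \<Sum>q\<in>C. munit k l i q * X q j)"
    by (rule rep_mult[OF rep_x[OF kl] assms(1)])
  have m: "(\<Sum>q\<in>C. munit k l i q * X q k) = (if i = k then X l k else 0)" for i
  proof -
    have "(\<Sum>q\<in>C. munit k l i q * X q k) = (\<Sum>q\<in>C. if q = l then (if i = k then X l k else 0) else 0)"
      by (intro sum.cong) (auto simp: munit_def)
    then show ?thesis using finC kl by simp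
  qed
  have s: "(\<Sum>i\<in>C. cc (\<Sum>q\<in>C. munit k l i q * X q k) * c N i) = cc (X l k) * c N k" for N
  proof -
    have "(\<Sum>i\<in>C. cc (\<Sum>q\<in>C. munit k l i q * X q k) * c N i) = (\<Sum>i\<in>C. if i = k then cc (X l k) * c N k else 0)"
      unfolding m by (intro sum.cong) auto
    then show ?thesis using finC kl by simp
  qed
  define e where "e N = norm (x k l * b * c N k - cc (X l k) * c N k)" for N
  have "(\<lambda>N. x k l * b * c N k - cc (X l k) * c N k) \<longlonglongrightarrow> 0"
    using r kl unfolding rep_def s[symmetric] by blast
  then have e: "e \<longlonglongrightarrow> 0" unfolding e_def by (rule tendsto_norm_zero)
  have "eventually (\<lambda>N. cmod (X l k) \<le> norm (x k l) * norm b + e N / \<delta> k) sequentially"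
    using c_ge(2)[OF kl(1)]
  proof eventually_elim
    case (elim N)
    have d: "\<delta> k > 0" by (rule c_ge(1)[OF kl(1)])
    have "cmod (X l k) * norm (c N k) = norm (cc (X l k) * c N k)" by (simp add: norm_cc_mult)
    also have "\<dots> \<le> norm (x k l * b * c N k) + e N"
      unfolding e_def by (metis norm_triangle_sub norm_minus_commute)
    also have "norm (x k l * b * c N k) \<le> norm (x k l) * norm b * norm (c N k)"
      by (rule order_trans[OF norm_mult_ineq]) (intro mult_right_mono norm_mult_ineq norm_ge_zero)
    also have "e N \<le> e N / \<delta> k * norm (c N k)"
      using mult_left_mono[OF elim, of "e N"] d by (simp add: pos_le_divide_eq e_def)
    finally have "cmod (X l k) * norm (c N k) \<le> (norm (x k l) * norm b + e N / \<delta> k) * norm (c N k)"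
      by (simp add: distrib_right)
    moreover have "norm (c N k) > 0" using elim d by linarith
    ultimately show ?case by (simp only: mult_le_cancel_right_pos)
  qed
  moreover have "(\<lambda>N. norm (x k l) * norm b + e N / \<delta> k) \<longlonglongrightarrow> norm (x k l) * norm b + 0 / \<delta> k"
    using c_ge(1)[OF kl(1)] by (intro tendsto_intros e) auto
  ultimately have "cmod (X l k) \<le> norm (x k l) * norm b + 0 / \<delta> k"
    by (intro tendsto_lowerbound[where F = sequentially]) auto
  then show ?thesis by simp
qed

lemma rep_diff: "rep b X \<Longrightarrow> rep d Z \<Longrightarrow> rep (b - d) (\<lambda>i j. X i j - Z i j)"
proof -
  assume "rep b X" "rep d Z"
  moreover have "cc (-1) * d = - d" using scaleR_cc[of "-1" d] by simp
  ultimately show ?thesis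
    using rep_add[OF _ rep_scale[of d Z "-1"], of b X] by simp
qed

lemma rep_unique:
  assumes "rep b X" "rep b Z" "l \<in> C" "k \<in> C"
  shows "X l k = Z l k"
  using rep_bound[OF rep_diff[OF assms(1,2)] assms(4,3)] by simp

lemma rep_convergent:
  assumes "\<And>n. rep (b n) (X n)" "b \<longlonglongrightarrow> d" "l \<in> C" "k \<in> C"
  shows "convergent (\<lambda>n. X n l k)"
proof (rule Cauchy_convergent)
  have "Cauchy b" using assms(2) by (rule LIMSEQ_imp_Cauchy)
  define D where "D = norm (x k l) + 1"
  have D: "D > 0" by (simp add: D_def add_nonneg_pos)
  show "Cauchy (\<lambda>n. X n l k)"
    unfolding Cauchy_iff
  proof (intro allI impI)
    fix e :: real assume "e > 0"
    then obtain M where M: "\<forall>n\<ge>M. \<forall>n'\<ge>M. norm (b n - b n') < e / D"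
      using \<open>Cauchy b\<close> D unfolding Cauchy_iff by (meson divide_pos_pos)
    have "cmod (X n l k - X n' l k) < e" if "n \<ge> M" "n' \<ge> M" for n n'
    proof -
      have "cmod (X n l k - X n' l k) \<le> norm (x k l) * norm (b n - b n')"
        using rep_bound[OF rep_diff[OF assms(1)[of n] assms(1)[of n']] assms(4,3)] by simp
      also have "\<dots> \<le> D * norm (b n - b n')" by (intro mult_right_mono) (auto simp: D_def)
      also have "\<dots> < e"
      proof -
        have "norm (b n - b n') < e / D" using M that by blast
        then show ?thesis using D by (simp add: field_simps)
      qed
      finally show ?thesis .
    qed
    then show "\<exists>M. \<forall>n\<ge>M. \<forall>n'\<ge>M. norm (X n l k - X n' l k) < e" by blast
  qed
qed

lemma rep_limit:
  assumes b: "\<And>n. rep (b n) (X n)" "b \<longlonglongrightarrow> d"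
    and X: "\<And>l k. l \<in> C \<Longrightarrow> k \<in> C \<Longrightarrow> (\<lambda>n. X n l k) \<longlonglongrightarrow> Z l k"
  shows "rep d Z"
  unfolding rep_def
proof
  fix k assume k: "k \<in> C"
  show "(\<lambda>N. d * c N k - (\<Sum>l\<in>C. cc (Z l k) * c N l)) \<longlonglongrightarrow> 0"
  proof (rule LIMSEQ_I)
    fix e :: real assume e: "e > 0"
    have "(\<lambda>n. norm (b n - d) + (\<Sum>l\<in>C. cmod (X n l k - Z l k))) \<longlonglongrightarrow> 0 + (\<Sum>l\<in>C. 0)"
      using b(2) X k by (intro tendsto_add tendsto_sum tendsto_norm_zero LIM_zero) auto
    then have "eventually (\<lambda>n. norm (b n - d) + (\<Sum>l\<in>C. cmod (X n l k - Z l k)) < e / 2) sequentially"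
      using e by (intro order_tendstoD(2)) auto
    \<comment> \<open>First \<open>n\<close> is fixed, with an error uniform in \<open>N\<close>
      because the vectors are bounded; only then is \<open>N\<close> taken large for this one
      \<open>n\<close>.\<close>
    then obtain n where n: "norm (b n - d) + (\<Sum>l\<in>C. cmod (X n l k - Z l k)) < e / 2"
      by (auto simp: eventually_sequentially)
    obtain M where M: "\<And>N. N \<ge> M \<Longrightarrow> norm (b n * c N k - (\<Sum>l\<in>C. cc (X n l k) * c N l) - 0) < e / 2"
      using b(1)[of n] k e unfolding rep_def by (meson LIMSEQ_D half_gt_zero)
    have "norm (d * c N k - (\<Sum>l\<in>C. cc (Z l k) * c N l) - 0) < e" if "N \<ge> M" for N
    proof -
      have ccd: "cc (X n l k - Z l k) = (cc (X n l k) - cc (Z l k) :: 'a)" for l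
        using cc_add[of "X n l k - Z l k" "Z l k", where 'a = 'a] by (simp add: algebra_simps)
      define e1 where "e1 = b n * c N k - (\<Sum>l\<in>C. cc (X n l k) * c N l)"
      define e2 where "e2 = (b n - d) * c N k"
      define e3 where "e3 = (\<Sum>l\<in>C. cc (X n l k - Z l k) * c N l)"
      have eq: "d * c N k - (\<Sum>l\<in>C. cc (Z l k) * c N l) = e1 - e2 + e3"
        unfolding e1_def e2_def e3_def ccd by (simp add: left_diff_distrib sum_subtractf)
      have "norm (e1 - e2 + e3) \<le> norm e1 + norm e2 + norm e3"
        using norm_triangle_ineq[of "e1 - e2" e3] norm_triangle_ineq4[of e1 e2] by linarith
      moreover have "norm e2 \<le> norm (b n - d)"
        unfolding e2_def by (rule order_trans[OF norm_mult_ineq mult_left_le[OF c_le[OF k] norm_ge_zero]])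
      moreover have "norm e3 \<le> (\<Sum>l\<in>C. cmod (X n l k - Z l k))"
        unfolding e3_def
      proof (rule order_trans[OF norm_sum], rule sum_mono)
        fix l assume "l \<in> C"
        then show "norm (cc (X n l k - Z l k) * c N l) \<le> cmod (X n l k - Z l k)"
          unfolding norm_cc_mult using c_le[of l N] by (intro mult_left_le) auto
      qed
      moreover have "norm e1 < e / 2" using M[OF that] by (simp add: e1_def)
      ultimately show ?thesis using n unfolding eq by simp
    qed
    then show "\<exists>M. \<forall>N\<ge>M. norm (d * c N k - (\<Sum>l\<in>C. cc (Z l k) * c N l) - 0) < e" by blast
  qed
qed

text \<open>Asymptotic invariance of the vectors under \<open>b\<close> says nothing about
  \<open>star b\<close>, so both are demanded; this makes the represented elements closed under
  \<open>star\<close>.\<close>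

definition rep2 :: "'a \<Rightarrow> (nat \<Rightarrow> nat \<Rightarrow> complex) \<Rightarrow> bool" where
  "rep2 b X \<longleftrightarrow> rep b X \<and> rep (star b) (\<lambda>i j. cnj (X j i))"

lemma rep2_add: "rep2 b X \<Longrightarrow> rep2 d Z \<Longrightarrow> rep2 (b + d) (\<lambda>i j. X i j + Z i j)"
  using rep_add[of b X d Z] rep_add[of "star b" "\<lambda>i j. cnj (X j i)" "star d" "\<lambda>i j. cnj (Z j i)"]
  by (simp add: rep2_def star_add)

lemma rep2_scale: "rep2 b X \<Longrightarrow> rep2 (cc z * b) (\<lambda>i j. z * X i j)"
  using rep_scale[of b X z] rep_scale[of "star b" "\<lambda>i j. cnj (X j i)" "cnj z"]
  by (simp add: rep2_def star_mult star_cc cc_commute[of "cnj z" "star b"])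

lemma rep2_zero: "rep2 0 (\<lambda>i j. 0)"
  by (simp add: rep2_def rep_zero)

lemma rep2_sum: "(\<And>i. i \<in> A \<Longrightarrow> rep2 (b i) (X i)) \<Longrightarrow> rep2 (sum b A) (\<lambda>k l. \<Sum>i\<in>A. X i k l)"
  by (induction A rule: infinite_finite_induct) (simp_all add: rep2_zero rep2_add)

lemma rep2_star: "rep2 b X \<Longrightarrow> rep2 (star b) (\<lambda>i j. cnj (X j i))"
  by (simp add: rep2_def)

lemma rep2_mult: "rep2 b X \<Longrightarrow> rep2 d Z \<Longrightarrow> rep2 (b * d) (\<lambda>i j. \<Sum>l\<in>C. X i l * Z l j)"
  using rep_mult[of b X d Z] rep_mult[of "star d" "\<lambda>i j. cnj (Z j i)" "star b" "\<lambda>i j. cnj (X j i)"]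
  by (simp add: rep2_def star_mult mult.commute)

lemma rep2_limit:
  assumes "\<And>n. rep2 (b n) (X n)" "b \<longlonglongrightarrow> d"
  shows "\<exists>Z. rep2 d Z"
proof -
  define Z where "Z l k = lim (\<lambda>n. X n l k)" for l k
  have Z: "(\<lambda>n. X n l k) \<longlonglongrightarrow> Z l k" if "l \<in> C" "k \<in> C" for l k
    unfolding Z_def using rep_convergent[of b X d l k] assms that
    by (simp add: rep2_def convergent_LIMSEQ_iff)
  have "rep d Z" by (rule rep_limit[of b X]) (use assms Z in \<open>auto simp: rep2_def\<close>)
  moreover have "rep (star d) (\<lambda>i j. cnj (Z j i))"
    by (rule rep_limit[of "\<lambda>n. star (b n)" "\<lambda>n i j. cnj (X n j i)"])
      (use assms Z in \<open>auto simp: rep2_def intro: tendsto_cnj bounded_linear.tendsto[OF bounded_linear_star]\<close>)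
  ultimately show ?thesis by (auto simp: rep2_def)
qed

end

section \<open>The universal property\<close>

locale dual_extension = unital_cstar B
  for B :: "('b, 'k) cstar_alg_scheme" +
  fixes n :: nat and R :: "(nat \<times> nat) set" and \<kappa> :: "(nat \<Rightarrow> nat \<Rightarrow> complex) \<Rightarrow> 'b"
  assumes tol: "tol_rel n R" and ch: "chordal n R" and cext: "cstar_extension n R B \<kappa>"
begin

lemma finR: "finite R"
  using tol finite_subset[of R "{1..n} \<times> {1..n}"] by (simp add: tol_rel_def)

lemma R_range: "(i, j) \<in> R \<Longrightarrow> i \<in> {1..n} \<and> j \<in> {1..n}"
  using tol by (auto simp: tol_rel_def)

lemma kappa_rules:
  "x \<in> ER n R \<Longrightarrow> \<kappa> x \<in> carrier B"
  "x \<in> ER n R \<Longrightarrow> y \<in> ER n R \<Longrightarrow> \<kappa> (\<lambda>i j. x i j + y i j) = ca_add B (\<kappa> x) (\<kappa> y)"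
  "x \<in> ER n R \<Longrightarrow> \<kappa> (\<lambda>i j. z * x i j) = ca_smult B z (\<kappa> x)"
  "\<kappa> (idX n) = ca_one B"
  using cext unfolding cstar_extension_def complete_order_embedding_def by auto

lemma kappa_pos_iff:
  "(\<And>a b. a < m \<Longrightarrow> b < m \<Longrightarrow> M a b \<in> ER n R) \<Longrightarrow>
    ERd_pos n R m M \<longleftrightarrow> mat_pos B m (\<lambda>a b. \<kappa> (M a b))"
  using cext unfolding cstar_extension_def complete_order_embedding_def by simp

lemma kappa_gen: "cstar_gen B (\<kappa> ` ER n R) = carrier B"
  using cext unfolding cstar_extension_def by simp

lemma ER_closed:
  "(\<lambda>i j. 0) \<in> ER n R" "idX n \<in> ER n R"
  "x \<in> ER n R \<Longrightarrow> y \<in> ER n R \<Longrightarrow> (\<lambda>i j. x i j + y i j) \<in> ER n R"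
  "x \<in> ER n R \<Longrightarrow> (\<lambda>i j. z * x i j) \<in> ER n R"
  using tol by (auto simp: ER_def idX_def tol_rel_def)

section \<open>Images of the matrix units in the extension\<close>

definition K :: "(nat \<Rightarrow> nat \<Rightarrow> complex) \<Rightarrow> 'b fam" where
  "K x = emb B (\<kappa> x)"

lemma K_add: "x \<in> ER n R \<Longrightarrow> y \<in> ER n R \<Longrightarrow> K (\<lambda>i j. x i j + y i j) = K x + K y"
  by (simp add: K_def kappa_rules emb_add)

lemma K_scale: "x \<in> ER n R \<Longrightarrow> K (\<lambda>i j. z * x i j) = cc z * K x"
  by (simp add: K_def kappa_rules emb_smult)

lemma K_zero: "K (\<lambda>i j. 0) = 0"
  using K_scale[OF ER_closed(1), of 0] by simp

lemma K_sum:
  assumes "finite A" "\<And>p. p \<in> A \<Longrightarrow> f p \<in> ER n R"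
  shows "K (\<lambda>i j. \<Sum>p\<in>A. f p i j) = (\<Sum>p\<in>A. K (f p)) \<and> (\<lambda>i j. \<Sum>p\<in>A. f p i j) \<in> ER n R"
  using assms by (induction A rule: finite_induct) (simp_all add: K_zero K_add ER_closed)

definition Mu :: "nat \<Rightarrow> nat \<Rightarrow> nat \<Rightarrow> nat \<Rightarrow> complex" where
  "Mu i j = (if (i, j) \<in> R then munit i j else (\<lambda>k l. 0))"

definition X :: "nat \<Rightarrow> nat \<Rightarrow> 'b fam" where
  "X i j = K (Mu i j)"

lemma Mu_ER: "Mu i j \<in> ER n R"
  by (auto simp: Mu_def munit_ER ER_closed)

lemma X_outside: "(i, j) \<notin> R \<Longrightarrow> X i j = 0"
  by (simp add: X_def Mu_def K_zero)

lemma ER_decomp: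
  assumes "x \<in> ER n R"
  shows "x = (\<lambda>i j. \<Sum>p\<in>R. x (fst p) (snd p) * munit (fst p) (snd p) i j)"
proof (intro ext)
  fix i j
  have "(\<Sum>p\<in>R. x (fst p) (snd p) * munit (fst p) (snd p) i j) = (\<Sum>p\<in>R. if p = (i, j) then x i j else 0)"
    by (intro sum.cong) (auto simp: munit_def)
  also have "\<dots> = x i j" using finR assms by (auto simp: ER_def)
  finally show "x i j = (\<Sum>p\<in>R. x (fst p) (snd p) * munit (fst p) (snd p) i j)" by simp
qed

lemma K_decomp:
  assumes "x \<in> ER n R"
  shows "K x = (\<Sum>p\<in>R. cc (x (fst p) (snd p)) * X (fst p) (snd p))"
proof -
  have m: "munit (fst p) (snd p) \<in> ER n R" if "p \<in> R" for p using that by (simp add: munit_ER)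
  have "K x = K (\<lambda>i j. \<Sum>p\<in>R. x (fst p) (snd p) * munit (fst p) (snd p) i j)"
    using ER_decomp[OF assms] by simp
  also have "\<dots> = (\<Sum>p\<in>R. K (\<lambda>i j. x (fst p) (snd p) * munit (fst p) (snd p) i j))"
    using K_sum[OF finR, of "\<lambda>p i j. x (fst p) (snd p) * munit (fst p) (snd p) i j"] m ER_closed(4) by simp
  also have "\<dots> = (\<Sum>p\<in>R. cc (x (fst p) (snd p)) * X (fst p) (snd p))"
    by (intro sum.cong refl) (simp add: K_scale m X_def Mu_def)
  finally show ?thesis .
qed

text \<open>Vertices start at 1 but matrix indices at 0. Matrices of size \<open>Suc n\<close> let a
  vertex be its own index, and the extra index 0 contributes \<open>X 0 0 = 0\<close>.\<close>

lemma K_idX: "K (idX n) = (\<Sum>k<Suc n. X k k)"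
proof -
  have "K (idX n) = (\<Sum>p\<in>R. cc (idX n (fst p) (snd p)) * X (fst p) (snd p))"
    by (rule K_decomp[OF ER_closed(2)])
  also have "\<dots> = (\<Sum>p\<in>(\<lambda>k. (k, k)) ` {1..n}. X (fst p) (snd p))"
    using finR tol
    by (intro sum.mono_neutral_cong_right) (auto simp: idX_def tol_rel_def)
  also have "\<dots> = (\<Sum>k\<in>{1..n}. X k k)"
    by (subst sum.reindex) (auto simp: inj_on_def)
  also have "\<dots> = (\<Sum>k<Suc n. X k k)"
    using X_outside R_range by (intro sum.mono_neutral_left) force+
  finally show ?thesis .
qed

text \<open>The matrix with entries \<open>e\<^sub>i\<^sub>j\<close> at the pairs of \<open>R\<close> is positive over the dual system, because
  adding the missing matrix units completes it to a multiple of a projection.\<close>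

lemma X_factorization:
  obtains Y :: "nat \<Rightarrow> nat \<Rightarrow> 'b fam" where
    "\<And>i j. i < Suc n \<Longrightarrow> j < Suc n \<Longrightarrow> X i j = (\<Sum>r<Suc n. star (Y r i) * Y r j)"
proof -
  define N where "N a b = (if (a, b) \<in> {1..n} \<times> {1..n} - R then munit a b else (\<lambda>k l. 0))" for a b
  \<comment> \<open>The rank-one matrix of the vector that is 1 at the pairs \<open>(a, a)\<close>
    and 0 elsewhere; its block \<open>(a, b)\<close> is the matrix unit at \<open>(a, b)\<close>,
    and zero when an index is 0.\<close>
  have "psd ({..<Suc n} \<times> {1..n}) (\<lambda>p q. cnj (if fst p = snd p then 1 else 0) * (if fst q = snd q then 1 else 0))"
    by (rule psd_rank_one)
  then have "psd_block n (Suc n) (\<lambda>a b i j. Mu a b i j + N a b i j)"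
    unfolding psd_block_iff
    by (rule psd_cong[THEN iffD1, rotated]) (use R_range in \<open>auto simp: Mu_def N_def munit_def\<close>)
  moreover have "N a b \<in> ER_perp n R" for a b
    by (auto simp: N_def ER_perp_def munit_def)
  ultimately have "ERd_pos n R (Suc n) Mu"
    unfolding ERd_pos_def using Mu_ER by blast
  then have "mat_pos B (Suc n) (\<lambda>a b. \<kappa> (Mu a b))"
    using kappa_pos_iff[of "Suc n" Mu] Mu_ER by blast
  then obtain Y where Y: "\<forall>a<Suc n. \<forall>b<Suc n. Y a b \<in> carrier B"
    "\<forall>a<Suc n. \<forall>b<Suc n. \<kappa> (Mu a b) = ca_sum B (\<lambda>k. ca_mul B (ca_star B (Y k a)) (Y k b)) (Suc n)"
    unfolding mat_pos_def by blast
  show ?thesis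
  proof (rule that[of "\<lambda>r i. emb B (Y r i)"])
    fix i j assume ij: "i < Suc n" "j < Suc n"
    have "X i j = (\<Sum>k<Suc n. emb B (ca_mul B (ca_star B (Y k i)) (Y k j)))"
      unfolding X_def K_def Y(2)[rule_format, OF ij] by (rule emb_ca_sum) (use Y(1) ij in auto)
    also have "\<dots> = (\<Sum>r<Suc n. star (emb B (Y r i)) * emb B (Y r j))"
      by (intro sum.cong refl) (use Y(1) ij in \<open>simp add: emb_mul emb_star\<close>)
    finally show "X i j = (\<Sum>r<Suc n. star (emb B (Y r i)) * emb B (Y r j))" .
  qed
qed

text \<open>Such a factorization would make \<open>t - (X i j) / card C\<close> positive over
  \<open>B\<close>, hence over the dual system because \<open>\<kappa>\<close> reflects positivity,
  hence on the block of \<open>C\<close>. But at the vector with entries 1 at the pairs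
  \<open>(a, a)\<close>, \<open>a \<in> C\<close>, the form has the negative value
  \<open>card C * (t - 1)\<close>.\<close>

lemma no_matrix_square:
  assumes C: "C \<in> max_cliques n R" "C \<noteq> {}" and t: "0 < t" "t < 1"
  shows "\<not> (\<forall>i<Suc n. \<forall>j<Suc n. (if i = j then scaleR t 1 else 0) -
      (if i \<in> C \<and> j \<in> C then scaleR (1 / real (card C)) (X i j) else 0) =
      (\<Sum>r<Suc n. star (S r i) * S r j))"
proof
  assume S: "\<forall>i<Suc n. \<forall>j<Suc n. (if i = j then scaleR t 1 else 0) -
      (if i \<in> C \<and> j \<in> C then scaleR (1 / real (card C)) (X i j) else 0) =
      (\<Sum>r<Suc n. star (S r i) * S r j)"
  have finC: "finite C" using finite_max_clique C by blast
  define M where "M a b = (\<lambda>i j. (if a = b then complex_of_real t else 0) * idX n i j +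
    (if a \<in> C \<and> b \<in> C then - complex_of_real (1 / real (card C)) else 0) * Mu a b i j)" for a b
  have ME: "M a b \<in> ER n R" for a b
    unfolding M_def by (intro ER_closed Mu_ER)
  have M: "\<kappa> (M a b) = ca_add B (ca_smult B (if a = b then complex_of_real t else 0) (ca_one B))
      (ca_smult B (if a \<in> C \<and> b \<in> C then - complex_of_real (1 / real (card C)) else 0) (\<kappa> (Mu a b)))" for a b
    unfolding M_def by (simp add: kappa_rules ER_closed Mu_ER)
  have evX: "ev B (X a b) = \<kappa> (Mu a b)" for a b
    by (simp add: X_def K_def kappa_rules Mu_ER)
  have carr: "\<kappa> (Mu a b) \<in> carrier B" for a b by (simp add: kappa_rules Mu_ER)
  have "\<kappa> (M a b) = ca_sum B (\<lambda>k. ca_mul B (ca_star B (ev B (S k a))) (ev B (S k b))) (Suc n)"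
    if ab: "a < Suc n" "b < Suc n" for a b
  proof -
    \<comment> \<open>\<open>ev B\<close> carries the equation from the product back to
      \<open>B\<close> and sends the 1 of the product to the unit of \<open>B\<close>.\<close>
    have "ev B ((if a = b then scaleR t 1 else 0) -
      (if a \<in> C \<and> b \<in> C then scaleR (1 / real (card C)) (X a b) else 0)) = \<kappa> (M a b)"
    proof -
      have "ev B (if a = b then scaleR t 1 else 0) = ca_smult B (if a = b then complex_of_real t else 0) (ca_one B)"
        by (simp add: ev_simps smult_0)
      moreover have "ca_smult B (-1) (ev B (if a \<in> C \<and> b \<in> C then scaleR (1 / real (card C)) (X a b) else 0)) =
          ca_smult B (if a \<in> C \<and> b \<in> C then - complex_of_real (1 / real (card C)) else 0) (\<kappa> (Mu a b))"
        using carr[of a b] vector_space_rules(6)[of "\<kappa> (Mu a b)" "-1" "complex_of_real (1 / real (card C))"]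
        by (simp add: ev_simps evX smult_0 smult_zero)
      ultimately show ?thesis unfolding ev_simps(5) ca_sub_def M by simp
    qed
    moreover have "ev B (\<Sum>r<Suc n. star (S r a) * S r b) =
        ca_sum B (\<lambda>k. ca_mul B (ca_star B (ev B (S k a))) (ev B (S k b))) (Suc n)"
      by (simp only: ev_sum ev_simps)
    ultimately show ?thesis using S[rule_format, OF ab] by (simp only:)
  qed
  then have "mat_pos B (Suc n) (\<lambda>a b. \<kappa> (M a b))"
    unfolding mat_pos_def
    by (intro conjI exI[of _ "\<lambda>k a. ev B (S k a)"] allI impI kappa_rules(1)[OF ME] ev_simps(1))
  then have "ERd_pos n R (Suc n) M"
    using kappa_pos_iff[of "Suc n" M] ME by blast
  then have psdC: "psd ({..<Suc n} \<times> C) (\<lambda>p q. M (fst p) (fst q) (snd p) (snd q))"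
    using ERd_pos_iff[OF tol ch, of "Suc n" M] ME C(1) by blast
  have Cn: "a < Suc n" "a \<in> {1..n}" if "a \<in> C" for a
    using max_cliques_subset[OF C(1)] that by auto
  have "psd ((\<lambda>a. (a, a)) ` C) (\<lambda>p q. M (fst p) (fst q) (snd p) (snd q))"
    by (rule psd_subset[OF psdC]) (use Cn finC in auto)
  from psdD[OF this, of "\<lambda>_. 1"]
  have "0 \<le> (\<Sum>p\<in>(\<lambda>a. (a, a)) ` C. \<Sum>q\<in>(\<lambda>a. (a, a)) ` C. M (fst p) (fst q) (snd p) (snd q))" by simp
  also have "\<dots> = (\<Sum>a\<in>C. \<Sum>b\<in>C. M a b a b)"
    by (simp add: sum.reindex inj_on_def)
  also have "\<dots> = (\<Sum>a\<in>C. \<Sum>b\<in>C. (if b = a then complex_of_real t else 0) - complex_of_real (1 / real (card C)))"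
    by (intro sum.cong refl)
      (use Cn max_clique_rel[OF tol C(1)] in \<open>auto simp: M_def Mu_def munit_def idX_def\<close>)
  also have "\<dots> = complex_of_real (real (card C) * (t - 1))"
    using finC C(2) by (simp add: sum_subtractf algebra_simps)
  finally have "0 \<le> real (card C) * (t - 1)"
    by (simp add: less_eq_complex_def)
  then have "0 \<le> t - 1"
    using finC C(2) by (simp add: zero_le_mult_iff card_gt_0_iff)
  then show False using t by simp
qed

lemma clique_approx_vectors:
  assumes C: "C \<in> max_cliques n R" "C \<noteq> {}"
  obtains c \<delta> where "approx_vectors C c X \<delta>"
    "\<And>l j k. k \<in> C \<Longrightarrow> (l, j) \<in> R \<Longrightarrow> (\<lambda>N. X l j * c N k - (if j = k \<and> l \<in> C then c N l else 0)) \<longlonglongrightarrow> 0"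
proof -
  have finC: "finite C" using finite_max_clique C by blast
  have Cn: "C \<subseteq> {..<Suc n}" using max_cliques_subset[OF C(1)] by auto
  obtain Y :: "nat \<Rightarrow> nat \<Rightarrow> 'b fam" where
    Y: "\<And>i j. i < Suc n \<Longrightarrow> j < Suc n \<Longrightarrow> X i j = (\<Sum>r<Suc n. star (Y r i) * Y r j)"
    using X_factorization by metis
  \<comment> \<open>The unit of \<open>B\<close> is only a projection in the product, and
    \<open>g\<close> is the complementary projection.\<close>
  define g where "g = 1 - K (idX n)"
  have unit: "1 = (\<Sum>k<Suc n. X k k) + star g * g"
  proof -
    have "K (idX n) * K (idX n) = K (idX n)" "star (K (idX n)) = K (idX n)"
    proof -
      show "K (idX n) * K (idX n) = K (idX n)"
        using emb_mul[of "ca_one B" "ca_one B"] mul_rules(6)[of "ca_one B"] by (simp add: K_def kappa_rules)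
      have "ca_star B (ca_one B) = ca_one B"
        using star_rules(3)[of "ca_star B (ca_one B)" "ca_one B"] by (simp add: star_rules(1) mul_rules(6,7))
      then show "star (K (idX n)) = K (idX n)"
        using emb_star[of "ca_one B"] by (simp add: K_def kappa_rules)
    qed
    then have "star g * g = 1 - K (idX n)" by (simp add: g_def star_diff algebra_simps)
    then show ?thesis by (simp add: K_idX del: sum.lessThan_Suc)
  qed
  obtain c :: "nat \<Rightarrow> nat \<Rightarrow> 'b fam" where
    c1: "\<And>N i. i < Suc n \<Longrightarrow> norm (c N i) \<le> 1" and
    c2: "\<And>N. \<exists>i\<in>C. norm (c N i) > 1 / (2 * real (Suc n))" and
    c3: "\<And>i. i \<in> C \<Longrightarrow> (\<lambda>N. g * c N i) \<longlonglongrightarrow> 0" and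
    c4: "\<And>i k r. i \<in> C \<Longrightarrow> k < Suc n \<Longrightarrow> k \<noteq> i \<Longrightarrow> r < Suc n \<Longrightarrow> (\<lambda>N. Y r k * c N i) \<longlonglongrightarrow> 0" and
    c5: "\<And>i j r. i \<in> C \<Longrightarrow> j \<in> C \<Longrightarrow> r < Suc n \<Longrightarrow> (\<lambda>N. Y r i * c N i - Y r j * c N j) \<longlonglongrightarrow> 0"
    using approximate_eigenvectors[OF Cn C(2) Y unit refl no_matrix_square[OF C]] by blast
  have off: "(\<lambda>N. X l j * c N k) \<longlonglongrightarrow> 0" if "l < Suc n" "j < Suc n" "k \<in> C" "j \<noteq> k" for l j k
  proof -
    have "(\<lambda>N. \<Sum>r<Suc n. star (Y r l) * (Y r j * c N k)) \<longlonglongrightarrow> (\<Sum>r<Suc n. 0)"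
      using that by (intro tendsto_sum tendsto_mult_left_null c4) auto
    moreover have "X l j * c N k = (\<Sum>r<Suc n. star (Y r l) * (Y r j * c N k))" for N
      using that by (simp only: Y sum_distrib_right mult.assoc)
    ultimately show ?thesis by simp
  qed
  have shift: "(\<lambda>N. X l k * c N k - X l k' * c N k') \<longlonglongrightarrow> 0" if "l < Suc n" "k \<in> C" "k' \<in> C" for l k k'
  proof -
    have kk: "k < Suc n" "k' < Suc n" using that Cn by auto
    have "(\<lambda>N. \<Sum>r<Suc n. star (Y r l) * (Y r k * c N k - Y r k' * c N k')) \<longlonglongrightarrow> (\<Sum>r<Suc n. 0)"
      using that by (intro tendsto_sum tendsto_mult_left_null c5) auto
    moreover have "X l k * c N k - X l k' * c N k' =
        (\<Sum>r<Suc n. star (Y r l) * (Y r k * c N k - Y r k' * c N k'))" for N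
      using that kk by (simp only: Y sum_distrib_right mult.assoc right_diff_distrib sum_subtractf)
    ultimately show ?thesis by simp
  qed
  \<comment> \<open>Apply the decomposition of 1 to \<open>c N l\<close>: every summand except
    \<open>X l l * c N l\<close> tends to 0.\<close>
  have diag: "(\<lambda>N. X l l * c N l - c N l) \<longlonglongrightarrow> 0" if l: "l \<in> C" for l
  proof -
    have ll: "l < Suc n" using l Cn by auto
    have "(\<lambda>N. - (star g * (g * c N l)) - (\<Sum>k\<in>{..<Suc n} - {l}. X k k * c N l)) \<longlonglongrightarrow>
        - 0 - (\<Sum>k\<in>{..<Suc n} - {l}. 0)"
      using l by (intro tendsto_diff tendsto_minus tendsto_sum tendsto_mult_left_null c3 off) auto
    moreover have "X l l * c N l - c N l = - (star g * (g * c N l)) - (\<Sum>k\<in>{..<Suc n} - {l}. X k k * c N l)" for N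
    proof -
      have "c N l = ((\<Sum>k<Suc n. X k k) + star g * g) * c N l"
        using unit by (metis mult_1_left)
      also have "\<dots> = (\<Sum>k<Suc n. X k k * c N l) + star g * (g * c N l)"
        by (simp only: distrib_right sum_distrib_right mult.assoc)
      also have "(\<Sum>k<Suc n. X k k * c N l) = X l l * c N l + (\<Sum>k\<in>{..<Suc n} - {l}. X k k * c N l)"
        using ll by (intro sum.remove) auto
      finally show ?thesis by (simp add: algebra_simps)
    qed
    ultimately show ?thesis by simp
  qed
  have inside: "(\<lambda>N. X l k * c N k - c N l) \<longlonglongrightarrow> 0" if "l \<in> C" "k \<in> C" for l k
  proof -
    have "l < Suc n" using that Cn by auto
    from tendsto_add[OF shift[OF this that(2,1)] diag[OF that(1)]] show ?thesis by simp
  qed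
  have all: "(\<lambda>N. X l j * c N k - (if j = k \<and> l \<in> C then c N l else 0)) \<longlonglongrightarrow> 0"
    if k: "k \<in> C" and lj: "(l, j) \<in> R" for l j k
  proof -
    have ln: "l < Suc n" "j < Suc n" "l \<in> {1..n}" using R_range[OF lj] by auto
    show ?thesis
    proof (cases "j = k")
      case False
      then show ?thesis using off[OF ln(1,2) k] by simp
    next
      case True
      show ?thesis
      proof (cases "l \<in> C")
        case True
        then show ?thesis using inside[OF True k] \<open>j = k\<close> by simp
      next
        case False
        have "\<not> is_clique n R (insert l C)"
          using C(1) False by (auto simp: max_cliques_def)
        moreover have "is_clique n R C" using C(1) by (simp add: max_cliques_def)
        ultimately obtain k' where k': "k' \<in> C" "\<not> adj R l k'"
          using ln(3) adj_sym[OF tol] by (auto simp: is_clique_def)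
        have "(l, k') \<notin> R" using k' False by (auto simp: adj_def)
        then have "X l k' = 0" by (rule X_outside)
        then show ?thesis using shift[OF ln(1) k k'(1)] \<open>j = k\<close> False by simp
      qed
    qed
  qed
  \<comment> \<open>For each \<open>N\<close> some vector is large, but which one may depend on
    \<open>N\<close>. As \<open>X i k * c N k\<close> approximates \<open>c N i\<close> for all
    \<open>i \<in> C\<close>, the bound passes to the fixed \<open>k\<close>.\<close>
  have low: "\<exists>d>0. eventually (\<lambda>N. norm (c N k) \<ge> d) sequentially" if k: "k \<in> C" for k
  proof -
    \<comment> \<open>Half of the guaranteed bound; the other half absorbs the error
      \<open>e N\<close>.\<close>
    define u where "u = 1 / (4 * real (Suc n))"
    have u: "u > 0" "1 / (2 * real (Suc n)) = u + u" by (auto simp: u_def field_simps)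
    define D where "D = (\<Sum>i\<in>C. norm (X i k)) + 1"
    have D: "D > 0" by (simp add: D_def add_nonneg_pos sum_nonneg)
    define e where "e N = (\<Sum>i\<in>C. norm (X i k * c N k - c N i))" for N
    have "e \<longlonglongrightarrow> (\<Sum>i\<in>C. 0)"
      unfolding e_def using k by (intro tendsto_sum tendsto_norm_zero inside)
    then have ev: "eventually (\<lambda>N. e N < u) sequentially"
      using u by (intro order_tendstoD(2)) auto
    have "eventually (\<lambda>N. norm (c N k) \<ge> u / D) sequentially"
      using ev
    proof eventually_elim
      case (elim N)
      obtain i where i: "i \<in> C" "norm (c N i) > 1 / (2 * real (Suc n))" using c2 by blast
      have "norm (X i k * c N k - c N i) \<le> e N"
        unfolding e_def using i(1) finC by (intro member_le_sum) auto
      moreover have "norm (c N i) \<le> norm (X i k * c N k) + norm (X i k * c N k - c N i)"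
        using norm_triangle_sub[of "c N i" "X i k * c N k"] by (simp add: norm_minus_commute)
      moreover have "norm (X i k * c N k) \<le> D * norm (c N k)"
      proof -
        have "norm (X i k) \<le> (\<Sum>i\<in>C. norm (X i k))"
          using i(1) finC by (intro member_le_sum) auto
        then have "norm (X i k) * norm (c N k) \<le> D * norm (c N k)"
          by (intro mult_right_mono) (auto simp: D_def)
        then show ?thesis using norm_mult_ineq[of "X i k" "c N k"] by linarith
      qed
      ultimately have "u \<le> D * norm (c N k)" using i(2) elim unfolding u(2) by linarith
      then show ?case using D by (simp add: pos_divide_le_eq mult.commute)
    qed
    then show ?thesis using D u by (intro exI[of _ "u / D"]) auto
  qed
  then have "\<forall>k\<in>C. \<exists>d. d > 0 \<and> eventually (\<lambda>N. norm (c N k) \<ge> d) sequentially" by blast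
  from bchoice[OF this] obtain \<delta> where \<delta>: "\<forall>k\<in>C. \<delta> k > 0 \<and> eventually (\<lambda>N. norm (c N k) \<ge> \<delta> k) sequentially"
    by blast
  have "approx_vectors C c X \<delta>"
  proof
    show "finite C" by (rule finC)
    show "norm (c N k) \<le> 1" if "k \<in> C" for N k using c1 that Cn by blast
    show "\<delta> k > 0" "eventually (\<lambda>N. norm (c N k) \<ge> \<delta> k) sequentially" if "k \<in> C" for k
      using \<delta> that by auto
    show "(\<lambda>N. X l j * c N k - (if j = k then c N l else 0)) \<longlonglongrightarrow> 0" if "l \<in> C" "j \<in> C" "k \<in> C" for l j k
      using all[OF that(3) max_clique_rel[OF tol C(1) that(1,2)]] that by simp
  qed
  then show ?thesis using that all by blast
qed

lemma star_X: "(i, j) \<in> R \<Longrightarrow> star (X i j) = X j i"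
proof -
  assume ij: "(i, j) \<in> R"
  obtain Y :: "nat \<Rightarrow> nat \<Rightarrow> 'b fam" where
    Y: "\<And>i j. i < Suc n \<Longrightarrow> j < Suc n \<Longrightarrow> X i j = (\<Sum>r<Suc n. star (Y r i) * Y r j)"
    using X_factorization by metis
  have "i < Suc n" "j < Suc n" using R_range[OF ij] by auto
  then show ?thesis by (simp only: Y star_sum star_mult star_star)
qed

text \<open>Exports only the algebraic rules of \<open>rep2\<close>, so that the vectors and their
  bounds are no longer visible.\<close>

lemma clique_representation:
  assumes C: "C \<in> max_cliques n R" "C \<noteq> {}"
  obtains rp :: "'b fam \<Rightarrow> (nat \<Rightarrow> nat \<Rightarrow> complex) \<Rightarrow> bool" where
    "\<And>b. b \<in> carrier B \<Longrightarrow> \<exists>Z. rp (emb B b) Z"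
    "\<And>x. x \<in> ER n R \<Longrightarrow> rp (K x) x"
    "\<And>b Z Z' i j. rp b Z \<Longrightarrow> rp b Z' \<Longrightarrow> i \<in> C \<Longrightarrow> j \<in> C \<Longrightarrow> Z i j = Z' i j"
    "\<And>b d Z Z'. rp b Z \<Longrightarrow> rp d Z' \<Longrightarrow> rp (b + d) (\<lambda>i j. Z i j + Z' i j)"
    "\<And>b d Z Z'. rp b Z \<Longrightarrow> rp d Z' \<Longrightarrow> rp (b * d) (\<lambda>i j. \<Sum>l\<in>C. Z i l * Z' l j)"
    "\<And>b z Z. rp b Z \<Longrightarrow> rp (cc z * b) (\<lambda>i j. z * Z i j)"
    "\<And>b Z. rp b Z \<Longrightarrow> rp (star b) (\<lambda>i j. cnj (Z j i))"
proof -
  obtain c \<delta> where av: "approx_vectors C c X \<delta>" and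
    all: "\<And>l j k. k \<in> C \<Longrightarrow> (l, j) \<in> R \<Longrightarrow> (\<lambda>N. X l j * c N k - (if j = k \<and> l \<in> C then c N l else 0)) \<longlonglongrightarrow> 0"
    using clique_approx_vectors[OF C] by blast
  interpret approx_vectors C c X \<delta> by (rule av)
  have repX: "rep (X l j) (munit l j)" if "(l, j) \<in> R" for l j
    unfolding rep_def
  proof
    fix k assume k: "k \<in> C"
    have "(\<Sum>i\<in>C. cc (munit l j i k) * c N i) = (if j = k \<and> l \<in> C then c N l else 0)" for N
    proof -
      have "(\<Sum>i\<in>C. cc (munit l j i k) * c N i) = (\<Sum>i\<in>C. if i = l then (if j = k then c N l else 0) else 0)"
        by (intro sum.cong) (auto simp: munit_def)
      then show ?thesis using finC by simp
    qed
    then show "(\<lambda>N. X l j * c N k - (\<Sum>i\<in>C. cc (munit l j i k) * c N i)) \<longlonglongrightarrow> 0"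
      using all[OF k that] by simp
  qed
  have rep2X: "rep2 (X l j) (munit l j)" if "(l, j) \<in> R" for l j
  proof -
    have "(j, l) \<in> R" using that tol by (auto simp: tol_rel_def sym_def)
    moreover have "(\<lambda>a b. cnj (munit l j b a)) = munit j l" by (auto simp: munit_def fun_eq_iff)
    ultimately show ?thesis using repX that by (simp add: rep2_def star_X)
  qed
  have rep2K: "rep2 (K x) x" if x: "x \<in> ER n R" for x
  proof -
    have "rep2 (\<Sum>p\<in>R. cc (x (fst p) (snd p)) * X (fst p) (snd p))
        (\<lambda>i j. \<Sum>p\<in>R. x (fst p) (snd p) * munit (fst p) (snd p) i j)"
      by (rule rep2_sum, rule rep2_scale, rule rep2X) simp
    then show ?thesis using ER_decomp[OF x] K_decomp[OF x] by simp
  qed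
  define T where "T = {b \<in> carrier B. \<exists>Z. rep2 (emb B b) Z}"
  have "cstar_gen B (\<kappa> ` ER n R) \<subseteq> T"
    unfolding cstar_gen_def
  proof (rule Inter_lower, rule CollectI, intro conjI ballI allI impI)
    show "\<kappa> ` ER n R \<subseteq> T"
      using rep2K by (auto simp: T_def kappa_rules K_def)
    show "T \<subseteq> carrier B" by (auto simp: T_def)
    show "ca_one B \<in> T"
      using rep2K[OF ER_closed(2)] by (auto simp: T_def kappa_rules K_def)
    show "ca_zero B \<in> T" using rep2_zero by (auto simp: T_def emb_zero)
    show "ca_add B b d \<in> T" "ca_mul B b d \<in> T" if bd: "b \<in> T" "d \<in> T" for b d
    proof -
      obtain Z Z' where Z: "b \<in> carrier B" "rep2 (emb B b) Z" "d \<in> carrier B" "rep2 (emb B d) Z'"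
        using bd unfolding T_def by blast
      show "ca_add B b d \<in> T" unfolding T_def
        using Z rep2_add[OF Z(2,4)] by (intro CollectI conjI exI) (simp_all add: emb_add)
      show "ca_mul B b d \<in> T" unfolding T_def
        using Z rep2_mult[OF Z(2,4)] by (intro CollectI conjI exI) (simp_all add: emb_mul)
    qed
    show "ca_smult B z b \<in> T" "ca_star B b \<in> T" if b: "b \<in> T" for z b
    proof -
      obtain Z where Z: "b \<in> carrier B" "rep2 (emb B b) Z"
        using b unfolding T_def by blast
      show "ca_smult B z b \<in> T" unfolding T_def
        using Z rep2_scale[OF Z(2), of z] by (intro CollectI conjI exI) (simp_all add: emb_smult)
      show "ca_star B b \<in> T" unfolding T_def
        using Z rep2_star[OF Z(2)] by (intro CollectI conjI exI) (simp_all add: emb_star)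
    qed
    fix f L assume f: "(\<forall>k. f k \<in> T) \<and> L \<in> carrier B \<and> (\<lambda>k. ca_norm B (ca_sub B (f k) L)) \<longlonglongrightarrow> 0"
    then have fc: "\<And>k. f k \<in> carrier B" "L \<in> carrier B" by (auto simp: T_def)
    have "\<forall>k. \<exists>Z. rep2 (emb B (f k)) Z" using f by (auto simp: T_def)
    then obtain Z where Z: "\<And>k. rep2 (emb B (f k)) (Z k)" by metis
    have "(\<lambda>k. norm (emb B (f k) - emb B L)) \<longlonglongrightarrow> 0"
      using f fc by (simp add: emb_sub[symmetric] norm_emb)
    then have "(\<lambda>k. emb B (f k)) \<longlonglongrightarrow> emb B L"
      by (simp add: tendsto_norm_zero_iff LIM_zero_iff)
    from rep2_limit[OF Z this] show "L \<in> T" using fc by (simp add: T_def)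
  qed
  then have T: "carrier B \<subseteq> T" unfolding kappa_gen .
  show ?thesis
  proof (rule that[of rep2])
    show "\<exists>Z. rep2 (emb B b) Z" if "b \<in> carrier B" for b
      using that T by (auto simp: T_def)
    show "Z i j = Z' i j" if "rep2 b Z" "rep2 b Z'" "i \<in> C" "j \<in> C" for b Z Z' i j
      using rep_unique[of b Z Z' i j] that by (simp add: rep2_def)
  qed (fact rep2K rep2_add rep2_mult rep2_scale rep2_star)+
qed

text \<open>A representing matrix is chosen for every element. Its entries over \<open>C\<close> are
  unique, so the choice respects the operations there; entries outside \<open>C\<close> are
  arbitrary, whence the restriction of all equations to \<open>C\<close>.\<close>

lemma clique_hom:
  assumes C: "C \<in> max_cliques n R"
  shows "\<exists>\<Psi> :: 'b \<Rightarrow> nat \<Rightarrow> nat \<Rightarrow> complex. \<forall>i\<in>C. \<forall>j\<in>C.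
    (\<forall>b\<in>carrier B. \<forall>d\<in>carrier B. \<Psi> (ca_add B b d) i j = \<Psi> b i j + \<Psi> d i j \<and>
      \<Psi> (ca_mul B b d) i j = (\<Sum>l\<in>C. \<Psi> b i l * \<Psi> d l j)) \<and>
    (\<forall>z. \<forall>b\<in>carrier B. \<Psi> (ca_smult B z b) i j = z * \<Psi> b i j) \<and>
    (\<forall>b\<in>carrier B. \<Psi> (ca_star B b) i j = cnj (\<Psi> b j i)) \<and>
    (\<forall>x\<in>ER n R. \<Psi> (\<kappa> x) i j = x i j)"
proof (cases "C = {}")
  case False
  obtain rp where rp: "\<And>b. b \<in> carrier B \<Longrightarrow> \<exists>Z. rp (emb B b) Z"
    "\<And>x. x \<in> ER n R \<Longrightarrow> rp (K x) x"
    "\<And>b Z Z' i j. rp b Z \<Longrightarrow> rp b Z' \<Longrightarrow> i \<in> C \<Longrightarrow> j \<in> C \<Longrightarrow> Z i j = Z' i j"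
    "\<And>b d Z Z'. rp b Z \<Longrightarrow> rp d Z' \<Longrightarrow> rp (b + d) (\<lambda>i j. Z i j + Z' i j)"
    "\<And>b d Z Z'. rp b Z \<Longrightarrow> rp d Z' \<Longrightarrow> rp (b * d) (\<lambda>i j. \<Sum>l\<in>C. Z i l * Z' l j)"
    "\<And>b z Z. rp b Z \<Longrightarrow> rp (cc z * b) (\<lambda>i j. z * Z i j)"
    "\<And>b Z. rp b Z \<Longrightarrow> rp (star b) (\<lambda>i j. cnj (Z j i))"
    by (rule clique_representation[OF C False]) (rule that)
  define \<Psi> where "\<Psi> b = (SOME Z. rp (emb B b) Z)" for b
  have \<Psi>: "rp (emb B b) (\<Psi> b)" if "b \<in> carrier B" for b
    unfolding \<Psi>_def using rp(1)[OF that] by (rule someI_ex)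
  have "\<Psi> (ca_add B b d) i j = \<Psi> b i j + \<Psi> d i j"
    "\<Psi> (ca_mul B b d) i j = (\<Sum>l\<in>C. \<Psi> b i l * \<Psi> d l j)"
    if "i \<in> C" "j \<in> C" "b \<in> carrier B" "d \<in> carrier B" for i j b d
    using rp(3)[OF \<Psi>[of "ca_add B b d"], OF _ _ that(1,2)] rp(4)[OF \<Psi>[OF that(3)] \<Psi>[OF that(4)]]
      rp(3)[OF \<Psi>[of "ca_mul B b d"], OF _ _ that(1,2)] rp(5)[OF \<Psi>[OF that(3)] \<Psi>[OF that(4)]] that(3,4)
    by (simp_all add: emb_add emb_mul)
  moreover have "\<Psi> (ca_smult B z b) i j = z * \<Psi> b i j" if "i \<in> C" "j \<in> C" "b \<in> carrier B" for i j z b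
    using rp(3)[OF \<Psi>[of "ca_smult B z b"], OF _ _ that(1,2)] rp(6)[OF \<Psi>[OF that(3)], of z] that(3)
    by (simp add: emb_smult)
  moreover have "\<Psi> (ca_star B b) i j = cnj (\<Psi> b j i)" if "i \<in> C" "j \<in> C" "b \<in> carrier B" for i j b
    using rp(3)[OF \<Psi>[of "ca_star B b"], OF _ _ that(1,2)] rp(7)[OF \<Psi>[OF that(3)]] that(3)
    by (simp add: emb_star)
  moreover have "\<Psi> (\<kappa> x) i j = x i j" if "i \<in> C" "j \<in> C" "x \<in> ER n R" for i j x
    using rp(3)[OF \<Psi>[OF kappa_rules(1)[OF that(3)]] rp(2)[OF that(3), unfolded K_def] that(1,2)] .
  ultimately show ?thesis by (intro exI[of _ \<Psi>] ballI conjI allI)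
qed simp

text \<open>Supplies the continuity that \<open>star_hom\<close> does not contain. For
  \<open>d\<close> of norm at most 1, \<open>1 - star d * d\<close> is a square
  \<open>star p * p\<close>. Applying \<open>\<psi>\<close> and comparing diagonal entries bounds
  the columns of \<open>\<psi> d\<close> by 1.\<close>

lemma star_hom_entry_le:
  assumes hom: "star_hom B (block_alg n R) \<psi>" and one: "\<psi> (ca_one B) = ca_one (block_alg n R)"
    and b: "b \<in> carrier B" and C: "C \<in> max_cliques n R" "i \<in> C" "j \<in> C"
  shows "cmod (\<psi> b C i j) \<le> ca_norm B b"
proof (rule field_le_epsilon)
  fix e :: real assume "e > 0"
  \<comment> \<open>The added \<open>e\<close> permits division by \<open>s\<close> when the norm of
    \<open>b\<close> is 0.\<close>
  define s where "s = ca_norm B b + e"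
  have s: "s > 0" "ca_norm B b \<le> s" using norm_rules(1)[OF b] \<open>e > 0\<close> by (auto simp: s_def)
  define d where "d = ca_smult B (complex_of_real (1 / s)) b"
  have d: "d \<in> carrier B" using b by (simp add: d_def)
  have "norm (emb B d) \<le> 1"
    using d b s by (simp add: norm_emb) (simp add: d_def norm_rules(5) norm_divide field_simps)
  then have nw: "norm (star (emb B d) * emb B d) \<le> 1"
    by (simp add: norm_star_mult power_le_one)
  define q where "q = sqr (star (emb B d) * emb B d)"
  have q: "star q = q" "q * q = 1 - star (emb B d) * emb B d"
    unfolding q_def using star_sqr[OF nw] sqr_square[OF nw] by (auto simp: star_mult)
  define p where "p = ev B q"
  have p: "p \<in> carrier B" by (simp add: p_def ev_simps)
  have "ca_add B (ca_mul B (ca_star B p) p) (ca_mul B (ca_star B d) d) = ca_one B"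
  proof -
    have "star q * q + star (emb B d) * emb B d = 1" using q by simp
    then have "ev B (star q * q + star (emb B d) * emb B d) = ev B 1" by simp
    then show ?thesis using d by (simp add: ev_simps p_def)
  qed
  then have "\<psi> (ca_add B (ca_mul B (ca_star B p) p) (ca_mul B (ca_star B d) d)) C j j = ca_one (block_alg n R) C j j"
    using one by simp
  moreover have "\<psi> (ca_add B (ca_mul B (ca_star B p) p) (ca_mul B (ca_star B d) d)) =
      ca_add (block_alg n R) (ca_mul (block_alg n R) (ca_star (block_alg n R) (\<psi> p)) (\<psi> p))
        (ca_mul (block_alg n R) (ca_star (block_alg n R) (\<psi> d)) (\<psi> d))"
    using hom p d unfolding star_hom_def by (simp del: block_alg_sel)
  ultimately have "(\<Sum>k\<in>C. cnj (\<psi> p C k j) * \<psi> p C k j) + (\<Sum>k\<in>C. cnj (\<psi> d C k j) * \<psi> d C k j) = 1"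
    using C by simp
  moreover have "cnj z * z = complex_of_real ((cmod z)\<^sup>2)" for z
    by (metis complex_norm_square mult.commute)
  ultimately have "complex_of_real ((\<Sum>k\<in>C. (cmod (\<psi> p C k j))\<^sup>2) + (\<Sum>k\<in>C. (cmod (\<psi> d C k j))\<^sup>2)) = 1"
    by (simp only: of_real_add of_real_sum)
  then have "(\<Sum>k\<in>C. (cmod (\<psi> p C k j))\<^sup>2) + (\<Sum>k\<in>C. (cmod (\<psi> d C k j))\<^sup>2) = 1"
    by (simp only: of_real_eq_1_iff)
  moreover have "(\<Sum>k\<in>C. (cmod (\<psi> p C k j))\<^sup>2) \<ge> 0" by (simp add: sum_nonneg)
  moreover have "(cmod (\<psi> d C i j))\<^sup>2 \<le> (\<Sum>k\<in>C. (cmod (\<psi> d C k j))\<^sup>2)"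
    using C finite_max_clique[OF C(1)] by (intro member_le_sum[of i C "\<lambda>k. (cmod (\<psi> d C k j))\<^sup>2"]) auto
  ultimately have "(cmod (\<psi> d C i j))\<^sup>2 \<le> 1" by linarith
  then have "cmod (\<psi> d C i j) \<le> 1" by (simp add: power_le_one_iff abs_square_le_1)
  moreover have "\<psi> d C i j = complex_of_real (1 / s) * \<psi> b C i j"
    using hom b unfolding star_hom_def d_def by simp
  ultimately have "cmod (\<psi> b C i j) / s \<le> 1" using s by (simp add: norm_mult norm_divide)
  then show "cmod (\<psi> b C i j) \<le> ca_norm B b + e" using s by (simp add: s_def)
qed

text \<open>The elements on which both maps agree form a closed subalgebra containing the
  generators; closedness uses the entrywise bound. That the maps are unital follows from their
  values on \<open>\<kappa> (idX n)\<close>.\<close>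

lemma star_hom_unique:
  assumes h: "star_hom B (block_alg n R) \<psi>" "star_hom B (block_alg n R) \<psi>'"
    and eq: "\<And>x. x \<in> ER n R \<Longrightarrow> \<psi> (\<kappa> x) = Phi n R x" "\<And>x. x \<in> ER n R \<Longrightarrow> \<psi>' (\<kappa> x) = Phi n R x"
    and b: "b \<in> carrier B"
  shows "\<psi>' b = \<psi> b"
proof -
  let ?A = "block_alg n R"
  have Phi1: "Phi n R (idX n) = ca_one ?A"
    using complete_order_embedding_Phi[OF tol ch] unfolding complete_order_embedding_def by blast
  have one: "\<psi> (ca_one B) = ca_one ?A" "\<psi>' (ca_one B) = ca_one ?A"
    using eq[OF ER_closed(2)] unfolding kappa_rules(4) Phi1 by auto
  have zero: "\<phi> (ca_zero B) = ca_zero ?A" if "star_hom B ?A \<phi>" for \<phi>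
  proof -
    have "\<phi> (ca_smult B 0 (ca_zero B)) = ca_smult ?A 0 (\<phi> (ca_zero B))"
      using that unfolding star_hom_def by (simp del: block_alg_sel)
    then show ?thesis by (simp add: smult_zero)
  qed
  define T where "T = {b \<in> carrier B. \<psi>' b = \<psi> b}"
  have "cstar_gen B (\<kappa> ` ER n R) \<subseteq> T"
    unfolding cstar_gen_def
  proof (rule Inter_lower, rule CollectI, intro conjI ballI allI impI)
    show "\<kappa> ` ER n R \<subseteq> T" using eq by (auto simp: T_def kappa_rules)
    show "T \<subseteq> carrier B" by (auto simp: T_def)
    show "ca_one B \<in> T" "ca_zero B \<in> T" using one zero h by (auto simp: T_def)
    show "ca_add B x y \<in> T" "ca_mul B x y \<in> T" if "x \<in> T" "y \<in> T" for x y
      using that h unfolding star_hom_def T_def by (simp_all del: block_alg_sel)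
    show "ca_smult B z x \<in> T" if "x \<in> T" for z x
      using that h unfolding star_hom_def T_def by (simp del: block_alg_sel)
    show "ca_star B x \<in> T" if "x \<in> T" for x
      using that h unfolding star_hom_def T_def by (simp del: block_alg_sel)
    fix f L assume f: "(\<forall>k. f k \<in> T) \<and> L \<in> carrier B \<and> (\<lambda>k. ca_norm B (ca_sub B (f k) L)) \<longlonglongrightarrow> 0"
    then have fc: "\<And>k. f k \<in> carrier B" "L \<in> carrier B" by (auto simp: T_def)
    have lim: "(\<lambda>k. \<phi> (f k) C i j) \<longlonglongrightarrow> \<phi> L C i j"
      if \<phi>: "star_hom B ?A \<phi>" "\<phi> (ca_one B) = ca_one ?A" and C: "C \<in> max_cliques n R" "i \<in> C" "j \<in> C" for \<phi> C i j
    proof -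
      have "\<phi> (ca_sub B (f k) L) C i j = \<phi> (f k) C i j - \<phi> L C i j" for k
        using \<phi>(1) fc unfolding star_hom_def ca_sub_def by simp
      then have "cmod (\<phi> (f k) C i j - \<phi> L C i j) \<le> ca_norm B (ca_sub B (f k) L)" for k
        using star_hom_entry_le[OF \<phi> _ C, of "ca_sub B (f k) L"] fc by simp
      then have "(\<lambda>k. \<phi> (f k) C i j - \<phi> L C i j) \<longlonglongrightarrow> 0"
        using f by (intro Lim_null_comparison[of "\<lambda>k. \<phi> (f k) C i j - \<phi> L C i j"
            "\<lambda>k. ca_norm B (ca_sub B (f k) L)"] always_eventually allI) auto
      then show ?thesis by (simp add: LIM_zero_iff)
    qed
    have "\<psi>' L C i j = \<psi> L C i j" for C i j
    proof (cases "C \<in> max_cliques n R \<and> i \<in> C \<and> j \<in> C")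
      case True
      then have C: "C \<in> max_cliques n R" "i \<in> C" "j \<in> C" by auto
      have "\<psi>' (f k) = \<psi> (f k)" for k using f by (simp add: T_def)
      then show ?thesis
        using LIMSEQ_unique[OF lim[OF h(2) one(2) C]] lim[OF h(1) one(1) C] by simp
    next
      case False
      have "\<psi>' L \<in> carrier ?A" "\<psi> L \<in> carrier ?A"
        using h fc unfolding star_hom_def by blast+
      then show ?thesis using False by auto
    qed
    then show "L \<in> T" using fc by (auto simp: T_def fun_eq_iff)
  qed
  then show ?thesis using b unfolding kappa_gen by (auto simp: T_def)
qed

lemma envelope_factors_Phi: "envelope_factors n R (block_alg n R) (Phi n R) B \<kappa>"
proof -
  let ?A = "block_alg n R"
  have "\<exists>\<Psi> :: nat set \<Rightarrow> 'b \<Rightarrow> nat \<Rightarrow> nat \<Rightarrow> complex. \<forall>C\<in>max_cliques n R. \<forall>i\<in>C. \<forall>j\<in>C.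
    (\<forall>b\<in>carrier B. \<forall>d\<in>carrier B. \<Psi> C (ca_add B b d) i j = \<Psi> C b i j + \<Psi> C d i j \<and>
      \<Psi> C (ca_mul B b d) i j = (\<Sum>l\<in>C. \<Psi> C b i l * \<Psi> C d l j)) \<and>
    (\<forall>z. \<forall>b\<in>carrier B. \<Psi> C (ca_smult B z b) i j = z * \<Psi> C b i j) \<and>
    (\<forall>b\<in>carrier B. \<Psi> C (ca_star B b) i j = cnj (\<Psi> C b j i)) \<and>
    (\<forall>x\<in>ER n R. \<Psi> C (\<kappa> x) i j = x i j)"
    by (intro bchoice ballI clique_hom)
  then obtain \<Psi> :: "nat set \<Rightarrow> 'b \<Rightarrow> nat \<Rightarrow> nat \<Rightarrow> complex" where \<Psi>: "\<forall>C\<in>max_cliques n R. \<forall>i\<in>C. \<forall>j\<in>C.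
    (\<forall>b\<in>carrier B. \<forall>d\<in>carrier B. \<Psi> C (ca_add B b d) i j = \<Psi> C b i j + \<Psi> C d i j \<and>
      \<Psi> C (ca_mul B b d) i j = (\<Sum>l\<in>C. \<Psi> C b i l * \<Psi> C d l j)) \<and>
    (\<forall>z. \<forall>b\<in>carrier B. \<Psi> C (ca_smult B z b) i j = z * \<Psi> C b i j) \<and>
    (\<forall>b\<in>carrier B. \<Psi> C (ca_star B b) i j = cnj (\<Psi> C b j i)) \<and>
    (\<forall>x\<in>ER n R. \<Psi> C (\<kappa> x) i j = x i j)"
    by (rule exE)
  note \<Psi>C = \<Psi>[THEN bspec, THEN bspec, THEN bspec]
  have \<Psi>_rules: "\<Psi> C (ca_add B b d) i j = \<Psi> C b i j + \<Psi> C d i j"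
    "\<Psi> C (ca_mul B b d) i j = (\<Sum>l\<in>C. \<Psi> C b i l * \<Psi> C d l j)"
    "\<Psi> C (ca_smult B z b) i j = z * \<Psi> C b i j" "\<Psi> C (ca_star B b) i j = cnj (\<Psi> C b j i)"
    if "C \<in> max_cliques n R" "i \<in> C" "j \<in> C" "b \<in> carrier B" "d \<in> carrier B" for C i j b d z
    using \<Psi>C[OF that(1-3)] that(4,5) by simp_all
  have \<Psi>_kappa: "\<Psi> C (\<kappa> x) i j = x i j"
    if "C \<in> max_cliques n R" "i \<in> C" "j \<in> C" "x \<in> ER n R" for C i j x
    using \<Psi>C[OF that(1-3)] that(4) by simp
  define \<psi> where "\<psi> b = (\<lambda>C i j. if C \<in> max_cliques n R \<and> i \<in> C \<and> j \<in> C then \<Psi> C b i j else 0)" for b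
  have hom: "star_hom B ?A \<psi>"
    unfolding star_hom_def
  proof (intro conjI ballI allI)
    fix b d assume b: "b \<in> carrier B" and d: "d \<in> carrier B"
    show "\<psi> (ca_add B b d) = ca_add ?A (\<psi> b) (\<psi> d)"
      using b d by (simp add: \<psi>_def fun_eq_iff \<Psi>_rules)
    have "(if C \<in> max_cliques n R \<and> i \<in> C \<and> j \<in> C then \<Psi> C (ca_mul B b d) i j else 0) =
        (\<Sum>l\<in>C. \<psi> b C i l * \<psi> d C l j)" for C i j
    proof (cases "C \<in> max_cliques n R \<and> i \<in> C \<and> j \<in> C")
      case True
      then show ?thesis using b d by (simp add: \<psi>_def \<Psi>_rules(2))
    next
      case False
      then have "\<psi> b C i l * \<psi> d C l j = 0" for l by (auto simp: \<psi>_def)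
      then have "(\<Sum>l\<in>C. \<psi> b C i l * \<psi> d C l j) = 0" by (intro sum.neutral) blast
      with False show ?thesis by (simp only: if_False)
    qed
    then show "\<psi> (ca_mul B b d) = ca_mul ?A (\<psi> b) (\<psi> d)"
      unfolding block_alg_sel by (subst \<psi>_def) (simp only:)
  next
    fix b assume b: "b \<in> carrier B"
    show "\<psi> b \<in> carrier ?A" by (auto simp: \<psi>_def)
    show "\<psi> (ca_smult B z b) = ca_smult ?A z (\<psi> b)" for z
      using b by (simp add: \<psi>_def fun_eq_iff \<Psi>_rules)
    show "\<psi> (ca_star B b) = ca_star ?A (\<psi> b)"
      using b by (simp add: \<psi>_def fun_eq_iff \<Psi>_rules conj_commute)
  qed
  have eq: "\<psi> (\<kappa> x) = Phi n R x" if "x \<in> ER n R" for x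
    using that by (simp add: \<psi>_def Phi_def fun_eq_iff \<Psi>_kappa)
  show ?thesis
    unfolding envelope_factors_def
    using hom eq star_hom_unique[OF hom _ eq] by blast
qed

end

theorem mainTheorem6:
  fixes n :: nat and R :: "(nat \<times> nat) set"
    and B :: "('b, 'k) cstar_alg_scheme" and \<kappa> :: "(nat \<Rightarrow> nat \<Rightarrow> complex) \<Rightarrow> 'b"
  assumes "tol_rel n R" and "chordal n R"
  shows "cstar_extension n R (block_alg n R) (Phi n R) \<and>
         (cstar_extension n R B \<kappa> \<longrightarrow> envelope_factors n R (block_alg n R) (Phi n R) B \<kappa>)"
proof (intro conjI impI)
  show "cstar_extension n R (block_alg n R) (Phi n R)"
    by (rule cstar_extension_Phi[OF assms])
  assume ext: "cstar_extension n R B \<kappa>"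
  then interpret dual_extension B n R \<kappa>
    using assms by unfold_locales (auto simp: cstar_extension_def)
  show "envelope_factors n R (block_alg n R) (Phi n R) B \<kappa>"
    by (rule envelope_factors_Phi)
qed

end
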